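(* Consider the ensemble Kalman smoother (EnKS) ensembles $[X_{0:i|i}^{n}]_{n=1}^{N}$ of size $N\ge 2$ and the reference ensembles $[U_{0:i|i}^{n}]_{n=1}^{N}$ built from the same random inputs, both defined in the context for a linear state-space model. Then for each time step $i=0,\ldots,k$ and each $N\ge 2$, the random matrix $$\begin{bmatrix} X_{0:i|i}^{1},\ldots,X_{0:i|i}^{N}\\ U_{0:i|i}^{1},\ldots,U_{0:i|i}^{N}\end{bmatrix}$$ has exchangeable columns. Moreover, for each $i=0,\ldots,k$ and all $1\le p<\infty$, as $N\to\infty$, $$X_{0:i|i}^{1}\to U_{0:i|i}^{1},\qquad \bar X_{0:i|i}^{N}\to E\left(U_{0:i|i}^{1}\right),\qquad P_{0:i|i}^{N}\to P_{0:i|i}\qquad\text{in } L^p,$$ where $\bar X_{0:i|i}^{N}$ and $P_{0:i|i}^{N}$ are the sample mean and sample covariance of the ensemble $[X_{0:i|i}^{n}]_{n=1}^{N}$, and $P_{0:i|i}$ is the Kalman smoother covariance.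
   Context: Norms: $|\cdot|$ is the Euclidean norm of a vector or the spectral norm of a matrix; $\|X\|_p=E(|X|^p)^{1/p}$; convergence in $L^p$ is convergence in $\|\cdot\|_p$. Random vectors $Z^1,\ldots,Z^N$ are exchangeable if $(Z^{\pi(1)},\ldots,Z^{\pi(N)})$ has the same joint distribution as $(Z^1,\ldots,Z^N)$ for every permutation $\pi$ of $\{1,\dots,N\}$. The sample mean and sample covariance of $Z^1,\dots,Z^N$ are $\bar Z^N=\frac1N\sum_{n}Z^n$ and $\frac1{N-1}\sum_n (Z^n-\bar Z^N)(Z^n-\bar Z^N)^{\mathrm T}$. Data: integers $k,m\ge1$ and $d_i\ge 1$; matrices $M_i\in\mathbf R^{m\times m}$, $H_i\in\mathbf R^{d_i\times m}$; fixed (deterministic) vectors $x_{\mathrm b},\mu_i\in\mathbf R^m$, $y_i\in\mathbf R^{d_i}$; covariance matrices $B,Q_i\in\mathbf R^{m\times m}$ (symmetric positive semidefinite) and $R_i\in\mathbf R^{d_i\times d_i}$ (symmetric positive definite), $i=1,\ldots,k$. Put $\tilde H_i=[0,\ldots,0,H_i]$ and $\tilde M_i=[0,\ldots,0,M_i]$, acting on composite vectors with blocks $0,\ldots,i$ and $0,\ldots,i-1$, respectively (so they act on the last block only). Kalman smoother: $P_{0:0|0}=B$ and, for $i=1,\dots,k$, with $F_i=\begin{bmatrix}I\\ \tilde M_i\end{bmatrix}$, $P_{0:i|i-1}=F_iP_{0:i-1|i-1}F_i^{\mathrm T}+\begin{bmatrix}0&0\\0&Q_i\end{bmatrix}$,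 $K_i=P_{0:i|i-1}\tilde H_i^{\mathrm T}(\tilde H_iP_{0:i|i-1}\tilde H_i^{\mathrm T}+R_i)^{-1}$, $P_{0:i|i}=(I-K_i\tilde H_i)P_{0:i|i-1}$. Random inputs: for $n=1,2,\ldots$ and $i=1,\ldots,k$, mutually independent random vectors $X_{0|0}^n\sim N(x_{\mathrm b},B)$, $V_i^n\sim N(0,Q_i)$, $W_i^n\sim N(0,R_i)$. EnKS with ensemble size $N\ge2$: start from $X_{0:0|0}^n=X_{0|0}^n$, $n=1,\ldots,N$. For $i=1,\ldots,k$, let $X_{i-1|i-1}^n$ be the last block of $X_{0:i-1|i-1}^n$, set $X_{i|i-1}^n=M_iX_{i-1|i-1}^n+\mu_i+V_i^n$, let $X_{0:i|i-1}^n$ be $X_{0:i-1|i-1}^n$ with the block $X_{i|i-1}^n$ appended, let $P_{0:i|i-1}^N$ be the sample covariance of $[X_{0:i|i-1}^n]_{n=1}^N$, and set $$X_{0:i|i}^n=X_{0:i|i-1}^n+P_{0:i|i-1}^N\tilde H_i^{\mathrm T}\left(\tilde H_iP_{0:i|i-1}^N\tilde H_i^{\mathrm T}+R_i\right)^{-1}\left(y_i-W_i^n-H_iX_{i|i-1}^n\right).$$ (These quantities depend on $N$.) Reference ensemble: $U_{0:0|0}^n=X_{0|0}^n$; for $i=1,\ldots,k$, $U_{i|i-1}^n=M_iU_{i-1|i-1}^n+\mu_i+V_i^n$ (with $U_{i-1|i-1}^n$ the last block of $U_{0:i-1|i-1}^n$), $U_{0:i|i-1}^n$ is $U_{0:i-1|i-1}^n$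 with $U_{i|i-1}^n$ appended, and, with the exact covariance $C_i=\operatorname{Cov}(U_{0:i|i-1}^1)$, $$U_{0:i|i}^n=U_{0:i|i-1}^n+C_i\tilde H_i^{\mathrm T}\left(\tilde H_iC_i\tilde H_i^{\mathrm T}+R_i\right)^{-1}\left(y_i-W_i^n-H_iU_{i|i-1}^n\right).$$ *)

theory Defs
  imports
    "HOL-Probability.Probability"
    "HOL-Combinatorics.Permutations"
    "Jordan_Normal_Form.Gauss_Jordan_Elimination"
begin

text \<open>
  Block dimensions vary with the time step, so vectors and matrices are the size-indexed ones of
  Jordan_Normal_Form; the same-named notions of HOL-Analysis are hidden.
\<close>

hide_type (open) Finite_Cartesian_Product.vec
hide_const (open) Finite_Cartesian_Product.vec Finite_Cartesian_Product.mat
  Finite_Cartesian_Product.transpose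
no_notation inner (infix "\<bullet>" 70)
no_notation Finite_Cartesian_Product.vec_nth (infixl "$" 90)


section \<open>Norms and matrices\<close>

definition euclid_norm :: "real vec \<Rightarrow> real" where
  "euclid_norm v = sqrt (v \<bullet> v)"

text \<open>The unit ball rather than the unit sphere, so that the supremum is over a nonempty set.\<close>

definition spectral_norm :: "real mat \<Rightarrow> real" where
  "spectral_norm A =
     (SUP v \<in> {v \<in> carrier_vec (dim_col A). euclid_norm v \<le> 1}. euclid_norm (A *\<^sub>v v))"

definition psd_matrix :: "nat \<Rightarrow> real mat \<Rightarrow> bool" where
  "psd_matrix d A \<longleftrightarrow> A \<in> carrier_mat d d \<and> A\<^sup>T = A \<and>
     (\<forall>x \<in> carrier_vec d. 0 \<le> x \<bullet> (A *\<^sub>v x))"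

definition pd_matrix :: "nat \<Rightarrow> real mat \<Rightarrow> bool" where
  "pd_matrix d A \<longleftrightarrow> A \<in> carrier_mat d d \<and> A\<^sup>T = A \<and>
     (\<forall>x \<in> carrier_vec d. x \<noteq> 0\<^sub>v d \<longrightarrow> 0 < x \<bullet> (A *\<^sub>v x))"

text \<open>\<open>on_last_block c A\<close> is the block row \<open>[0, A]\<close> with \<open>c\<close> zero columns in front of \<open>A\<close>.\<close>

definition on_last_block :: "nat \<Rightarrow> real mat \<Rightarrow> real mat" where
  "on_last_block c A =
     four_block_mat (0\<^sub>m (dim_row A) c) A (0\<^sub>m 0 c) (0\<^sub>m 0 (dim_col A))"


section \<open>Random vectors\<close>

text \<open>The Borel space of \<open>\<real>\<^sup>d\<close>, transported from the product sigma-algebra along the coordinates.\<close>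

definition vec_borel :: "nat \<Rightarrow> real vec measure" where
  "vec_borel d = vimage_algebra (carrier_vec d) (\<lambda>v. \<lambda>j\<in>{..<d}. v $ j)
     (\<Pi>\<^sub>M j\<in>{..<d}. (borel :: real measure))"

definition mean_vec :: "'w measure \<Rightarrow> nat \<Rightarrow> ('w \<Rightarrow> real vec) \<Rightarrow> real vec" where
  "mean_vec P d Z = vec d (\<lambda>a. \<integral>\<omega>. Z \<omega> $ a \<partial>P)"

definition cov_mat :: "'w measure \<Rightarrow> nat \<Rightarrow> ('w \<Rightarrow> real vec) \<Rightarrow> real mat" where
  "cov_mat P d Z = mat d d (\<lambda>(a, b).
     \<integral>\<omega>. (Z \<omega> $ a - mean_vec P d Z $ a) * (Z \<omega> $ b - mean_vec P d Z $ b) \<partial>P)"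

text \<open>The normal law on the line with variance \<open>v \<ge> 0\<close>; it is a point mass when \<open>v = 0\<close>.\<close>

definition normal_law :: "real \<Rightarrow> real \<Rightarrow> real measure" where
  "normal_law \<mu> v =
     (if v = 0 then return borel \<mu> else density lborel (normal_density \<mu> (sqrt v)))"

text \<open>
  The law \<open>N(\<mu>, \<Sigma>)\<close> with a possibly singular covariance: every linear functional \<open>u \<bullet> Z\<close> is
  normal with mean \<open>u \<bullet> \<mu>\<close> and variance \<open>u \<bullet> \<Sigma> u\<close>.
\<close>

definition gaussian_vec ::
  "'w measure \<Rightarrow> nat \<Rightarrow> ('w \<Rightarrow> real vec) \<Rightarrow> real vec \<Rightarrow> real mat \<Rightarrow> bool" where
  "gaussian_vec P d Z \<mu> \<Sigma> \<longleftrightarrow> Z \<in> P \<rightarrow>\<^sub>M vec_borel d \<and>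
     (\<forall>u \<in> carrier_vec d. distr P borel (\<lambda>\<omega>. u \<bullet> Z \<omega>) = normal_law (u \<bullet> \<mu>) (u \<bullet> (\<Sigma> *\<^sub>v u)))"

definition exchangeable ::
  "'w measure \<Rightarrow> nat \<Rightarrow> nat \<Rightarrow> (nat \<Rightarrow> 'w \<Rightarrow> real vec) \<Rightarrow> bool" where
  "exchangeable P d N Z \<longleftrightarrow>
     (\<forall>n \<in> {1..N}. Z n \<in> P \<rightarrow>\<^sub>M vec_borel d) \<and>
     (\<forall>\<pi>. \<pi> permutes {1..N} \<longrightarrow>
        distr P (\<Pi>\<^sub>M n\<in>{1..N}. vec_borel d) (\<lambda>\<omega>. \<lambda>n\<in>{1..N}. Z (\<pi> n) \<omega>) =
        distr P (\<Pi>\<^sub>M n\<in>{1..N}. vec_borel d) (\<lambda>\<omega>. \<lambda>n\<in>{1..N}. Z n \<omega>))"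

text \<open>\<open>E(|f|\<^sup>p)\<^sup>1\<^sup>/\<^sup>p\<close>, which is infinite when the moment is.\<close>

definition Lp_norm :: "'w measure \<Rightarrow> real \<Rightarrow> ('w \<Rightarrow> real) \<Rightarrow> ennreal" where
  "Lp_norm P p f = (let I = \<integral>\<^sup>+\<omega>. ennreal (\<bar>f \<omega>\<bar> powr p) \<partial>P in
     if I = \<infinity> then \<infinity> else ennreal (enn2real I powr (1 / p)))"

definition vec_converges_Lp ::
  "'w measure \<Rightarrow> real \<Rightarrow> (nat \<Rightarrow> 'w \<Rightarrow> real vec) \<Rightarrow> ('w \<Rightarrow> real vec) \<Rightarrow> bool" where
  "vec_converges_Lp P p Z Z' \<longleftrightarrow>
     (\<lambda>N. Lp_norm P p (\<lambda>\<omega>. euclid_norm (Z N \<omega> - Z' \<omega>))) \<longlonglongrightarrow> 0"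

definition mat_converges_Lp ::
  "'w measure \<Rightarrow> real \<Rightarrow> (nat \<Rightarrow> 'w \<Rightarrow> real mat) \<Rightarrow> ('w \<Rightarrow> real mat) \<Rightarrow> bool" where
  "mat_converges_Lp P p A A' \<longleftrightarrow>
     (\<lambda>N. Lp_norm P p (\<lambda>\<omega>. spectral_norm (A N \<omega> - A' \<omega>))) \<longlonglongrightarrow> 0"


section \<open>Ensembles\<close>

text \<open>The members of an ensemble of size \<open>N\<close> are numbered \<open>1, \<dots>, N\<close>.\<close>

definition sample_mean :: "nat \<Rightarrow> nat \<Rightarrow> (nat \<Rightarrow> real vec) \<Rightarrow> real vec" where
  "sample_mean d N Z = vec d (\<lambda>a. (\<Sum>n=1..N. Z n $ a) / real N)"

definition sample_cov :: "nat \<Rightarrow> nat \<Rightarrow> (nat \<Rightarrow> real vec) \<Rightarrow> real mat" where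
  "sample_cov d N Z = mat d d (\<lambda>(a, b).
     (\<Sum>n=1..N. (Z n $ a - sample_mean d N Z $ a) * (Z n $ b - sample_mean d N Z $ b))
       / (real N - 1))"


section \<open>The linear state-space model\<close>

record linear_model =
  horizon :: nat                    \<comment> \<open>\<open>k\<close>\<close>
  state_dim :: nat                  \<comment> \<open>\<open>m\<close>\<close>
  obs_dim :: "nat \<Rightarrow> nat"           \<comment> \<open>\<open>d\<^sub>i\<close>\<close>
  model_op :: "nat \<Rightarrow> real mat"     \<comment> \<open>\<open>M\<^sub>i\<close>\<close>
  obs_op :: "nat \<Rightarrow> real mat"       \<comment> \<open>\<open>H\<^sub>i\<close>\<close>
  prior_mean :: "real vec"          \<comment> \<open>\<open>x\<^sub>b\<close>\<close>
  model_shift :: "nat \<Rightarrow> real vec"  \<comment> \<open>\<open>\<mu>\<^sub>i\<close>\<close>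
  obs_data :: "nat \<Rightarrow> real vec"     \<comment> \<open>\<open>y\<^sub>i\<close>\<close>
  prior_cov :: "real mat"           \<comment> \<open>\<open>B\<close>\<close>
  model_cov :: "nat \<Rightarrow> real mat"    \<comment> \<open>\<open>Q\<^sub>i\<close>\<close>
  obs_cov :: "nat \<Rightarrow> real mat"      \<comment> \<open>\<open>R\<^sub>i\<close>\<close>

definition well_formed_model :: "linear_model \<Rightarrow> bool" where
  "well_formed_model S \<longleftrightarrow>
     1 \<le> horizon S \<and> 1 \<le> state_dim S \<and>
     prior_mean S \<in> carrier_vec (state_dim S) \<and>
     psd_matrix (state_dim S) (prior_cov S) \<and>
     (\<forall>i \<in> {1..horizon S}.
        1 \<le> obs_dim S i \<and>
        model_op S i \<in> carrier_mat (state_dim S) (state_dim S) \<and>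
        obs_op S i \<in> carrier_mat (obs_dim S i) (state_dim S) \<and>
        model_shift S i \<in> carrier_vec (state_dim S) \<and>
        obs_data S i \<in> carrier_vec (obs_dim S i) \<and>
        psd_matrix (state_dim S) (model_cov S i) \<and>
        pd_matrix (obs_dim S i) (obs_cov S i))"

text \<open>The dimension of a composite vector with blocks \<open>0, \<dots>, i\<close>.\<close>

definition comp_dim :: "linear_model \<Rightarrow> nat \<Rightarrow> nat" where
  "comp_dim S i = (i + 1) * state_dim S"


section \<open>The Kalman smoother\<close>

text \<open>The gain at step \<open>i\<close> belonging to a covariance \<open>C\<close> of composite states with blocks \<open>0, \<dots>, i\<close>.\<close>

definition kalman_gain :: "linear_model \<Rightarrow> nat \<Rightarrow> real mat \<Rightarrow> real mat" where
  "kalman_gain S i C = (let H = on_last_block (i * state_dim S) (obs_op S i) in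
     C * H\<^sup>T * the (mat_inverse (H * C * H\<^sup>T + obs_cov S i)))"

definition kalman_forecast_cov :: "linear_model \<Rightarrow> nat \<Rightarrow> real mat \<Rightarrow> real mat" where
  "kalman_forecast_cov S i C =
     (let m = state_dim S;
          F = 1\<^sub>m (i * m) @\<^sub>r on_last_block ((i - 1) * m) (model_op S i)
      in F * C * F\<^sup>T +
         four_block_mat (0\<^sub>m (i * m) (i * m)) (0\<^sub>m (i * m) m) (0\<^sub>m m (i * m)) (model_cov S i))"

primrec kalman_cov :: "linear_model \<Rightarrow> nat \<Rightarrow> real mat" where
  "kalman_cov S 0 = prior_cov S"
| "kalman_cov S (Suc j) =
     (let i = Suc j;
          C = kalman_forecast_cov S i (kalman_cov S j)
      in (1\<^sub>m (comp_dim S i) - kalman_gain S i C * on_last_block (i * state_dim S) (obs_op S i)) * C)"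


section \<open>The ensemble Kalman smoother and the reference ensemble\<close>

definition forecast :: "linear_model \<Rightarrow> nat \<Rightarrow> real vec \<Rightarrow> real vec \<Rightarrow> real vec" where
  "forecast S i x v =
     x @\<^sub>v (model_op S i *\<^sub>v vec_last x (state_dim S) + model_shift S i + v)"

definition analysis :: "linear_model \<Rightarrow> nat \<Rightarrow> real mat \<Rightarrow> real vec \<Rightarrow> real vec \<Rightarrow> real vec" where
  "analysis S i C x w =
     x + kalman_gain S i C *\<^sub>v (obs_data S i - w - obs_op S i *\<^sub>v vec_last x (state_dim S))"

text \<open>
  The random inputs are \<open>X0 n\<close>, \<open>V i n\<close> and \<open>W i n\<close>; \<open>enks S X0 V W N i n\<close> is the member \<open>n\<close>
  of the EnKS analysis ensemble of size \<open>N\<close> after step \<open>i\<close>, and \<open>ref_ens P S X0 V W i n\<close> is its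
  counterpart in the reference ensemble.
\<close>

primrec enks ::
  "linear_model \<Rightarrow> (nat \<Rightarrow> 'w \<Rightarrow> real vec) \<Rightarrow> (nat \<Rightarrow> nat \<Rightarrow> 'w \<Rightarrow> real vec) \<Rightarrow>
   (nat \<Rightarrow> nat \<Rightarrow> 'w \<Rightarrow> real vec) \<Rightarrow> nat \<Rightarrow> nat \<Rightarrow> nat \<Rightarrow> 'w \<Rightarrow> real vec" where
  "enks S X0 V W N 0 = X0"
| "enks S X0 V W N (Suc j) =
     (let i = Suc j;
          Xf = (\<lambda>n \<omega>. forecast S i (enks S X0 V W N j n \<omega>) (V i n \<omega>))
      in (\<lambda>n \<omega>. analysis S i (sample_cov (comp_dim S i) N (\<lambda>l. Xf l \<omega>)) (Xf n \<omega>) (W i n \<omega>)))"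

primrec ref_ens ::
  "'w measure \<Rightarrow> linear_model \<Rightarrow> (nat \<Rightarrow> 'w \<Rightarrow> real vec) \<Rightarrow> (nat \<Rightarrow> nat \<Rightarrow> 'w \<Rightarrow> real vec) \<Rightarrow>
   (nat \<Rightarrow> nat \<Rightarrow> 'w \<Rightarrow> real vec) \<Rightarrow> nat \<Rightarrow> nat \<Rightarrow> 'w \<Rightarrow> real vec" where
  "ref_ens P S X0 V W 0 = X0"
| "ref_ens P S X0 V W (Suc j) =
     (let i = Suc j;
          Uf = (\<lambda>n \<omega>. forecast S i (ref_ens P S X0 V W j n \<omega>) (V i n \<omega>))
      in (\<lambda>n \<omega>. analysis S i (cov_mat P (comp_dim S i) (Uf 1)) (Uf n \<omega>) (W i n \<omega>)))"

text \<open>A single index type, so that joint independence of all the inputs is one instance of \<open>indep_vars\<close>.\<close>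

datatype input = Prior nat | Model_noise nat nat | Obs_noise nat nat

fun input_vec ::
  "(nat \<Rightarrow> 'w \<Rightarrow> real vec) \<Rightarrow> (nat \<Rightarrow> nat \<Rightarrow> 'w \<Rightarrow> real vec) \<Rightarrow>
   (nat \<Rightarrow> nat \<Rightarrow> 'w \<Rightarrow> real vec) \<Rightarrow> input \<Rightarrow> 'w \<Rightarrow> real vec" where
  "input_vec X0 V W (Prior n) = X0 n"
| "input_vec X0 V W (Model_noise i n) = V i n"
| "input_vec X0 V W (Obs_noise i n) = W i n"

fun input_dim :: "linear_model \<Rightarrow> input \<Rightarrow> nat" where
  "input_dim S (Prior n) = state_dim S"
| "input_dim S (Model_noise i n) = state_dim S"
| "input_dim S (Obs_noise i n) = obs_dim S i"

definition inputs :: "linear_model \<Rightarrow> input set" where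
  "inputs S = {Prior n |n. 1 \<le> n} \<union>
     {Model_noise i n |i n. i \<in> {1..horizon S} \<and> 1 \<le> n} \<union>
     {Obs_noise i n |i n. i \<in> {1..horizon S} \<and> 1 \<le> n}"

end

(*
  By the Joseph form of the analysis covariance and induction on i, the reference ensemble has the
  Kalman covariances, so it is a fixed affine recursion in the inputs.

  Convergence: all random variables have moments of every order, bounded uniformly in the ensemble
  size and the member number, so smallness in mean square implies smallness in every L^p (Cauchy-Schwarz).
  "Equal up to such a small term" is compatible with sums, products and averages over the ensemble.
  Hence if the analysis ensembles agree asymptotically at step i - 1, so do the forecast ensembles
  and their sample covariances; by the L^2 law of large numbers the latter tend to the exact ones.
  The gains follow because the entries of (H C H^T + R)^-1 are bounded by those of R^-1 for
  all positive semidefinite C, and A^-1 - B^-1 = A^-1 (B - A) B^-1.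

  Exchangeability: permuting the inputs permutes both ensembles, and the joint law of the independent
  inputs is invariant under such permutations. Since gaussian_vec only prescribes the laws of
  linear functionals, equality of the marginal laws needs the Cramer-Wold theorem, proved by induction
  on the dimension from the uniqueness of characteristic functions on the line.
*)

theory Submission
  imports Defs "Jordan_Normal_Form.Determinant" "HOL-Real_Asymp.Real_Asymp"
begin

text \<open>Once an analysis has been made, the ensemble members are coupled through the shared
  sample covariance, so no law of large numbers applies to them directly. It is applied to the
  reference members, each a function of its own inputs only, and carried over by closeness.
  Closeness is therefore stated for all members at once, with bounds independent of the member
  number: an ensemble average inherits the bound of its summands. Moments of every order have to be
  carried along because each step multiplies random quantities (gain times innovation), and a
  product costs twice the order. The inverse inside the gain is the only operation of the recursion
  that is not polynomial; its pointwise bound is what keeps the calculus closed. For the marginal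
  laws, the passage from one coordinate to several weights the law of the last coordinate by
  nonnegative functions of the others and restricts the measure to events of the last coordinate.
  Both destroy total mass 1, which is why finite measures appear there.\<close>

hide_const (open) Determinants.det

section \<open>Matrix operations in coordinates\<close>

lemma mult_mat_vec_entry:
  assumes "A \<in> carrier_mat r c" "x \<in> carrier_vec c" "a < r"
  shows "(A *\<^sub>v x) $ a = (\<Sum>b<c. A $$ (a, b) * x $ b)"
  using assms by (auto simp: scalar_prod_def lessThan_atLeast0 intro!: sum.cong)

lemma mult_mat_entry:
  assumes "A \<in> carrier_mat r n" "B \<in> carrier_mat n c" "a < r" "b < c"
  shows "(A * B) $$ (a, b) = (\<Sum>k<n. A $$ (a, k) * B $$ (k, b))"
  using assms by (auto simp: scalar_prod_def lessThan_atLeast0 intro!: sum.cong)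

text \<open>Coordinate form of the covariance of a linear image: it matches the double sums that
  bilinearity of the expectation produces in \<open>has_moments_affine\<close>.\<close>

lemma congruence_entry:
  fixes A C :: "real mat"
  assumes A: "A \<in> carrier_mat r n" and C: "C \<in> carrier_mat n n" and ab: "a < r" "b < r"
  shows "(A * C * A\<^sup>T) $$ (a, b) = (\<Sum>k<n. \<Sum>l<n. A $$ (a, k) * A $$ (b, l) * C $$ (k, l))"
proof -
  have "(A * C * A\<^sup>T) $$ (a, b) = (\<Sum>l<n. (A * C) $$ (a, l) * A\<^sup>T $$ (l, b))"
    using A C ab by (intro mult_mat_entry) auto
  also have "\<dots> = (\<Sum>l<n. (\<Sum>k<n. A $$ (a, k) * C $$ (k, l)) * A $$ (b, l))"
  proof (intro sum.cong refl)
    fix l assume "l \<in> {..<n}"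
    then show "(A * C) $$ (a, l) * A\<^sup>T $$ (l, b) = (\<Sum>k<n. A $$ (a, k) * C $$ (k, l)) * A $$ (b, l)"
      using mult_mat_entry[OF A C ab(1), of l] A ab by simp
  qed
  also have "\<dots> = (\<Sum>l<n. \<Sum>k<n. A $$ (a, k) * A $$ (b, l) * C $$ (k, l))"
    by (simp add: sum_distrib_left mult_ac)
  also have "\<dots> = (\<Sum>k<n. \<Sum>l<n. A $$ (a, k) * A $$ (b, l) * C $$ (k, l))"
    by (rule sum.swap)
  finally show ?thesis .
qed

lemma add_mat_entry:
  "A \<in> carrier_mat r c \<Longrightarrow> B \<in> carrier_mat r c \<Longrightarrow> a < r \<Longrightarrow> b < c \<Longrightarrow>
    (A + B) $$ (a, b) = A $$ (a, b) + B $$ (a, b)"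
  by auto

lemma add_vec_entry:
  fixes x y :: "real vec"
  assumes "x \<in> carrier_vec d" "y \<in> carrier_vec d" "j < d"
  shows "(x + y) $ j = x $ j + y $ j" "(x - y) $ j = x $ j - y $ j"
  using assms by auto

lemma add_diff_cancel_mat:
  fixes X Y :: "real mat"
  assumes "X \<in> carrier_mat r c" "Y \<in> carrier_mat r c"
  shows "X + Y - X = Y" "X - Y + Y = X"
  using assms by (auto intro!: eq_matI)

lemma zero_mult_mat_vec:
  fixes v :: "real vec"
  assumes "v \<in> carrier_vec c"
  shows "0\<^sub>m r c *\<^sub>v v = 0\<^sub>v r"
  using assms by (intro eq_vecI) auto

section \<open>One step in affine form\<close>

lemma carrier_on_last_block [simp]:
  assumes "A \<in> carrier_mat r m"
  shows "on_last_block c A \<in> carrier_mat r (c + m)"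
proof -
  have "on_last_block c A \<in> carrier_mat (dim_row A + 0) (c + dim_col A)"
    unfolding on_last_block_def by (rule four_block_carrier_mat) auto
  then show ?thesis
    using assms by auto
qed

text \<open>The gain is defined with the block row, whereas \<open>forecast\<close> and
  \<open>analysis\<close> read off the last block by \<open>vec_last\<close>; this identity
  reconciles the two.\<close>

lemma on_last_block_mult_vec:
  assumes A: "A \<in> carrier_mat r m" and x: "x \<in> carrier_vec (c + m)"
  shows "on_last_block c A *\<^sub>v x = A *\<^sub>v vec_last x m"
proof (rule eq_vecI)
  fix a
  assume "a < dim_vec (A *\<^sub>v vec_last x m)"
  then have a: "a < r" using A by simp
  have H: "on_last_block c A \<in> carrier_mat r (c + m)" using A by simp
  have "(on_last_block c A *\<^sub>v x) $ a = (\<Sum>b<c + m. on_last_block c A $$ (a, b) * x $ b)"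
    using H x a by (rule mult_mat_vec_entry)
  also have "\<dots> = (\<Sum>b<c + m. if b < c then 0 else A $$ (a, b - c) * x $ b)"
    using a A x by (intro sum.cong) (auto simp: on_last_block_def)
  also have "\<dots> = (\<Sum>b\<in>{c..<c + m}. A $$ (a, b - c) * x $ b)"
    by (rule sum.mono_neutral_cong_right) auto
  also have "\<dots> = (\<Sum>b<m. A $$ (a, b) * x $ (c + b))"
    by (rule sum.reindex_bij_witness[of _ "\<lambda>b. c + b" "\<lambda>b. b - c"]) auto
  also have "\<dots> = (A *\<^sub>v vec_last x m) $ a"
    using a A x by (subst mult_mat_vec_entry[OF A]) (auto simp: vec_last_def intro!: sum.cong)
  finally show "(on_last_block c A *\<^sub>v x) $ a = (A *\<^sub>v vec_last x m) $ a" .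
qed (use A in \<open>simp add: on_last_block_def\<close>)

text \<open>This is F_i. The old state has i blocks, so i - 1 zero blocks stand in front of the
  model matrix.\<close>

definition forecast_mat :: "linear_model \<Rightarrow> nat \<Rightarrow> real mat" where
  "forecast_mat S i = 1\<^sub>m (i * state_dim S) @\<^sub>r on_last_block ((i - 1) * state_dim S) (model_op S i)"

text \<open>The embedding of the model noise as the new last block; with it the block-diagonal noise
  covariance becomes a congruence of Q_i.\<close>

definition noise_mat :: "linear_model \<Rightarrow> nat \<Rightarrow> real mat" where
  "noise_mat S i = 0\<^sub>m (i * state_dim S) (state_dim S) @\<^sub>r 1\<^sub>m (state_dim S)"

definition forecast_shift :: "linear_model \<Rightarrow> nat \<Rightarrow> real vec" where
  "forecast_shift S i = 0\<^sub>v (i * state_dim S) @\<^sub>v model_shift S i"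

definition composite_obs_op :: "linear_model \<Rightarrow> nat \<Rightarrow> real mat" where
  "composite_obs_op S i = on_last_block (i * state_dim S) (obs_op S i)"

context
  fixes S :: linear_model and i m :: nat
  assumes S: "well_formed_model S" and i: "i \<in> {1..horizon S}"
    and m_def: "m = state_dim S"
begin

lemma model_carriers:
  "model_op S i \<in> carrier_mat m m"
  "obs_op S i \<in> carrier_mat (obs_dim S i) m"
  "model_shift S i \<in> carrier_vec m"
  "obs_data S i \<in> carrier_vec (obs_dim S i)"
  "model_cov S i \<in> carrier_mat m m"
  "obs_cov S i \<in> carrier_mat (obs_dim S i) (obs_dim S i)"
  using S i m_def by (auto simp: well_formed_model_def psd_matrix_def pd_matrix_def)

text \<open>Since i >= 1, the truncated \<open>i - 1\<close> is a genuine predecessor, and the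
  previous composite state has exactly i blocks.\<close>

lemma comp_dim_step: "comp_dim S i = i * m + m" "comp_dim S (i - 1) = i * m"
  using i by (auto simp: comp_dim_def m_def)

lemma forecast_mat_carrier: "forecast_mat S i \<in> carrier_mat (comp_dim S i) (comp_dim S (i - 1))"
  unfolding comp_dim_step forecast_mat_def m_def[symmetric]
proof (rule carrier_append_rows)
  have "on_last_block ((i - 1) * m) (model_op S i) \<in> carrier_mat m ((i - 1) * m + m)"
    by (rule carrier_on_last_block[OF model_carriers(1)])
  also have "(i - 1) * m + m = i * m"
    using i by (cases i) auto
  finally show "on_last_block ((i - 1) * m) (model_op S i) \<in> carrier_mat m (i * m)" .
qed simp

lemma noise_mat_carrier: "noise_mat S i \<in> carrier_mat (comp_dim S i) m"
  unfolding comp_dim_step noise_mat_def m_def[symmetric] by (rule carrier_append_rows) auto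

lemma forecast_shift_carrier: "forecast_shift S i \<in> carrier_vec (comp_dim S i)"
  using model_carriers unfolding comp_dim_step forecast_shift_def m_def[symmetric] by auto

lemma composite_obs_op_carrier:
  "composite_obs_op S i \<in> carrier_mat (obs_dim S i) (comp_dim S i)"
  using model_carriers unfolding comp_dim_step composite_obs_op_def m_def[symmetric] by auto

text \<open>Appending a block is linear, so the forecast is jointly affine in the old state and the
  noise. Measurability, moments and asymptotic equality of the forecast are all derived from this
  form.\<close>

lemma forecast_affine:
  assumes x: "x \<in> carrier_vec (comp_dim S (i - 1))" and v: "v \<in> carrier_vec m"
  shows "forecast S i x v = forecast_mat S i *\<^sub>v x + noise_mat S i *\<^sub>v v + forecast_shift S i"
proof -
  have dim: "(i - 1) * m + m = i * m"
    using i by (cases i) auto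
  have x': "x \<in> carrier_vec (i * m)" using x unfolding comp_dim_step .
  have L: "on_last_block ((i - 1) * m) (model_op S i) \<in> carrier_mat m (i * m)"
    using carrier_on_last_block[OF model_carriers(1), of "(i - 1) * m"] unfolding dim .
  have F: "forecast_mat S i *\<^sub>v x = x @\<^sub>v (model_op S i *\<^sub>v vec_last x m)"
    unfolding forecast_mat_def m_def[symmetric]
    using mat_mult_append[OF one_carrier_mat L x'] x'
      on_last_block_mult_vec[OF model_carriers(1), of x "(i - 1) * m", unfolded dim]
    by simp
  have G: "noise_mat S i *\<^sub>v v = 0\<^sub>v (i * m) @\<^sub>v v"
    unfolding noise_mat_def m_def[symmetric]
    using mat_mult_append[OF zero_carrier_mat one_carrier_mat v, of "i * m"] v
      zero_mult_mat_vec[OF v] by simp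
  show ?thesis
    unfolding F G forecast_def forecast_shift_def m_def[symmetric]
    using x' v model_carriers by (intro eq_vecI) auto
qed

text \<open>As a sum of two congruences the forecast covariance is visibly positive semidefinite,
  and it is the covariance that \<open>has_moments_affine\<close> assigns to the affine map of
  \<open>forecast_affine\<close>.\<close>

lemma kalman_forecast_cov_eq:
  assumes C: "C \<in> carrier_mat (comp_dim S (i - 1)) (comp_dim S (i - 1))"
  shows "kalman_forecast_cov S i C = forecast_mat S i * C * (forecast_mat S i)\<^sup>T +
    noise_mat S i * model_cov S i * (noise_mat S i)\<^sup>T"
proof -
  let ?Q = "model_cov S i"
  have Q: "?Q \<in> carrier_mat m m" by (rule model_carriers)
  have G: "noise_mat S i = four_block_mat (0\<^sub>m (i * m) m) (0\<^sub>m (i * m) 0) (1\<^sub>m m) (0\<^sub>m m 0)"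
    by (simp add: noise_mat_def append_rows_def m_def)
  have GT: "(noise_mat S i)\<^sup>T = four_block_mat (0\<^sub>m m (i * m)) (1\<^sub>m m) (0\<^sub>m 0 (i * m)) (0\<^sub>m 0 m)"
    unfolding G by (subst transpose_four_block_mat) auto
  \<comment> \<open>Appending rows means a block matrix whose right column has width 0, so the noise
    covariance is split with empty blocks of matching shape before the block product is
    taken.\<close>
  have Qb: "?Q = four_block_mat ?Q (0\<^sub>m m 0) (0\<^sub>m 0 m) (0\<^sub>m 0 0)"
    using Q by (intro eq_matI) auto
  have GQ: "noise_mat S i * ?Q = four_block_mat (0\<^sub>m (i * m) m) (0\<^sub>m (i * m) 0) ?Q (0\<^sub>m m 0)"
    apply (subst Qb)
    unfolding G using Q
    by (subst mult_four_block_mat[of _ "i * m" m _ 0 _ m _ _ m _ 0]) auto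
  have "noise_mat S i * ?Q * (noise_mat S i)\<^sup>T =
      four_block_mat (0\<^sub>m (i * m) (i * m)) (0\<^sub>m (i * m) m) (0\<^sub>m m (i * m)) ?Q"
    unfolding GQ unfolding GT using Q
    by (subst mult_four_block_mat[of _ "i * m" m _ 0 _ m _ _ "i * m" _ m]) auto
  then show ?thesis
    by (simp add: kalman_forecast_cov_def Let_def forecast_mat_def m_def)
qed

lemma analysis_eq:
  assumes x: "x \<in> carrier_vec (comp_dim S i)"
  shows "analysis S i C x w =
    x + kalman_gain S i C *\<^sub>v (obs_data S i - w - composite_obs_op S i *\<^sub>v x)"
proof -
  have "composite_obs_op S i *\<^sub>v x = obs_op S i *\<^sub>v vec_last x m"
    unfolding composite_obs_op_def m_def[symmetric]
    using x on_last_block_mult_vec[OF model_carriers(2)] by (simp add: comp_dim_step)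
  then show ?thesis by (simp add: analysis_def m_def)
qed

text \<open>For a fixed gain K the analysis is affine in the forecast and the observation noise,
  with coefficients I - K H and -K. These are the two congruence factors on the left side of
  \<open>joseph_form\<close>.\<close>

lemma analysis_affine:
  assumes x: "x \<in> carrier_vec (comp_dim S i)" and w: "w \<in> carrier_vec (obs_dim S i)"
    and K: "kalman_gain S i C \<in> carrier_mat (comp_dim S i) (obs_dim S i)"
  shows "analysis S i C x w =
    (1\<^sub>m (comp_dim S i) - kalman_gain S i C * composite_obs_op S i) *\<^sub>v x
      + (- kalman_gain S i C) *\<^sub>v w + kalman_gain S i C *\<^sub>v obs_data S i"
proof -
  let ?K = "kalman_gain S i C" and ?H = "composite_obs_op S i" and ?y = "obs_data S i"
  note H = composite_obs_op_carrier and y = model_carriers(4)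
  have "?K *\<^sub>v (?y - w - ?H *\<^sub>v x) = ?K *\<^sub>v ?y - ?K *\<^sub>v w - ?K *\<^sub>v (?H *\<^sub>v x)"
    using K H y x w
    by (simp add: mult_minus_distrib_mat_vec[of _ "comp_dim S i" "obs_dim S i"])
  moreover have "(1\<^sub>m (comp_dim S i) - ?K * ?H) *\<^sub>v x = x - ?K *\<^sub>v (?H *\<^sub>v x)"
    using K H x
    by (subst minus_mult_distrib_mat_vec[of _ "comp_dim S i" "comp_dim S i"]) auto
  moreover have "(- ?K) *\<^sub>v w = - (?K *\<^sub>v w)"
    using K w by simp
  moreover have "dim_vec x = comp_dim S i" "dim_row ?K = comp_dim S i" using x K by auto
  ultimately show ?thesis
    unfolding analysis_eq[OF x] by (intro eq_vecI) auto
qed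

end

section \<open>The analysis covariance\<close>

text \<open>Let L = I - K H. The relation K (H C H^T + R) = C H^T gives L C H^T = K R; hence L C L^T
  = L C - L C H^T K^T = L C - K R K^T, and the noise term restores K R K^T. The left side is the
  covariance of an updated reference member, the right side is the smoother recursion.\<close>

lemma joseph_form:
  fixes C H R K :: "real mat"
  assumes C: "C \<in> carrier_mat n n" and H: "H \<in> carrier_mat r n" and R: "R \<in> carrier_mat r r"
    and A: "A \<in> carrier_mat r r" and inv: "A * (H * C * H\<^sup>T + R) = 1\<^sub>m r"
  defines "K \<equiv> C * H\<^sup>T * A"
  shows "(1\<^sub>m n - K * H) * C * (1\<^sub>m n - K * H)\<^sup>T + (- K) * R * (- K)\<^sup>T = (1\<^sub>m n - K * H) * C"
proof -
  have HT: "H\<^sup>T \<in> carrier_mat n r" using H by simp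
  have K: "K \<in> carrier_mat n r" using C HT A by (simp add: K_def)
  have KT: "K\<^sup>T \<in> carrier_mat r n" using K by simp
  have KH: "K * H \<in> carrier_mat n n" using K H by simp
  let ?L = "1\<^sub>m n - K * H"
  have L: "?L \<in> carrier_mat n n" using KH by (simp add: minus_carrier_mat)
  have LC: "?L * C \<in> carrier_mat n n" using L C by simp
  have LT: "?L\<^sup>T = 1\<^sub>m n - H\<^sup>T * K\<^sup>T"
    using KH transpose_minus[OF one_carrier_mat KH] transpose_mult[OF K H] by simp
  have CHT: "C * H\<^sup>T \<in> carrier_mat n r" and HCHT: "H * C * H\<^sup>T \<in> carrier_mat r r"
    using C H HT by auto
  have KS: "K * (H * C * H\<^sup>T + R) = C * H\<^sup>T"
  proof -
    have "K * (H * C * H\<^sup>T + R) = C * H\<^sup>T * (A * (H * C * H\<^sup>T + R))"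
      unfolding K_def using CHT A HCHT R by (intro assoc_mult_mat) auto
    then show ?thesis unfolding inv right_mult_one_mat[OF CHT] .
  qed
  have "?L * C * H\<^sup>T = ?L * (C * H\<^sup>T)"
    using L C HT by (rule assoc_mult_mat)
  also have "\<dots> = C * H\<^sup>T - K * H * (C * H\<^sup>T)"
    unfolding minus_mult_distrib_mat[OF one_carrier_mat KH CHT] left_mult_one_mat[OF CHT] ..
  also have "K * H * (C * H\<^sup>T) = K * (H * C * H\<^sup>T)"
    unfolding assoc_mult_mat[OF K H CHT] assoc_mult_mat[OF H C HT] ..
  also have "C * H\<^sup>T - K * (H * C * H\<^sup>T) = K * R"
  proof -
    have "C * H\<^sup>T = K * (H * C * H\<^sup>T) + K * R"
      unfolding KS[symmetric] using K HCHT R by (rule mult_add_distrib_mat)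
    then show ?thesis
      using add_diff_cancel_mat(1)[of "K * (H * C * H\<^sup>T)" n r "K * R"] K HCHT R by simp
  qed
  finally have key: "?L * C * H\<^sup>T = K * R" .
  have KRKT: "K * R * K\<^sup>T \<in> carrier_mat n n" using K R KT by simp
  have "?L * C * ?L\<^sup>T = ?L * C - ?L * C * (H\<^sup>T * K\<^sup>T)"
    unfolding LT
    using mult_minus_distrib_mat[OF LC one_carrier_mat, of "H\<^sup>T * K\<^sup>T", unfolded right_mult_one_mat[OF LC]]
      HT KT by simp
  also have "?L * C * (H\<^sup>T * K\<^sup>T) = K * R * K\<^sup>T"
    using assoc_mult_mat[OF LC HT KT] key by simp
  finally have 1: "?L * C * ?L\<^sup>T = ?L * C - K * R * K\<^sup>T" .
  have 2: "(- K) * R * (- K)\<^sup>T = K * R * K\<^sup>T"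
    using K R by (simp add: transpose_uminus)
  show ?thesis
    unfolding 1 2 by (rule add_diff_cancel_mat(2)[OF LC KRKT])
qed

section \<open>Positive semidefinite matrices\<close>

lemma psd_matrix_carrier: "psd_matrix n A \<Longrightarrow> A \<in> carrier_mat n n"
  by (simp add: psd_matrix_def)

lemma pd_matrix_imp_psd: "pd_matrix n A \<Longrightarrow> psd_matrix n A"
  unfolding psd_matrix_def
proof (intro conjI ballI)
  assume A: "pd_matrix n A"
  then show "A \<in> carrier_mat n n" "A\<^sup>T = A" by (auto simp: pd_matrix_def)
  fix x :: "real vec" assume x: "x \<in> carrier_vec n"
  show "0 \<le> x \<bullet> (A *\<^sub>v x)"
  proof (cases "x = 0\<^sub>v n")
    case True
    have "A *\<^sub>v x \<in> carrier_vec n" using A x by (auto simp: pd_matrix_def)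
    then show ?thesis using True by simp
  next
    case False
    then show ?thesis using A x by (auto simp: pd_matrix_def less_imp_le)
  qed
qed

lemma psd_matrix_add:
  assumes "psd_matrix n A" "psd_matrix n B"
  shows "psd_matrix n (A + B)"
proof -
  have c: "A \<in> carrier_mat n n" "B \<in> carrier_mat n n" "A\<^sup>T = A" "B\<^sup>T = B"
    using assms by (auto simp: psd_matrix_def)
  have "0 \<le> x \<bullet> ((A + B) *\<^sub>v x)" if x: "x \<in> carrier_vec n" for x
  proof -
    have "x \<bullet> ((A + B) *\<^sub>v x) = x \<bullet> (A *\<^sub>v x) + x \<bullet> (B *\<^sub>v x)"
      using c x by (simp add: add_mult_distrib_mat_vec[of _ n n] scalar_prod_add_distrib[of _ n])
    with assms x show ?thesis by (simp add: psd_matrix_def)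
  qed
  then show ?thesis
    using c transpose_add[OF c(1,2)] by (auto simp: psd_matrix_def)
qed

text \<open>A nonzero kernel vector would have quadratic form 0.\<close>

lemma pd_matrix_det:
  assumes "pd_matrix n A"
  shows "det A \<noteq> 0"
proof
  assume 0: "det A = 0"
  have A: "A \<in> carrier_mat n n" using assms by (simp add: pd_matrix_def)
  obtain v where v: "v \<in> carrier_vec n" "v \<noteq> 0\<^sub>v n" "A *\<^sub>v v = 0\<^sub>v n"
    using det_0_iff_vec_prod_zero_field[OF A] 0 by auto
  then have "0 < v \<bullet> 0\<^sub>v n" using assms by (metis pd_matrix_def)
  then show False using v(1) by simp
qed

text \<open>\<open>mat_inverse\<close> is an elimination procedure whose branching depends on the
  entries. The adjugate formula replaces it by an explicit rational function of the entries, from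
  which measurability of the inverse follows.\<close>

lemma mat_inverse_pd:
  fixes A :: "real mat"
  assumes "pd_matrix n A"
  defines "B \<equiv> the (mat_inverse A)"
  shows "B \<in> carrier_mat n n" "A * B = 1\<^sub>m n" "B * A = 1\<^sub>m n" "B = (1 / det A) \<cdot>\<^sub>m adj_mat A"
proof -
  have A: "A \<in> carrier_mat n n" using assms by (simp add: pd_matrix_def)
  have d: "det A \<noteq> 0" using pd_matrix_det assms by blast
  \<comment> \<open>A nonzero determinant makes A a unit of the matrix ring, so \<open>the\<close>
    is never applied to \<open>None\<close>.\<close>
  have "mat_inverse A \<noteq> None"
  proof
    assume "mat_inverse A = None"
    from mat_inverse(1)[OF A this] have "A \<notin> Units (ring_mat TYPE(real) n ())" .
    then show False
      using det_non_zero_imp_unit[OF A d, of "()"] by blast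
  qed
  then have "mat_inverse A = Some B" by (auto simp: B_def)
  from mat_inverse(2)[OF A this] show B: "A * B = 1\<^sub>m n" "B * A = 1\<^sub>m n" "B \<in> carrier_mat n n" by auto
  have "adj_mat A = B * A * adj_mat A"
    unfolding B(2) using left_mult_one_mat[OF adj_mat(1)[OF A]] by simp
  also have "\<dots> = B * (A * adj_mat A)" by (rule assoc_mult_mat[OF B(3) A adj_mat(1)[OF A]])
  also have "\<dots> = det A \<cdot>\<^sub>m B" using adj_mat(2)[OF A] B
    by (simp add: mult_smult_distrib[of B n n "1\<^sub>m n" n])
  finally show "B = (1 / det A) \<cdot>\<^sub>m adj_mat A" using d B by (intro eq_matI) auto
qed

text \<open>The quadratic form at x is that of C at H^T x.\<close>

lemma psd_matrix_congruence:
  assumes C: "psd_matrix n C" and H: "H \<in> carrier_mat r n"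
  shows "psd_matrix r (H * C * H\<^sup>T)"
  unfolding psd_matrix_def
proof (intro conjI ballI)
  have C': "C \<in> carrier_mat n n" "C\<^sup>T = C" using C by (auto simp: psd_matrix_def)
  have HT: "H\<^sup>T \<in> carrier_mat n r" using H by simp
  have HC: "H * C \<in> carrier_mat r n" using H C' by simp
  show "H * C * H\<^sup>T \<in> carrier_mat r r" using HC HT by simp
  have "(H * C * H\<^sup>T)\<^sup>T = H * (C * H\<^sup>T)"
    using transpose_mult[OF HC HT] transpose_mult[OF H C'(1)] C'(2) by simp
  then show "(H * C * H\<^sup>T)\<^sup>T = H * C * H\<^sup>T"
    using assoc_mult_mat[OF H C'(1) HT] by simp
  fix x :: "real vec" assume x: "x \<in> carrier_vec r"
  have y: "H\<^sup>T *\<^sub>v x \<in> carrier_vec n" using HT x by simp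
  have "H * C * H\<^sup>T *\<^sub>v x = H *\<^sub>v (C *\<^sub>v (H\<^sup>T *\<^sub>v x))"
    using assoc_mult_mat_vec[OF HC HT x] assoc_mult_mat_vec[OF H C'(1) y] by simp
  then have "x \<bullet> (H * C * H\<^sup>T *\<^sub>v x) = (H\<^sup>T *\<^sub>v x) \<bullet> (C *\<^sub>v (H\<^sup>T *\<^sub>v x))"
    using transpose_vec_mult_scalar[OF H _ x, of "C *\<^sub>v (H\<^sup>T *\<^sub>v x)"] C' y by simp
  then show "0 \<le> x \<bullet> (H * C * H\<^sup>T *\<^sub>v x)"
    using C y by (simp add: psd_matrix_def)
qed

lemma pd_matrix_add:
  assumes T: "psd_matrix n T" and R: "pd_matrix n R"
  shows "pd_matrix n (T + R)"
proof -
  have c: "T \<in> carrier_mat n n" "R \<in> carrier_mat n n" "T\<^sup>T = T" "R\<^sup>T = R"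
    using assms by (auto simp: pd_matrix_def psd_matrix_def)
  have "0 < x \<bullet> ((T + R) *\<^sub>v x)" if x: "x \<in> carrier_vec n" "x \<noteq> 0\<^sub>v n" for x
  proof -
    have "x \<bullet> ((T + R) *\<^sub>v x) = x \<bullet> (T *\<^sub>v x) + x \<bullet> (R *\<^sub>v x)"
      using c x by (simp add: add_mult_distrib_mat_vec[of _ n n] scalar_prod_add_distrib[of _ n])
    moreover have "0 \<le> x \<bullet> (T *\<^sub>v x)" "0 < x \<bullet> (R *\<^sub>v x)"
      using T R x by (auto simp: pd_matrix_def psd_matrix_def)
    ultimately show ?thesis by simp
  qed
  then show ?thesis
    using c transpose_add[OF c(1,2)] by (auto simp: pd_matrix_def)
qed

text \<open>Symmetry of R merges the two mixed terms. Besides the bound on the inverse, this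
  polarisation is used to read off-diagonal covariances from variances.\<close>

lemma quadratic_form_add:
  fixes R :: "real mat"
  assumes R: "R \<in> carrier_mat n n" "R\<^sup>T = R" and w: "w \<in> carrier_vec n" and v: "v \<in> carrier_vec n"
  shows "(w + v) \<bullet> (R *\<^sub>v (w + v)) = w \<bullet> (R *\<^sub>v w) + 2 * (v \<bullet> (R *\<^sub>v w)) + v \<bullet> (R *\<^sub>v v)"
proof -
  have "w \<bullet> (R *\<^sub>v v) = v \<bullet> (R *\<^sub>v w)"
  proof -
    have "w \<bullet> (R *\<^sub>v v) = (R *\<^sub>v w) \<bullet> v"
      using transpose_vec_mult_scalar[OF R(1) v w] R(2) by simp
    then show ?thesis using R v w by (simp add: comm_scalar_prod[of _ n])
  qed
  moreover have "(w + v) \<bullet> (R *\<^sub>v (w + v)) =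
      w \<bullet> (R *\<^sub>v w) + w \<bullet> (R *\<^sub>v v) + (v \<bullet> (R *\<^sub>v w) + v \<bullet> (R *\<^sub>v v))"
    using R v w by (simp add: mult_add_distrib_mat_vec[of _ n n] add_scalar_prod_distrib[of _ n]
        scalar_prod_add_distrib[of _ n])
  ultimately show ?thesis by simp
qed

lemma mat_inverse_pd_col:
  fixes A :: "real mat"
  assumes A: "pd_matrix n A" and k: "k < n"
  shows "col (the (mat_inverse A)) k \<in> carrier_vec n"
    "A *\<^sub>v col (the (mat_inverse A)) k = unit_vec n k"
  using mat_inverse_pd[OF A] k col_mult2[of A n n "the (mat_inverse A)" n k] A
  by (auto simp: pd_matrix_def)

text \<open>The bound does not depend on \<open>T\<close>: with \<open>v\<close> the \<open>k\<close>-th column of the inverse of \<open>T + R\<close> and \<open>w\<close>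
  the \<open>j\<close>-th column of the inverse of \<open>R\<close>, expand \<open>0 \<le> (w \<plusminus> v) \<bullet> R (w \<plusminus> v)\<close>.\<close>

lemma mat_inverse_psd_add_pd_bound:
  assumes T: "psd_matrix n T" and R: "pd_matrix n R" and j: "j < n" and k: "k < n"
  shows "\<bar>the (mat_inverse (T + R)) $$ (j, k)\<bar> \<le>
    (the (mat_inverse R) $$ (j, j) + the (mat_inverse R) $$ (k, k)) / 2"
proof -
  define B where "B = the (mat_inverse (T + R))"
  define Ri where "Ri = the (mat_inverse R)"
  have A: "pd_matrix n (T + R)" using T R by (rule pd_matrix_add)
  have Rc: "R \<in> carrier_mat n n" "R\<^sup>T = R" and Tc: "T \<in> carrier_mat n n"
    using R T by (auto simp: pd_matrix_def psd_matrix_def)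
  have Bc: "B \<in> carrier_mat n n" and Ric: "Ri \<in> carrier_mat n n"
    using mat_inverse_pd(1)[OF A] mat_inverse_pd(1)[OF R] by (auto simp: B_def Ri_def)
  have nonneg: "0 \<le> x \<bullet> (R *\<^sub>v x)" if "x \<in> carrier_vec n" for x
    using pd_matrix_imp_psd[OF R] that by (simp add: psd_matrix_def)
  have key: "0 \<le> Ri $$ (j, j) + 2 * s * B $$ (j, k) + B $$ (k, k)"
    if j: "j < n" and k: "k < n" and s: "s\<^sup>2 = 1" for j k and s :: real
  proof -
    define v where "v = col B k"
    define w where "w = col Ri j"
    have v: "v \<in> carrier_vec n" "(T + R) *\<^sub>v v = unit_vec n k"
      using mat_inverse_pd_col[OF A k] by (auto simp: v_def B_def)
    have w: "w \<in> carrier_vec n" "R *\<^sub>v w = unit_vec n j"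
      using mat_inverse_pd_col[OF R j] by (auto simp: w_def Ri_def)
    have sv: "s \<cdot>\<^sub>v v \<in> carrier_vec n" using v by simp
    \<comment> \<open>Test (T + R) v = e_k against v: the right side is the entry (k, k) of the
      inverse, and dropping the nonnegative term of T bounds v . R v by it.\<close>
    have "v \<bullet> (T *\<^sub>v v) + v \<bullet> (R *\<^sub>v v) = v \<bullet> unit_vec n k"
      unfolding v(2)[symmetric] using v(1) Rc Tc
      by (simp add: add_mult_distrib_mat_vec[of _ n n] scalar_prod_add_distrib[of _ n])
    moreover have "0 \<le> v \<bullet> (T *\<^sub>v v)" using T v by (simp add: psd_matrix_def)
    ultimately have le: "v \<bullet> (R *\<^sub>v v) \<le> B $$ (k, k)"
      using scalar_prod_right_unit[OF k, of v] v(1) Bc k by (simp add: v_def)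
    have "0 \<le> (w + s \<cdot>\<^sub>v v) \<bullet> (R *\<^sub>v (w + s \<cdot>\<^sub>v v))"
      using nonneg w v by simp
    also have "\<dots> = w \<bullet> (R *\<^sub>v w) + 2 * ((s \<cdot>\<^sub>v v) \<bullet> (R *\<^sub>v w)) + (s \<cdot>\<^sub>v v) \<bullet> (R *\<^sub>v (s \<cdot>\<^sub>v v))"
      by (rule quadratic_form_add[OF Rc w(1) sv])
    also have "(s \<cdot>\<^sub>v v) \<bullet> (R *\<^sub>v (s \<cdot>\<^sub>v v)) = v \<bullet> (R *\<^sub>v v)"
      using v(1) Rc s by (simp add: mult_mat_vec[of _ n n] power2_eq_square flip: mult.assoc)
    also have "(s \<cdot>\<^sub>v v) \<bullet> (R *\<^sub>v w) = s * B $$ (j, k)"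
      unfolding w(2) using scalar_prod_right_unit[OF j, of "s \<cdot>\<^sub>v v"] v(1) Bc j k by (simp add: v_def)
    also have "w \<bullet> (R *\<^sub>v w) = Ri $$ (j, j)"
      unfolding w(2) using scalar_prod_right_unit[OF j, of w] w(1) Ric j by (simp add: w_def)
    finally show ?thesis using le by simp
  qed
  \<comment> \<open>The diagonal case j = k with sign -1 reads Ri_kk - 2 B_kk + B_kk >= 0; it
    removes B_kk from the general bound.\<close>
  have "B $$ (k, k) \<le> Ri $$ (k, k)"
    using key[OF k k, of "-1"] by simp
  moreover have "\<bar>2 * B $$ (j, k)\<bar> \<le> Ri $$ (j, j) + B $$ (k, k)"
    using key[OF j k, of 1] key[OF j k, of "-1"] by simp
  ultimately show ?thesis unfolding B_def[symmetric] Ri_def[symmetric] by (simp add: abs_mult)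
qed

text \<open>The resolvent identity B - B0 = B (A0 - A) B0, written in entries so that the scalar
  moment calculus applies to each summand.\<close>

lemma the_mat_inverse_diff_entry:
  assumes A: "pd_matrix n A" and A0: "pd_matrix n A0" and j: "j < n" and k: "k < n"
  defines "B \<equiv> the (mat_inverse A)" and "B0 \<equiv> the (mat_inverse A0)"
  shows "B $$ (j, k) - B0 $$ (j, k) =
    (\<Sum>p<n. B $$ (j, p) * (\<Sum>q<n. (A0 $$ (p, q) - A $$ (p, q)) * B0 $$ (q, k)))"
proof -
  have c: "A \<in> carrier_mat n n" "A0 \<in> carrier_mat n n" using A A0 by (auto simp: pd_matrix_def)
  note B = mat_inverse_pd[OF A, folded B_def] and B0 = mat_inverse_pd[OF A0, folded B0_def]
  have e: "(B * (T * B0)) $$ (j, k) = (\<Sum>p<n. B $$ (j, p) * (\<Sum>q<n. T $$ (p, q) * B0 $$ (q, k)))"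
    if T: "T \<in> carrier_mat n n" for T
  proof -
    have "T * B0 \<in> carrier_mat n n" using T B0 by simp
    then have "(B * (T * B0)) $$ (j, k) = (\<Sum>p<n. B $$ (j, p) * (T * B0) $$ (p, k))"
      using B(1) j k by (intro mult_mat_entry) auto
    also have "\<dots> = (\<Sum>p<n. B $$ (j, p) * (\<Sum>q<n. T $$ (p, q) * B0 $$ (q, k)))"
      using T B0(1) k by (intro sum.cong refl arg_cong2[of _ _ _ _ "(*)"] mult_mat_entry) auto
    finally show ?thesis .
  qed
  have "B * (A0 * B0) = B" using B(1) B0(2) by simp
  moreover have "B * (A * B0) = B0"
    using assoc_mult_mat[OF B(1) c(1) B0(1)] B(3) B0(1) by simp
  ultimately show ?thesis
    using e[OF c(1)] e[OF c(2)] by (simp add: left_diff_distrib sum_subtractf right_diff_distrib)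
qed

section \<open>Sample covariances\<close>

lemma sample_cov_carrier [simp]: "sample_cov d N Z \<in> carrier_mat d d"
  by (simp add: sample_cov_def)

text \<open>The quadratic form is a sum of squares divided by c. The alternative
  \<open>I = {}\<close> serves the ensemble size 0, where the divisor of the sample covariance is
  -1; for size 1 the divisor is 0 and the matrix is 0.\<close>

lemma psd_matrix_gram:
  fixes D :: "'i \<Rightarrow> nat \<Rightarrow> real"
  assumes "0 \<le> c \<or> I = {}"
  shows "psd_matrix d (mat d d (\<lambda>(a, b). (\<Sum>n\<in>I. D n a * D n b) / c))" (is "psd_matrix d ?S")
  unfolding psd_matrix_def
proof (intro conjI ballI)
  show "?S\<^sup>T = ?S" by (intro eq_matI) (auto simp: mult.commute)
  fix x :: "real vec" assume x: "x \<in> carrier_vec d"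
  have "x \<bullet> (?S *\<^sub>v x) = (\<Sum>a<d. x $ a * (\<Sum>b<d. (\<Sum>n\<in>I. D n a * D n b) / c * x $ b))"
    unfolding scalar_prod_def using x
    by (auto simp: lessThan_atLeast0 mult_mat_vec_entry[of ?S d d x] simp del: index_mult_mat_vec
        intro!: sum.cong)
  also have "\<dots> = (\<Sum>a<d. \<Sum>b<d. \<Sum>n\<in>I. (x $ a * D n a) * (x $ b * D n b)) / c"
    by (simp add: sum_distrib_left sum_distrib_right sum_divide_distrib mult_ac)
  also have "(\<Sum>a<d. \<Sum>b<d. \<Sum>n\<in>I. (x $ a * D n a) * (x $ b * D n b)) =
      (\<Sum>n\<in>I. (\<Sum>a<d. x $ a * D n a)\<^sup>2)"
  proof -
    have "(\<Sum>n\<in>I. (\<Sum>a<d. x $ a * D n a)\<^sup>2) =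
        (\<Sum>n\<in>I. \<Sum>a<d. \<Sum>b<d. (x $ a * D n a) * (x $ b * D n b))"
      unfolding power2_eq_square sum_product ..
    also have "\<dots> = (\<Sum>a<d. \<Sum>n\<in>I. \<Sum>b<d. (x $ a * D n a) * (x $ b * D n b))"
      by (rule sum.swap)
    also have "\<dots> = (\<Sum>a<d. \<Sum>b<d. \<Sum>n\<in>I. (x $ a * D n a) * (x $ b * D n b))"
      by (intro sum.cong refl sum.swap)
    finally show ?thesis ..
  qed
  finally have "x \<bullet> (?S *\<^sub>v x) = (\<Sum>n\<in>I. (\<Sum>a<d. x $ a * D n a)\<^sup>2) / c" .
  also have "0 \<le> \<dots>"
    using assms by (cases "I = {}") (simp_all add: sum_nonneg)
  finally show "0 \<le> x \<bullet> (?S *\<^sub>v x)" .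
qed simp

lemma psd_sample_cov: "psd_matrix d (sample_cov d N Z)"
  unfolding sample_cov_def by (rule psd_matrix_gram) (cases N, auto)

text \<open>Bias factor times (average of products minus product of averages): each piece is a
  deterministic sequence or an ensemble average. For N = 0 and N = 1 both sides are 0, by the
  convention for division by 0 in the latter case.\<close>

lemma sample_cov_entry:
  assumes "a < d" "b < d"
  shows "sample_cov d N Z $$ (a, b) = real N / (real N - 1) *
    ((\<Sum>n=1..N. Z n $ a * Z n $ b) / real N - (\<Sum>n=1..N. Z n $ a) / real N * ((\<Sum>n=1..N. Z n $ b) / real N))"
proof (cases "N = 0")
  case True
  then show ?thesis using assms by (simp add: sample_cov_def)
next
  case False
  define x where "x = (\<Sum>n=1..N. Z n $ a) / real N"
  define y where "y = (\<Sum>n=1..N. Z n $ b) / real N"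
  have x: "(\<Sum>n=1..N. Z n $ a) = real N * x" and y: "(\<Sum>n=1..N. Z n $ b) = real N * y"
    using False by (simp_all add: x_def y_def)
  have "(\<Sum>n=1..N. (Z n $ a - x) * (Z n $ b - y)) =
      (\<Sum>n=1..N. Z n $ a * Z n $ b) - y * (\<Sum>n=1..N. Z n $ a) - x * (\<Sum>n=1..N. Z n $ b) + real N * x * y"
    by (simp add: algebra_simps sum.distrib sum_subtractf sum_distrib_left)
  also have "\<dots> = real N * ((\<Sum>n=1..N. Z n $ a * Z n $ b) / real N - x * y)"
    unfolding x y using False by (simp add: algebra_simps)
  finally show ?thesis
    using assms by (simp add: sample_cov_def sample_mean_def x_def y_def)
qed

section \<open>Measurable random vectors and matrices\<close>

lemma space_vec_borel [simp]: "space (vec_borel d) = carrier_vec d"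
  by (simp add: vec_borel_def)

lemma measurable_vec_borel_iff:
  "Z \<in> M \<rightarrow>\<^sub>M vec_borel d \<longleftrightarrow>
    (\<forall>\<omega> \<in> space M. Z \<omega> \<in> carrier_vec d) \<and> (\<forall>j<d. (\<lambda>\<omega>. Z \<omega> $ j) \<in> borel_measurable M)"
proof (intro iffI conjI ballI allI impI)
  assume Z: "Z \<in> M \<rightarrow>\<^sub>M vec_borel d"
  show "Z \<omega> \<in> carrier_vec d" if "\<omega> \<in> space M" for \<omega>
    using measurable_space[OF Z that] by simp
  fix j assume j: "j < d"
  have "(\<lambda>v. \<lambda>j\<in>{..<d}. v $ j) \<in> vec_borel d \<rightarrow>\<^sub>M (\<Pi>\<^sub>M j\<in>{..<d}. (borel :: real measure))"
    unfolding vec_borel_def by (rule measurable_vimage_algebra1) (auto simp: space_PiM)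
  from measurable_compose[OF this measurable_component_singleton[of j]] j
  have "(\<lambda>v. (\<lambda>j\<in>{..<d}. v $ j) j) \<in> vec_borel d \<rightarrow>\<^sub>M (borel :: real measure)"
    by simp
  from measurable_compose[OF Z this] show "(\<lambda>\<omega>. Z \<omega> $ j) \<in> borel_measurable M"
    using j by simp
next
  assume Z: "(\<forall>\<omega> \<in> space M. Z \<omega> \<in> carrier_vec d) \<and> (\<forall>j<d. (\<lambda>\<omega>. Z \<omega> $ j) \<in> borel_measurable M)"
  show "Z \<in> M \<rightarrow>\<^sub>M vec_borel d"
    unfolding vec_borel_def
  proof (rule measurable_vimage_algebra2)
    show "Z \<in> space M \<rightarrow> carrier_vec d" using Z by blast
    show "(\<lambda>\<omega>. \<lambda>j\<in>{..<d}. Z \<omega> $ j) \<in> M \<rightarrow>\<^sub>M (\<Pi>\<^sub>M j\<in>{..<d}. borel)"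
      using Z by (intro measurable_restrict) simp
  qed
qed

lemma measurable_vec_borelI:
  assumes "\<And>\<omega>. \<omega> \<in> space M \<Longrightarrow> Z \<omega> \<in> carrier_vec d"
    and "\<And>j. j < d \<Longrightarrow> (\<lambda>\<omega>. Z \<omega> $ j) \<in> borel_measurable M"
  shows "Z \<in> M \<rightarrow>\<^sub>M vec_borel d"
  using assms by (simp add: measurable_vec_borel_iff)

lemma measurable_vec_borelD:
  assumes "Z \<in> M \<rightarrow>\<^sub>M vec_borel d"
  shows "\<omega> \<in> space M \<Longrightarrow> Z \<omega> \<in> carrier_vec d" "j < d \<Longrightarrow> (\<lambda>\<omega>. Z \<omega> $ j) \<in> borel_measurable M"
  using assms by (auto simp: measurable_vec_borel_iff)

text \<open>Matrices occur only as coefficients and never through their law, so measurability is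
  asked of the entries rather than with respect to a Borel space of matrices.\<close>

definition random_matrix :: "'w measure \<Rightarrow> nat \<Rightarrow> nat \<Rightarrow> ('w \<Rightarrow> real mat) \<Rightarrow> bool" where
  "random_matrix M r c A \<longleftrightarrow> (\<forall>\<omega> \<in> space M. A \<omega> \<in> carrier_mat r c) \<and>
     (\<forall>a<r. \<forall>b<c. (\<lambda>\<omega>. A \<omega> $$ (a, b)) \<in> borel_measurable M)"

lemma random_matrixD:
  assumes "random_matrix M r c A"
  shows "\<omega> \<in> space M \<Longrightarrow> A \<omega> \<in> carrier_mat r c"
    "a < r \<Longrightarrow> b < c \<Longrightarrow> (\<lambda>\<omega>. A \<omega> $$ (a, b)) \<in> borel_measurable M"
  using assms by (auto simp: random_matrix_def)

lemma random_matrix_const: "A \<in> carrier_mat r c \<Longrightarrow> random_matrix M r c (\<lambda>_. A)"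
  by (simp add: random_matrix_def)

lemma random_matrix_mult:
  assumes A: "random_matrix M r n A" and B: "random_matrix M n c B"
  shows "random_matrix M r c (\<lambda>\<omega>. A \<omega> * B \<omega>)"
  unfolding random_matrix_def
proof (intro conjI ballI allI impI)
  show "A \<omega> * B \<omega> \<in> carrier_mat r c" if "\<omega> \<in> space M" for \<omega>
    using random_matrixD(1)[OF A that] random_matrixD(1)[OF B that] by simp
  fix a b assume ab: "a < r" "b < c"
  have "(\<lambda>\<omega>. \<Sum>k<n. A \<omega> $$ (a, k) * B \<omega> $$ (k, b)) \<in> borel_measurable M"
    using random_matrixD(2)[OF A] random_matrixD(2)[OF B] ab by auto
  \<comment> \<open>The entry formula requires the dimensions, which are known only on the sample
    space; hence a congruence of measurable functions instead of a rewrite.\<close>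
  also have "?this \<longleftrightarrow> (\<lambda>\<omega>. (A \<omega> * B \<omega>) $$ (a, b)) \<in> borel_measurable M"
    by (intro measurable_cong
        mult_mat_entry[OF random_matrixD(1)[OF A] random_matrixD(1)[OF B] ab, symmetric])
  finally show "(\<lambda>\<omega>. (A \<omega> * B \<omega>) $$ (a, b)) \<in> borel_measurable M" .
qed

lemma random_matrix_add:
  assumes A: "random_matrix M r c A" and B: "random_matrix M r c B"
  shows "random_matrix M r c (\<lambda>\<omega>. A \<omega> + B \<omega>)"
  unfolding random_matrix_def
proof (intro conjI ballI allI impI)
  show "A \<omega> + B \<omega> \<in> carrier_mat r c" if "\<omega> \<in> space M" for \<omega>
    using random_matrixD(1)[OF A that] random_matrixD(1)[OF B that] by simp
  fix a b assume ab: "a < r" "b < c"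
  have "(\<lambda>\<omega>. A \<omega> $$ (a, b) + B \<omega> $$ (a, b)) \<in> borel_measurable M"
    using random_matrixD(2)[OF A] random_matrixD(2)[OF B] ab by auto
  also have "?this \<longleftrightarrow> (\<lambda>\<omega>. (A \<omega> + B \<omega>) $$ (a, b)) \<in> borel_measurable M"
    by (intro measurable_cong
        add_mat_entry[OF random_matrixD(1)[OF A] random_matrixD(1)[OF B] ab, symmetric])
  finally show "(\<lambda>\<omega>. (A \<omega> + B \<omega>) $$ (a, b)) \<in> borel_measurable M" .
qed

text \<open>By the Leibniz formula the determinant is a polynomial in the entries.\<close>

lemma measurable_det:
  assumes A: "random_matrix M n n A"
  shows "(\<lambda>\<omega>. det (A \<omega>)) \<in> borel_measurable M"
proof -
  have "(\<lambda>\<omega>. \<Sum>p\<in>{p. p permutes {0..<n}}. signof p * (\<Prod>i = 0..<n. A \<omega> $$ (i, p i))) \<in> borel_measurable M"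
    by (intro borel_measurable_sum borel_measurable_times borel_measurable_prod
        borel_measurable_const random_matrixD(2)[OF A])
      (auto simp: permutes_in_image)
  also have "?this \<longleftrightarrow> ?thesis"
    by (intro measurable_cong det_def'[symmetric] random_matrixD(1)[OF A])
  finally show ?thesis .
qed

lemma random_matrix_adj:
  assumes A: "random_matrix M n n A"
  shows "random_matrix M n n (\<lambda>\<omega>. adj_mat (A \<omega>))"
  unfolding random_matrix_def
proof (intro conjI ballI allI impI)
  show "adj_mat (A \<omega>) \<in> carrier_mat n n" if "\<omega> \<in> space M" for \<omega>
    using adj_mat(1)[OF random_matrixD(1)[OF A that]] .
  fix a b assume ab: "a < n" "b < n"
  have "random_matrix M (n - 1) (n - 1) (\<lambda>\<omega>. mat_delete (A \<omega>) b a)"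
    unfolding random_matrix_def
  proof (intro conjI ballI allI impI)
    show "mat_delete (A \<omega>) b a \<in> carrier_mat (n - 1) (n - 1)" if "\<omega> \<in> space M" for \<omega>
      using random_matrixD(1)[OF A that] by (simp add: mat_delete_def)
    fix i j assume ij: "i < n - 1" "j < n - 1"
    have "(\<lambda>\<omega>. A \<omega> $$ (if i < b then i else Suc i, if j < a then j else Suc j)) \<in> borel_measurable M"
      using ij by (intro random_matrixD(2)[OF A]) auto
    also have "?this \<longleftrightarrow> (\<lambda>\<omega>. mat_delete (A \<omega>) b a $$ (i, j)) \<in> borel_measurable M"
    proof (intro measurable_cong)
      fix \<omega> assume "\<omega> \<in> space M"
      with random_matrixD(1)[OF A] have "A \<omega> \<in> carrier_mat n n" .
      then show "A \<omega> $$ (if i < b then i else Suc i, if j < a then j else Suc j) =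
          mat_delete (A \<omega>) b a $$ (i, j)"
        using ij by (auto simp: mat_delete_def)
    qed
    finally show "(\<lambda>\<omega>. mat_delete (A \<omega>) b a $$ (i, j)) \<in> borel_measurable M" .
  qed
  from measurable_det[OF this]
  have "(\<lambda>\<omega>. (- 1) ^ (b + a) * det (mat_delete (A \<omega>) b a)) \<in> borel_measurable M"
    by simp
  also have "?this \<longleftrightarrow> (\<lambda>\<omega>. adj_mat (A \<omega>) $$ (a, b)) \<in> borel_measurable M"
  proof (intro measurable_cong)
    fix \<omega> assume "\<omega> \<in> space M"
    with random_matrixD(1)[OF A] have "A \<omega> \<in> carrier_mat n n" .
    then show "(- 1) ^ (b + a) * det (mat_delete (A \<omega>) b a) = adj_mat (A \<omega>) $$ (a, b)"
      using ab by (auto simp: adj_mat_def cofactor_def)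
  qed
  finally show "(\<lambda>\<omega>. adj_mat (A \<omega>) $$ (a, b)) \<in> borel_measurable M" .
qed

text \<open>Each entry is a cofactor divided by the determinant. Pointwise positive definiteness
  makes the adjugate formula valid at every sample point.\<close>

lemma random_matrix_inverse:
  assumes A: "random_matrix M n n A" and pd: "\<And>\<omega>. \<omega> \<in> space M \<Longrightarrow> pd_matrix n (A \<omega>)"
  shows "random_matrix M n n (\<lambda>\<omega>. the (mat_inverse (A \<omega>)))"
  unfolding random_matrix_def
proof (intro conjI ballI allI impI)
  show "the (mat_inverse (A \<omega>)) \<in> carrier_mat n n" if "\<omega> \<in> space M" for \<omega>
    using mat_inverse_pd(1)[OF pd[OF that]] .
  fix a b assume ab: "a < n" "b < n"
  note [measurable] = measurable_det[OF A] random_matrixD(2)[OF random_matrix_adj[OF A] ab]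
  have "(\<lambda>\<omega>. (1 / det (A \<omega>)) * adj_mat (A \<omega>) $$ (a, b)) \<in> borel_measurable M" by measurable
  also have "?this \<longleftrightarrow> (\<lambda>\<omega>. the (mat_inverse (A \<omega>)) $$ (a, b)) \<in> borel_measurable M"
  proof (intro measurable_cong)
    fix \<omega> assume \<omega>: "\<omega> \<in> space M"
    have "adj_mat (A \<omega>) \<in> carrier_mat n n"
      by (rule adj_mat(1)[OF random_matrixD(1)[OF A \<omega>]])
    then show "(1 / det (A \<omega>)) * adj_mat (A \<omega>) $$ (a, b) = the (mat_inverse (A \<omega>)) $$ (a, b)"
      using ab by (subst mat_inverse_pd(4)[OF pd[OF \<omega>]]) simp
  qed
  finally show "(\<lambda>\<omega>. the (mat_inverse (A \<omega>)) $$ (a, b)) \<in> borel_measurable M" .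
qed

lemma measurable_mult_mat_vec:
  assumes A: "random_matrix M r c A" and Z: "Z \<in> M \<rightarrow>\<^sub>M vec_borel c"
  shows "(\<lambda>\<omega>. A \<omega> *\<^sub>v Z \<omega>) \<in> M \<rightarrow>\<^sub>M vec_borel r"
proof (rule measurable_vec_borelI)
  show "A \<omega> *\<^sub>v Z \<omega> \<in> carrier_vec r" if "\<omega> \<in> space M" for \<omega>
    using random_matrixD(1)[OF A that] measurable_vec_borelD(1)[OF Z that] by simp
  fix a assume a: "a < r"
  have "(\<lambda>\<omega>. \<Sum>b<c. A \<omega> $$ (a, b) * Z \<omega> $ b) \<in> borel_measurable M"
    using random_matrixD(2)[OF A] measurable_vec_borelD(2)[OF Z] a by auto
  also have "?this \<longleftrightarrow> (\<lambda>\<omega>. (A \<omega> *\<^sub>v Z \<omega>) $ a) \<in> borel_measurable M"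
    by (intro measurable_cong
        mult_mat_vec_entry[OF random_matrixD(1)[OF A] measurable_vec_borelD(1)[OF Z] a, symmetric])
  finally show "(\<lambda>\<omega>. (A \<omega> *\<^sub>v Z \<omega>) $ a) \<in> borel_measurable M" .
qed

lemma measurable_add_vec:
  assumes Y: "Y \<in> M \<rightarrow>\<^sub>M vec_borel d" and Z: "Z \<in> M \<rightarrow>\<^sub>M vec_borel d"
  shows "(\<lambda>\<omega>. Y \<omega> + Z \<omega>) \<in> M \<rightarrow>\<^sub>M vec_borel d" "(\<lambda>\<omega>. Y \<omega> - Z \<omega>) \<in> M \<rightarrow>\<^sub>M vec_borel d"
proof -
  note c = measurable_vec_borelD(1)[OF Y] measurable_vec_borelD(1)[OF Z]
  show "(\<lambda>\<omega>. Y \<omega> + Z \<omega>) \<in> M \<rightarrow>\<^sub>M vec_borel d"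
  proof (rule measurable_vec_borelI)
    fix j assume j: "j < d"
    have "(\<lambda>\<omega>. Y \<omega> $ j + Z \<omega> $ j) \<in> borel_measurable M"
      using measurable_vec_borelD(2)[OF Y j] measurable_vec_borelD(2)[OF Z j] by simp
    also have "?this \<longleftrightarrow> (\<lambda>\<omega>. (Y \<omega> + Z \<omega>) $ j) \<in> borel_measurable M"
      by (intro measurable_cong add_vec_entry(1)[OF c j, symmetric])
    finally show "(\<lambda>\<omega>. (Y \<omega> + Z \<omega>) $ j) \<in> borel_measurable M" .
  qed (use c in auto)
  show "(\<lambda>\<omega>. Y \<omega> - Z \<omega>) \<in> M \<rightarrow>\<^sub>M vec_borel d"
  proof (rule measurable_vec_borelI)
    fix j assume j: "j < d"
    have "(\<lambda>\<omega>. Y \<omega> $ j - Z \<omega> $ j) \<in> borel_measurable M"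
      using measurable_vec_borelD(2)[OF Y j] measurable_vec_borelD(2)[OF Z j] by simp
    also have "?this \<longleftrightarrow> (\<lambda>\<omega>. (Y \<omega> - Z \<omega>) $ j) \<in> borel_measurable M"
      by (intro measurable_cong add_vec_entry(2)[OF c j, symmetric])
    finally show "(\<lambda>\<omega>. (Y \<omega> - Z \<omega>) $ j) \<in> borel_measurable M" .
  qed (use c in auto)
qed

lemma measurable_append_vec:
  assumes Y: "Y \<in> M \<rightarrow>\<^sub>M vec_borel d" and Z: "Z \<in> M \<rightarrow>\<^sub>M vec_borel e"
  shows "(\<lambda>\<omega>. Y \<omega> @\<^sub>v Z \<omega>) \<in> M \<rightarrow>\<^sub>M vec_borel (d + e)"
proof (rule measurable_vec_borelI)
  note c = measurable_vec_borelD(1)[OF Y] measurable_vec_borelD(1)[OF Z]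
  show "Y \<omega> @\<^sub>v Z \<omega> \<in> carrier_vec (d + e)" if "\<omega> \<in> space M" for \<omega>
    using c that by auto
  fix j assume j: "j < d + e"
  show "(\<lambda>\<omega>. (Y \<omega> @\<^sub>v Z \<omega>) $ j) \<in> borel_measurable M"
  proof (cases "j < d")
    case True
    have "(\<lambda>\<omega>. Y \<omega> $ j) \<in> borel_measurable M" by (rule measurable_vec_borelD(2)[OF Y True])
    also have "?this \<longleftrightarrow> (\<lambda>\<omega>. (Y \<omega> @\<^sub>v Z \<omega>) $ j) \<in> borel_measurable M"
    proof (intro measurable_cong)
      fix \<omega> assume "\<omega> \<in> space M"
      with c have "Y \<omega> \<in> carrier_vec d" "Z \<omega> \<in> carrier_vec e" by auto
      then show "Y \<omega> $ j = (Y \<omega> @\<^sub>v Z \<omega>) $ j" using True by auto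
    qed
    finally show ?thesis .
  next
    case False
    have "(\<lambda>\<omega>. Z \<omega> $ (j - d)) \<in> borel_measurable M"
      using j False by (intro measurable_vec_borelD(2)[OF Z]) auto
    also have "?this \<longleftrightarrow> (\<lambda>\<omega>. (Y \<omega> @\<^sub>v Z \<omega>) $ j) \<in> borel_measurable M"
    proof (intro measurable_cong)
      fix \<omega> assume "\<omega> \<in> space M"
      with c have "Y \<omega> \<in> carrier_vec d" "Z \<omega> \<in> carrier_vec e" by auto
      then show "Z \<omega> $ (j - d) = (Y \<omega> @\<^sub>v Z \<omega>) $ j" using j False by auto
    qed
    finally show ?thesis .
  qed
qed

lemma random_matrix_sample_cov:
  assumes Z: "\<And>n. 1 \<le> n \<Longrightarrow> Z n \<in> M \<rightarrow>\<^sub>M vec_borel d"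
  shows "random_matrix M d d (\<lambda>\<omega>. sample_cov d N (\<lambda>n. Z n \<omega>))"
  unfolding random_matrix_def
proof (intro conjI ballI allI impI)
  fix a b assume ab: "a < d" "b < d"
  have [measurable]: "(\<lambda>\<omega>. Z n \<omega> $ j) \<in> borel_measurable M" if "j < d" "n \<in> {1..N}" for j n
    using measurable_vec_borelD(2)[OF Z] that by auto
  show "(\<lambda>\<omega>. sample_cov d N (\<lambda>n. Z n \<omega>) $$ (a, b)) \<in> borel_measurable M"
    unfolding sample_cov_def sample_mean_def using ab by simp measurable
qed simp

section \<open>Uniqueness of multivariate laws\<close>

text \<open>Levy's uniqueness theorem for finite measures. The characteristic function at 0 is the
  total mass c, so both measures have the same mass; if c > 0 they are rescaled to probabilities,
  and if c = 0 both are zero.\<close>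

lemma char_eq_imp_eq:
  fixes M1 M2 :: "real measure"
  assumes fin: "finite_measure M1" "finite_measure M2"
    and [measurable_cong, simp]: "sets M1 = sets borel" "sets M2 = sets borel"
    and char: "\<And>t. char M1 t = char M2 t"
  shows "M1 = M2"
proof -
  interpret M1: finite_measure M1 by (rule fin)
  interpret M2: finite_measure M2 by (rule fin)
  have sp [simp]: "space M1 = UNIV" "space M2 = UNIV"
    using sets_eq_imp_space_eq[of M1 borel] sets_eq_imp_space_eq[of M2 borel] by auto
  define c where "c = measure M1 UNIV"
  have c: "c = measure M2 UNIV"
    using char[of 0] by (simp add: char_def c_def)
  have em: "emeasure M1 UNIV = ennreal c" "emeasure M2 UNIV = ennreal c"
    using M1.emeasure_eq_measure[of UNIV] M2.emeasure_eq_measure[of UNIV] c c_def by auto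
  show ?thesis
  proof (cases "c = 0")
    case True
    have "emeasure M1 A = emeasure M2 A" for A
      using emeasure_mono[of A UNIV M1] emeasure_mono[of A UNIV M2] em True by simp
    then show ?thesis by (intro measure_eqI) auto
  next
    case False
    then have c0: "0 < c" by (simp add: c_def zero_less_measure_iff M1.emeasure_eq_measure)
    let ?D = "\<lambda>M. density M (\<lambda>_. ennreal (1 / c))"
    have prob: "real_distribution (?D M)" if "M \<in> {M1, M2}" for M
    proof -
      have s: "sets M = sets borel" "emeasure M UNIV = ennreal c" "space M = UNIV"
        using that em by auto
      have "emeasure (?D M) UNIV = 1"
        using s c0 by (subst emeasure_density_const) (auto simp flip: ennreal_mult)
      then have "prob_space (?D M)" by (intro prob_spaceI) (simp add: s)
      then show ?thesis
        by (simp add: real_distribution_def real_distribution_axioms_def s)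
    qed
    have ch: "char (?D M) t = (1 / c) *\<^sub>R char M t" if "M \<in> {M1, M2}" for M t
    proof -
      have s [measurable_cong]: "sets M = sets borel" using that by auto
      have "char (?D M) t = (CLINT x|M. (1 / c) *\<^sub>R iexp (t * x))"
        unfolding char_def using c0 by (intro integral_density) auto
      then show ?thesis by (simp add: char_def)
    qed
    have "?D M1 = ?D M2"
      by (rule Levy_uniqueness) (use prob ch char in \<open>auto simp: fun_eq_iff\<close>)
    moreover have "emeasure M A = ennreal c * emeasure (?D M) A"
      if "M \<in> {M1, M2}" "A \<in> sets borel" for M A
    proof -
      have "A \<in> sets M" using that by auto
      then have "ennreal c * emeasure (?D M) A = ennreal c * ennreal (1 / c) * emeasure M A"
        by (simp only: emeasure_density_const mult.assoc)
      also have "ennreal c * ennreal (1 / c) = 1"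
        using c0 by (simp flip: ennreal_mult)
      finally show ?thesis by simp
    qed
    ultimately have "emeasure M1 A = emeasure M2 A" if "A \<in> sets borel" for A
      using that by simp
    then show ?thesis by (intro measure_eqI) auto
  qed
qed

lemma finite_measure_density_integrable:
  fixes g :: "'a \<Rightarrow> real"
  assumes g: "integrable M g" "\<And>\<omega>. 0 \<le> g \<omega>"
  shows "finite_measure (density M (\<lambda>\<omega>. ennreal (g \<omega>)))"
proof (rule finite_measureI)
  have [measurable]: "g \<in> borel_measurable M" using g by simp
  have "emeasure (density M g) (space M) = (\<integral>\<^sup>+\<omega>. ennreal (g \<omega>) \<partial>M)"
    by (subst emeasure_density) (auto intro!: nn_integral_cong)
  also have "\<dots> = ennreal (\<integral>\<omega>. g \<omega> \<partial>M)"
    using g by (intro nn_integral_eq_integral) auto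
  finally show "emeasure (density M g) (space (density M g)) \<noteq> \<infinity>" by simp
qed

lemma integrable_iexp:
  assumes "finite_measure M" and [measurable]: "f \<in> borel_measurable M"
  shows "integrable M (\<lambda>\<omega>. iexp (f \<omega>))"
proof -
  interpret finite_measure M by fact
  show ?thesis by (rule integrable_const_bound[of _ 1]) auto
qed

text \<open>
  The weights \<open>1 + cos (S + \<theta>)\<close> are nonnegative, so that the one-dimensional uniqueness theorem applies
  to the law of the last coordinate weighted by them.
\<close>

lemma weighted_marginal_eq:
  fixes X Y :: "nat \<Rightarrow> 'a \<Rightarrow> real"
  assumes fin: "finite_measure P" "finite_measure Q"
    and [measurable]: "\<And>j. j \<le> d \<Longrightarrow> X j \<in> borel_measurable P" "\<And>j. j \<le> d \<Longrightarrow> Y j \<in> borel_measurable Q"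
    and char: "\<And>t. (CLINT \<omega>|P. iexp (\<Sum>j<Suc d. t j * X j \<omega>)) = (CLINT \<omega>|Q. iexp (\<Sum>j<Suc d. t j * Y j \<omega>))"
    and B [measurable]: "B \<in> sets borel"
  shows "(\<integral>\<omega>. indicator B (X d \<omega>) * (1 + cos ((\<Sum>j<d. t j * X j \<omega>) + \<theta>)) \<partial>P) =
    (\<integral>\<omega>. indicator B (Y d \<omega>) * (1 + cos ((\<Sum>j<d. t j * Y j \<omega>) + \<theta>)) \<partial>Q)"
proof -
  define D where "D M S = density M (\<lambda>\<omega>. ennreal (1 + cos (S \<omega> + \<theta>)))" for M :: "'a measure" and S
  have nonneg: "0 \<le> 1 + cos x" for x :: real using cos_ge_minus_one[of x] by linarith
  have le2: "1 + cos x \<le> 2" for x :: real using cos_le_one[of x] by linarith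
  have cosx: "complex_of_real (cos x) = (iexp x + iexp (- x)) / 2" for x
    by (simp add: cos_of_real[symmetric] cos_exp_eq)
  have lin: "(CLINT \<omega>|M. f \<omega> + a * g \<omega> + b * h \<omega>) = (CLINT \<omega>|M. f \<omega>) + a * (CLINT \<omega>|M. g \<omega>) + b * (CLINT \<omega>|M. h \<omega>)"
    if "complex_integrable M f" "complex_integrable M g" "complex_integrable M h"
    for M :: "'a measure" and f g h a b
    using that by simp
  have finD: "finite_measure (distr (D M S) borel Z)"
    if "finite_measure M" and [measurable]: "S \<in> borel_measurable M" "Z \<in> borel_measurable M" for M S Z
  proof -
    interpret finite_measure M by fact
    have "integrable M (\<lambda>\<omega>. 1 + cos (S \<omega> + \<theta>))"
      using nonneg le2 by (intro integrable_const_bound[of _ 2]) auto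
    then have "finite_measure (D M S)"
      unfolding D_def by (rule finite_measure_density_integrable) (simp add: nonneg)
    then show ?thesis
      by (rule finite_measure.finite_measure_distr) (simp add: D_def)
  qed
  \<comment> \<open>The cosine weight is half a sum of two exponentials, so the characteristic
    function of the weighted law combines three joint characteristic functions, with factors 0, 1
    and -1 on the partial sum.\<close>
  have charD: "char (distr (D M S) borel Z) s =
      (CLINT \<omega>|M. iexp (s * Z \<omega>)) +
      (iexp \<theta> / 2) * (CLINT \<omega>|M. iexp (S \<omega> + s * Z \<omega>)) + (iexp (- \<theta>) / 2) * (CLINT \<omega>|M. iexp (- S \<omega> + s * Z \<omega>))"
    if M: "finite_measure M" and [measurable]: "S \<in> borel_measurable M" "Z \<in> borel_measurable M" for M S Z s
  proof -
    have "char (distr (D M S) borel Z) s = (CLINT \<omega>|D M S. iexp (s * Z \<omega>))"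
      unfolding char_def by (subst integral_distr) (auto simp: D_def)
    also have "\<dots> = (CLINT \<omega>|M. (1 + cos (S \<omega> + \<theta>)) *\<^sub>R iexp (s * Z \<omega>))"
      unfolding D_def by (intro integral_density) (auto simp: nonneg)
    also have "\<dots> = (CLINT \<omega>|M. iexp (s * Z \<omega>) + (iexp \<theta> / 2) * iexp (S \<omega> + s * Z \<omega>) +
        (iexp (- \<theta>) / 2) * iexp (- S \<omega> + s * Z \<omega>))"
    proof (intro Bochner_Integration.integral_cong refl)
      fix \<omega>
      have "complex_of_real (cos (S \<omega> + \<theta>)) = (iexp (S \<omega> + \<theta>) + iexp (- (S \<omega> + \<theta>))) / 2"
        using cosx .
      moreover have "iexp (S \<omega> + \<theta>) * iexp (s * Z \<omega>) = iexp \<theta> * iexp (S \<omega> + s * Z \<omega>)"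
        "iexp (- (S \<omega> + \<theta>)) * iexp (s * Z \<omega>) = iexp (- \<theta>) * iexp (- S \<omega> + s * Z \<omega>)"
        by (simp_all add: algebra_simps flip: exp_add)
      ultimately show "(1 + cos (S \<omega> + \<theta>)) *\<^sub>R iexp (s * Z \<omega>) = iexp (s * Z \<omega>) +
          (iexp \<theta> / 2) * iexp (S \<omega> + s * Z \<omega>) + (iexp (- \<theta>) / 2) * iexp (- S \<omega> + s * Z \<omega>)"
        by (simp only: scaleR_conv_of_real of_real_add of_real_1 distrib_right add_divide_distrib
            times_divide_eq_left mult_1_left add.assoc)
    qed
    also have "\<dots> = (CLINT \<omega>|M. iexp (s * Z \<omega>)) +
      (iexp \<theta> / 2) * (CLINT \<omega>|M. iexp (S \<omega> + s * Z \<omega>)) + (iexp (- \<theta>) / 2) * (CLINT \<omega>|M. iexp (- S \<omega> + s * Z \<omega>))"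
      by (rule lin; rule integrable_iexp[OF M]; measurable)
    finally show ?thesis .
  qed
  let ?S = "\<lambda>\<omega>. \<Sum>j<d. t j * X j \<omega>" and ?T = "\<lambda>\<omega>. \<Sum>j<d. t j * Y j \<omega>"
  \<comment> \<open>The hypothesis on joint characteristic functions is taken at the coefficients r
    t_j on the leading d coordinates and s on the last one; it is needed for r = 0, 1, -1.\<close>
  have c: "(CLINT \<omega>|P. iexp (r * ?S \<omega> + s * X d \<omega>)) = (CLINT \<omega>|Q. iexp (r * ?T \<omega> + s * Y d \<omega>))" for r s
  proof -
    have "(\<Sum>j<Suc d. (if j < d then r * t j else s) * Z j) = r * (\<Sum>j<d. t j * Z j) + s * Z d" for Z :: "nat \<Rightarrow> real"
      by (simp add: sum_distrib_left mult.assoc)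
    then show ?thesis
      using char[of "\<lambda>j. if j < d then r * t j else s"] by (simp only:)
  qed
  have "distr (D P ?S) borel (X d) = distr (D Q ?T) borel (Y d)"
  proof (rule char_eq_imp_eq)
    fix s
    have m: "?S \<in> borel_measurable P" "X d \<in> borel_measurable P"
      "?T \<in> borel_measurable Q" "Y d \<in> borel_measurable Q" by simp_all
    have "(CLINT \<omega>|P. iexp (s * X d \<omega>)) = (CLINT \<omega>|Q. iexp (s * Y d \<omega>))"
      "(CLINT \<omega>|P. iexp (?S \<omega> + s * X d \<omega>)) = (CLINT \<omega>|Q. iexp (?T \<omega> + s * Y d \<omega>))"
      "(CLINT \<omega>|P. iexp (- ?S \<omega> + s * X d \<omega>)) = (CLINT \<omega>|Q. iexp (- ?T \<omega> + s * Y d \<omega>))"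
      using c[of 0 s] c[of 1 s] c[of "-1" s] unfolding mult_zero_left mult_1 mult_minus1 add_0 .
    then show "char (distr (D P ?S) borel (X d)) s = char (distr (D Q ?T) borel (Y d)) s"
      unfolding charD[OF fin(1) m(1,2)] charD[OF fin(2) m(3,4)] by (simp only:)
  next
    show "finite_measure (distr (D P ?S) borel (X d))" by (rule finD[OF fin(1)]) simp_all
    show "finite_measure (distr (D Q ?T) borel (Y d))" by (rule finD[OF fin(2)]) simp_all
  qed simp_all
  moreover have w: "(\<integral>x. indicator B x \<partial>distr (D M S) borel Z) = (\<integral>\<omega>. indicator B (Z \<omega>) * (1 + cos (S \<omega> + \<theta>)) \<partial>M)"
    if [measurable]: "S \<in> borel_measurable M" "Z \<in> borel_measurable M" for M S Z
  proof -
    have "(\<integral>x. indicator B x \<partial>distr (D M S) borel Z) = (\<integral>\<omega>. indicator B (Z \<omega>) \<partial>D M S :: real)"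
      by (subst integral_distr) (auto simp: D_def)
    also have "\<dots> = (\<integral>\<omega>. (1 + cos (S \<omega> + \<theta>)) *\<^sub>R indicator B (Z \<omega>) \<partial>M)"
      unfolding D_def by (intro integral_density) (auto simp: nonneg)
    finally show ?thesis by (simp add: mult.commute)
  qed
  moreover have "?S \<in> borel_measurable P" "X d \<in> borel_measurable P"
      "?T \<in> borel_measurable Q" "Y d \<in> borel_measurable Q" by simp_all
  ultimately show ?thesis
    using w[of ?S P "X d"] w[of ?T Q "Y d"] by (simp only:)
qed

text \<open>Induction on the number of coordinates, with the measures varying: both are restricted
  to the event that the last coordinate lies in its set. The characteristic functions of the
  remaining coordinates under the restricted measures are recovered from
  \<open>weighted_marginal_eq\<close>.\<close>

lemma joint_law_eq:
  fixes X Y :: "nat \<Rightarrow> 'a \<Rightarrow> real"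
  assumes "finite_measure P" "finite_measure Q"
    and "\<And>j. j < d \<Longrightarrow> X j \<in> borel_measurable P" "\<And>j. j < d \<Longrightarrow> Y j \<in> borel_measurable Q"
    and "\<And>t. (CLINT \<omega>|P. iexp (\<Sum>j<d. t j * X j \<omega>)) = (CLINT \<omega>|Q. iexp (\<Sum>j<d. t j * Y j \<omega>))"
    and "\<And>j. j < d \<Longrightarrow> A j \<in> sets borel"
  shows "measure P {\<omega> \<in> space P. \<forall>j<d. X j \<omega> \<in> A j} = measure Q {\<omega> \<in> space Q. \<forall>j<d. Y j \<omega> \<in> A j}"
  using assms
proof (induction d arbitrary: P Q)
  case 0
  then show ?case by simp
next
  case (Suc d)
  note fin = Suc.prems(1,2)
  have X [measurable]: "X j \<in> borel_measurable P" and Y [measurable]: "Y j \<in> borel_measurable Q"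
    if "j \<le> d" for j
    using Suc.prems(3,4) that by simp_all
  have A [measurable]: "A j \<in> sets borel" if "j \<le> d" for j
    using Suc.prems(6) that by simp
  \<comment> \<open>Restriction as a density keeps the sample space and its measurable sets, so
    measurability of the other coordinates passes to the restricted measure.\<close>
  define D where "D M Z = density M (\<lambda>\<omega>. ennreal (indicator (A d) (Z \<omega>)))"
    for M :: "'a measure" and Z :: "'a \<Rightarrow> real"
  have finD: "finite_measure (D M Z)"
    if "finite_measure M" and [measurable]: "Z \<in> borel_measurable M" for M Z
  proof -
    interpret finite_measure M by fact
    have "integrable M (\<lambda>\<omega>. indicator (A d) (Z \<omega>) :: real)"
      by (rule integrable_const_bound[of _ 1]) (auto simp: indicator_def)
    then show ?thesis
      unfolding D_def by (rule finite_measure_density_integrable) simp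
  qed
  have split: "measure (D M Z) {\<omega> \<in> space (D M Z). \<forall>j<d. U j \<omega> \<in> A j} =
      measure M {\<omega> \<in> space M. \<forall>j<Suc d. U j \<omega> \<in> A j}"
    if [measurable]: "Z \<in> borel_measurable M" "\<And>j. j < d \<Longrightarrow> U j \<in> borel_measurable M" and Z: "U d = Z"
    for M Z and U :: "nat \<Rightarrow> 'a \<Rightarrow> real"
  proof -
    have "{\<omega> \<in> space M. \<forall>j\<in>{..<d}. U j \<omega> \<in> A j} \<in> sets M"
    proof (rule sets.sets_Collect_finite_All)
      fix j assume "j \<in> {..<d}"
      then have "U j -` A j \<inter> space M \<in> sets M" by (intro measurable_sets[OF that(2)] A) auto
      also have "U j -` A j \<inter> space M = {\<omega> \<in> space M. U j \<omega> \<in> A j}" by auto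
      finally show "{\<omega> \<in> space M. U j \<omega> \<in> A j} \<in> sets M" .
    qed simp
    then have m [measurable]: "{\<omega> \<in> space M. \<forall>j<d. U j \<omega> \<in> A j} \<in> sets M" by simp
    have "Z -` A d \<inter> space M \<in> sets M" by (intro measurable_sets[OF that(1)] A) auto
    also have "Z -` A d \<inter> space M = {\<omega> \<in> space M. Z \<omega> \<in> A d}" by auto
    finally have m' [measurable]: "{\<omega> \<in> space M. Z \<omega> \<in> A d} \<in> sets M" .
    have "emeasure (D M Z) {\<omega> \<in> space M. \<forall>j<d. U j \<omega> \<in> A j} =
        (\<integral>\<^sup>+\<omega>. indicator ({\<omega> \<in> space M. Z \<omega> \<in> A d} \<inter> {\<omega> \<in> space M. \<forall>j<d. U j \<omega> \<in> A j}) \<omega> \<partial>M)"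
    proof -
      have "emeasure (D M Z) {\<omega> \<in> space M. \<forall>j<d. U j \<omega> \<in> A j} =
          (\<integral>\<^sup>+\<omega>. ennreal (indicator (A d) (Z \<omega>)) * indicator {\<omega> \<in> space M. \<forall>j<d. U j \<omega> \<in> A j} \<omega> \<partial>M)"
        unfolding D_def by (rule emeasure_density[OF _ m]) simp
      also have "\<dots> = (\<integral>\<^sup>+\<omega>. indicator ({\<omega> \<in> space M. Z \<omega> \<in> A d} \<inter> {\<omega> \<in> space M. \<forall>j<d. U j \<omega> \<in> A j}) \<omega> \<partial>M)"
        by (intro nn_integral_cong) (auto split: split_indicator)
      finally show ?thesis .
    qed
    also have "\<dots> = emeasure M ({\<omega> \<in> space M. Z \<omega> \<in> A d} \<inter> {\<omega> \<in> space M. \<forall>j<d. U j \<omega> \<in> A j})"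
      by (intro nn_integral_indicator sets.Int m m')
    also have "{\<omega> \<in> space M. Z \<omega> \<in> A d} \<inter> {\<omega> \<in> space M. \<forall>j<d. U j \<omega> \<in> A j} =
        {\<omega> \<in> space M. \<forall>j<Suc d. U j \<omega> \<in> A j}"
      using Z by (auto simp: less_Suc_eq)
    finally show ?thesis by (simp add: measure_def D_def)
  qed
  have ci: "(CLINT \<omega>|D M Z. iexp (S \<omega>)) = complex_of_real (\<integral>\<omega>. indicator (A d) (Z \<omega>) * cos (S \<omega>) \<partial>M)
      + \<i> * complex_of_real (\<integral>\<omega>. indicator (A d) (Z \<omega>) * sin (S \<omega>) \<partial>M)"
    if "finite_measure M" and [measurable]: "S \<in> borel_measurable M" "Z \<in> borel_measurable M" for M S Z
  proof -
    interpret finite_measure M by fact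
    have i: "integrable M (\<lambda>\<omega>. indicator (A d) (Z \<omega>) * cos (S \<omega>))"
      "integrable M (\<lambda>\<omega>. indicator (A d) (Z \<omega>) * sin (S \<omega>))"
      by (rule integrable_const_bound[of _ 1]; auto simp: indicator_def)+
    have "(CLINT \<omega>|D M Z. iexp (S \<omega>)) = (CLINT \<omega>|M. indicator (A d) (Z \<omega>) *\<^sub>R iexp (S \<omega>))"
      unfolding D_def by (intro integral_density) auto
    also have "\<dots> = (CLINT \<omega>|M. complex_of_real (indicator (A d) (Z \<omega>) * cos (S \<omega>))
        + \<i> * complex_of_real (indicator (A d) (Z \<omega>) * sin (S \<omega>)))"
      by (intro Bochner_Integration.integral_cong refl) (simp add: exp_Euler cos_of_real sin_of_real scaleR_conv_of_real algebra_simps)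
    also have "\<dots> = (CLINT \<omega>|M. complex_of_real (indicator (A d) (Z \<omega>) * cos (S \<omega>)))
        + (CLINT \<omega>|M. \<i> * complex_of_real (indicator (A d) (Z \<omega>) * sin (S \<omega>)))"
      by (rule Bochner_Integration.integral_add)
        (intro integrable_mult_right integrable_of_real i)+
    finally show ?thesis
      unfolding integral_mult_right_zero integral_complex_of_real .
  qed
  \<comment> \<open>Cosine and sine are half-differences of the admissible weights 1 + cos (x +
    \<theta>): phases 0 and pi for the cosine, -pi/2 and pi/2 for the sine.\<close>
  have trig: "(\<integral>\<omega>. indicator (A d) (Z \<omega>) * cos (S \<omega>) \<partial>M) =
      ((\<integral>\<omega>. indicator (A d) (Z \<omega>) * (1 + cos (S \<omega> + 0)) \<partial>M) -
        (\<integral>\<omega>. indicator (A d) (Z \<omega>) * (1 + cos (S \<omega> + pi)) \<partial>M)) / 2"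
    "(\<integral>\<omega>. indicator (A d) (Z \<omega>) * sin (S \<omega>) \<partial>M) =
      ((\<integral>\<omega>. indicator (A d) (Z \<omega>) * (1 + cos (S \<omega> + - (pi / 2))) \<partial>M) -
        (\<integral>\<omega>. indicator (A d) (Z \<omega>) * (1 + cos (S \<omega> + pi / 2)) \<partial>M)) / 2"
    if "finite_measure M" and [measurable]: "S \<in> borel_measurable M" "Z \<in> borel_measurable M" for M S Z
  proof -
    interpret finite_measure M by fact
    have i: "integrable M (\<lambda>\<omega>. indicator (A d) (Z \<omega>) * (1 + cos (S \<omega> + \<theta>)))" for \<theta>
    proof (rule integrable_const_bound[of _ 2])
      have "\<bar>1 + cos x\<bar> \<le> 2" for x :: real
        using cos_ge_minus_one[of x] cos_le_one[of x] by linarith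
      then show "AE \<omega> in M. norm (indicator (A d) (Z \<omega>) * (1 + cos (S \<omega> + \<theta>))) \<le> 2"
        by (auto simp: indicator_def)
    qed simp
    show "(\<integral>\<omega>. indicator (A d) (Z \<omega>) * cos (S \<omega>) \<partial>M) =
      ((\<integral>\<omega>. indicator (A d) (Z \<omega>) * (1 + cos (S \<omega> + 0)) \<partial>M) -
        (\<integral>\<omega>. indicator (A d) (Z \<omega>) * (1 + cos (S \<omega> + pi)) \<partial>M)) / 2"
      unfolding Bochner_Integration.integral_diff[OF i i, symmetric] integral_divide_zero[symmetric]
      by (intro Bochner_Integration.integral_cong refl) (simp add: algebra_simps)
    show "(\<integral>\<omega>. indicator (A d) (Z \<omega>) * sin (S \<omega>) \<partial>M) =
      ((\<integral>\<omega>. indicator (A d) (Z \<omega>) * (1 + cos (S \<omega> + - (pi / 2))) \<partial>M) -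
        (\<integral>\<omega>. indicator (A d) (Z \<omega>) * (1 + cos (S \<omega> + pi / 2)) \<partial>M)) / 2"
      unfolding Bochner_Integration.integral_diff[OF i i, symmetric] integral_divide_zero[symmetric]
      by (intro Bochner_Integration.integral_cong refl) (simp add: cos_add cos_diff algebra_simps)
  qed
  have "measure (D P (X d)) {\<omega> \<in> space (D P (X d)). \<forall>j<d. X j \<omega> \<in> A j} =
    measure (D Q (Y d)) {\<omega> \<in> space (D Q (Y d)). \<forall>j<d. Y j \<omega> \<in> A j}"
  proof (rule Suc.IH)
    show "finite_measure (D P (X d))" "finite_measure (D Q (Y d))"
      by (rule finD[OF fin(1) X[OF order_refl]], rule finD[OF fin(2) Y[OF order_refl]])
    show "X j \<in> borel_measurable (D P (X d))" "Y j \<in> borel_measurable (D Q (Y d))" "A j \<in> sets borel"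
      if "j < d" for j
      using that X[of j] Y[of j] A[of j] by (simp_all add: D_def)
    fix t
    let ?S = "\<lambda>\<omega>. \<Sum>j<d. t j * X j \<omega>" and ?T = "\<lambda>\<omega>. \<Sum>j<d. t j * Y j \<omega>"
    have m: "?S \<in> borel_measurable P" "X d \<in> borel_measurable P"
      "?T \<in> borel_measurable Q" "Y d \<in> borel_measurable Q"
      using X Y by (auto intro!: borel_measurable_sum borel_measurable_times)
    have w: "(\<integral>\<omega>. indicator (A d) (X d \<omega>) * (1 + cos (?S \<omega> + \<theta>)) \<partial>P) =
      (\<integral>\<omega>. indicator (A d) (Y d \<omega>) * (1 + cos (?T \<omega> + \<theta>)) \<partial>Q)" for \<theta>
      by (rule weighted_marginal_eq[OF fin X Y Suc.prems(5) A[OF order_refl]])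
    show "(CLINT \<omega>|D P (X d). iexp (?S \<omega>)) = (CLINT \<omega>|D Q (Y d). iexp (?T \<omega>))"
      unfolding ci[OF fin(1) m(1,2)] ci[OF fin(2) m(3,4)] trig[OF fin(1) m(1,2)] trig[OF fin(2) m(3,4)] w ..
  qed
  then show ?case
    by (subst (asm) (1 2) split) (use X Y in auto)
qed

text \<open>The Cramer-Wold theorem. The characteristic function of u . Z at frequency 1 is the
  joint characteristic function at u, so \<open>joint_law_eq\<close> applies to boxes. These
  generate the product space, and every set of \<open>vec_borel d\<close> is by construction the
  preimage of a set of that space.\<close>

lemma distr_vec_borel_eqI:
  assumes "prob_space P"
    and Z: "Z \<in> P \<rightarrow>\<^sub>M vec_borel d" and Z': "Z' \<in> P \<rightarrow>\<^sub>M vec_borel d"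
    and law: "\<And>u. u \<in> carrier_vec d \<Longrightarrow>
      distr P borel (\<lambda>\<omega>. u \<bullet> Z \<omega>) = distr P borel (\<lambda>\<omega>. u \<bullet> Z' \<omega>)"
  shows "distr P (vec_borel d) Z = distr P (vec_borel d) Z'"
proof -
  interpret prob_space P by fact
  let ?c = "\<lambda>Y \<omega>. \<lambda>j\<in>{..<d}. Y \<omega> $ j" and ?M = "\<Pi>\<^sub>M j\<in>{..<d}. (borel :: real measure)"
  have c_meas: "?c Y \<in> P \<rightarrow>\<^sub>M ?M" if "Y \<in> P \<rightarrow>\<^sub>M vec_borel d" for Y
    using measurable_vec_borelD(2)[OF that] by (intro measurable_restrict) simp
  have expand: "u \<bullet> Y \<omega> = (\<Sum>j<d. u $ j * Y \<omega> $ j)"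
    if "Y \<in> P \<rightarrow>\<^sub>M vec_borel d" "\<omega> \<in> space P" "u \<in> carrier_vec d" for Y u \<omega>
    using measurable_vec_borelD(1)[OF that(1,2)] by (simp add: scalar_prod_def lessThan_atLeast0)
  have ch: "(CLINT \<omega>|P. iexp (\<Sum>j<d. t j * Y \<omega> $ j)) = char (distr P borel (\<lambda>\<omega>. vec d t \<bullet> Y \<omega>)) 1"
    if Y: "Y \<in> P \<rightarrow>\<^sub>M vec_borel d" for Y t
  proof -
    have e: "vec d t \<bullet> Y \<omega> = (\<Sum>j<d. t j * Y \<omega> $ j)" if "\<omega> \<in> space P" for \<omega>
      using expand[OF Y that, of "vec d t"] by simp
    have "(\<lambda>\<omega>. \<Sum>j<d. t j * Y \<omega> $ j) \<in> borel_measurable P"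
      using measurable_vec_borelD(2)[OF Y] by simp
    then have "(\<lambda>\<omega>. vec d t \<bullet> Y \<omega>) \<in> borel_measurable P"
      by (subst measurable_cong[OF e])
    then show ?thesis
      unfolding char_def by (subst integral_distr) (auto simp: e intro!: Bochner_Integration.integral_cong)
  qed
  have prod_eq: "distr P ?M (?c Z) = distr P ?M (?c Z')"
  proof (rule measure_eqI_PiM_finite[where I = "{..<d}" and M = "\<lambda>_. borel" and A = "\<lambda>_. space ?M"])
    fix A :: "nat \<Rightarrow> real set" assume A: "\<And>i. i \<in> {..<d} \<Longrightarrow> A i \<in> sets borel"
    have em: "emeasure (distr P ?M (?c Y)) (Pi\<^sub>E {..<d} A) = measure P {\<omega> \<in> space P. \<forall>j<d. Y \<omega> $ j \<in> A j}"
      if "Y \<in> P \<rightarrow>\<^sub>M vec_borel d" for Y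
    proof -
      have "?c Y -` Pi\<^sub>E {..<d} A \<inter> space P = {\<omega> \<in> space P. \<forall>j<d. Y \<omega> $ j \<in> A j}"
        by (intro Set.set_eqI)
          (simp only: Int_iff vimage_eq mem_Collect_eq restrict_PiE_iff Ball_def lessThan_iff conj_commute)
      moreover have "Pi\<^sub>E {..<d} A \<in> sets ?M"
        using sets_PiM_I_finite[of "{..<d}" A "\<lambda>_. borel"] A by simp
      ultimately show ?thesis
        by (simp only: emeasure_distr[OF c_meas[OF that]] emeasure_eq_measure)
    qed
    have "measure P {\<omega> \<in> space P. \<forall>j<d. Z \<omega> $ j \<in> A j} = measure P {\<omega> \<in> space P. \<forall>j<d. Z' \<omega> $ j \<in> A j}"
    proof (rule joint_law_eq[where X = "\<lambda>j \<omega>. Z \<omega> $ j" and Y = "\<lambda>j \<omega>. Z' \<omega> $ j"])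
      show "(CLINT \<omega>|P. iexp (\<Sum>j<d. t j * Z \<omega> $ j)) = (CLINT \<omega>|P. iexp (\<Sum>j<d. t j * Z' \<omega> $ j))" for t
        unfolding ch[OF Z] ch[OF Z'] law[OF vec_carrier] ..
    qed (use A measurable_vec_borelD(2)[OF Z] measurable_vec_borelD(2)[OF Z'] finite_measure_axioms in simp_all)
    then show "emeasure (distr P ?M (?c Z)) (Pi\<^sub>E {..<d} A) = emeasure (distr P ?M (?c Z')) (Pi\<^sub>E {..<d} A)"
      by (simp add: em Z Z')
  next
    show "range (\<lambda>_::nat. space ?M) \<subseteq> prod_algebra {..<d} (\<lambda>_. borel)"
      unfolding space_PiM using space_in_prod_algebra[of "{..<d}" "\<lambda>_. borel"] by blast
    show "emeasure (distr P ?M (?c Z)) (space ?M) \<noteq> \<infinity>" for i :: nat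
      by (simp only: emeasure_distr[OF c_meas[OF Z] sets.top] emeasure_eq_measure ennreal_neq_top infinity_ennreal_def not_False_eq_True)
  qed simp_all
  show ?thesis
  proof (rule measure_eqI)
    fix E assume "E \<in> sets (distr P (vec_borel d) Z)"
    then have E: "E \<in> sets (vec_borel d)" by simp
    have "(\<lambda>v. \<lambda>j\<in>{..<d}. v $ j) \<in> carrier_vec d \<rightarrow> space ?M"
      by (auto simp: space_PiM)
    from sets_vimage_algebra2[OF this] E obtain A where A: "A \<in> sets ?M"
      "E = (\<lambda>v. \<lambda>j\<in>{..<d}. v $ j) -` A \<inter> carrier_vec d"
      unfolding vec_borel_def by auto
    have "emeasure (distr P (vec_borel d) Y) E = emeasure (distr P ?M (?c Y)) A"
      if Y: "Y \<in> P \<rightarrow>\<^sub>M vec_borel d" for Y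
    proof -
      have "Y -` E \<inter> space P = ?c Y -` A \<inter> space P"
        using A(2) measurable_vec_borelD(1)[OF Y] by auto
      then show ?thesis
        using emeasure_distr[OF Y E] emeasure_distr[OF c_meas[OF Y] A(1)] by simp
    qed
    then show "emeasure (distr P (vec_borel d) Z) E = emeasure (distr P (vec_borel d) Z') E"
      using Z Z' prod_eq by simp
  qed simp
qed

section \<open>Moment calculus\<close>

text \<open>If a^2 <= b^2, then (a + b)^2 <= 4 b^2; the k-th power gives the constant 4^k. Its size
  is irrelevant, since only uniform finiteness is used.\<close>

lemma power_add_le_even:
  fixes a b :: real
  shows "(a + b) ^ (2 * k) \<le> 4 ^ k * (a ^ (2 * k) + b ^ (2 * k))"
proof -
  have *: "(a + b) ^ (2 * k) \<le> 4 ^ k * b ^ (2 * k)" if "a\<^sup>2 \<le> b\<^sup>2" for a b :: real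
  proof -
    have "2 * (a * b) \<le> a\<^sup>2 + b\<^sup>2"
      using zero_le_power2[of "a - b"] by (simp add: power2_diff)
    then have "(a + b)\<^sup>2 \<le> 4 * b\<^sup>2"
      using that by (simp add: power2_sum)
    then have "((a + b)\<^sup>2) ^ k \<le> (4 * b\<^sup>2) ^ k"
      by (intro power_mono) auto
    then show ?thesis by (simp add: power_mult power_mult_distrib)
  qed
  have nn: "0 \<le> a ^ (2 * k)" "0 \<le> b ^ (2 * k)" by (simp_all add: zero_le_even_power)
  show ?thesis
  proof (cases "a\<^sup>2 \<le> b\<^sup>2")
    case True
    with *[of a b] nn show ?thesis by (smt (verit) distrib_left mult_nonneg_nonneg zero_le_power)
  next
    case False
    with *[of b a] nn show ?thesis by (smt (verit) add.commute distrib_left mult_nonneg_nonneg zero_le_power)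
  qed
qed

lemma mult_le_sum_squares:
  fixes a b :: real
  shows "a * b \<le> a\<^sup>2 + b\<^sup>2"
  using sum_squares_bound[of a b] zero_le_power2[of a] zero_le_power2[of b] by linarith

text \<open>Jensen's inequality with equal weights for the convex even power. For N = 0 the average
  is 0, and k >= 1 makes its power 0 as well.\<close>

lemma power_mean_le:
  fixes x :: "nat \<Rightarrow> real"
  assumes k: "1 \<le> k"
  shows "((\<Sum>n=1..N. x n) / real N) ^ (2 * k) \<le> (\<Sum>n=1..N. x n ^ (2 * k)) / real N"
proof (cases "N = 0")
  case True
  then show ?thesis using k by (simp add: zero_power)
next
  case False
  have "(\<Sum>n=1..N. (1 / real N) *\<^sub>R x n) ^ (2 * k) \<le> (\<Sum>n=1..N. (1 / real N) * x n ^ (2 * k))"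
    using False
    by (intro convex_on_sum[where f = "\<lambda>y::real. y ^ (2 * k)" and C = UNIV]) (auto intro!: convex_power_even)
  then show ?thesis by (simp add: sum_divide_distrib)
qed

context prob_space
begin

lemma cauchy_schwarz_expectation:
  fixes f g :: "'a \<Rightarrow> real"
  assumes [measurable]: "f \<in> borel_measurable M" "g \<in> borel_measurable M"
    and f: "integrable M (\<lambda>\<omega>. (f \<omega>)\<^sup>2)" and g: "integrable M (\<lambda>\<omega>. (g \<omega>)\<^sup>2)"
  shows "integrable M (\<lambda>\<omega>. f \<omega> * g \<omega>)"
    "(\<integral>\<omega>. \<bar>f \<omega> * g \<omega>\<bar> \<partial>M) \<le> sqrt (\<integral>\<omega>. (f \<omega>)\<^sup>2 \<partial>M) * sqrt (\<integral>\<omega>. (g \<omega>)\<^sup>2 \<partial>M)"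
proof -
  show i: "integrable M (\<lambda>\<omega>. f \<omega> * g \<omega>)"
  proof (rule Bochner_Integration.integrable_bound)
    show "integrable M (\<lambda>\<omega>. (f \<omega>)\<^sup>2 + (g \<omega>)\<^sup>2)" using f g by simp
    have "\<bar>x * y\<bar> \<le> x\<^sup>2 + y\<^sup>2" for x y :: real
      using mult_le_sum_squares[of "\<bar>x\<bar>" "\<bar>y\<bar>"] by (simp add: abs_mult)
    then show "AE \<omega> in M. norm (f \<omega> * g \<omega>) \<le> norm ((f \<omega>)\<^sup>2 + (g \<omega>)\<^sup>2)" by auto
  qed simp
  let ?A = "\<integral>\<omega>. (f \<omega>)\<^sup>2 \<partial>M" and ?B = "\<integral>\<omega>. (g \<omega>)\<^sup>2 \<partial>M" and ?C = "\<integral>\<omega>. \<bar>f \<omega> * g \<omega>\<bar> \<partial>M"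
  have "(\<integral>\<^sup>+\<omega>. ennreal \<bar>f \<omega>\<bar> * ennreal \<bar>g \<omega>\<bar> \<partial>M)\<^sup>2 \<le>
      (\<integral>\<^sup>+\<omega>. (ennreal \<bar>f \<omega>\<bar>)\<^sup>2 \<partial>M) * (\<integral>\<^sup>+\<omega>. (ennreal \<bar>g \<omega>\<bar>)\<^sup>2 \<partial>M)"
    by (rule Cauchy_Schwarz_nn_integral) simp_all
  also have "(\<integral>\<^sup>+\<omega>. ennreal \<bar>f \<omega>\<bar> * ennreal \<bar>g \<omega>\<bar> \<partial>M) = ennreal ?C"
    using nn_integral_eq_integral[OF integrable_abs[OF i]] by (simp add: abs_mult flip: ennreal_mult)
  also have "(\<integral>\<^sup>+\<omega>. (ennreal \<bar>f \<omega>\<bar>)\<^sup>2 \<partial>M) = ennreal ?A"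
    using f by (simp add: ennreal_power nn_integral_eq_integral)
  also have "(\<integral>\<^sup>+\<omega>. (ennreal \<bar>g \<omega>\<bar>)\<^sup>2 \<partial>M) = ennreal ?B"
    using g by (simp add: ennreal_power nn_integral_eq_integral)
  finally have "?C\<^sup>2 \<le> ?A * ?B"
    by (simp add: ennreal_power flip: ennreal_mult)
  then show "?C \<le> sqrt ?A * sqrt ?B"
    by (metis real_le_rsqrt real_sqrt_mult)
qed

text \<open>
  Families are indexed by the ensemble size and the member number; the member number starts at 1,
  and all bounds are uniform in it.
\<close>

definition bounded_moments :: "(nat \<Rightarrow> nat \<Rightarrow> 'a \<Rightarrow> real) \<Rightarrow> bool" where
  "bounded_moments F \<longleftrightarrow> (\<forall>N. \<forall>n\<ge>1. F N n \<in> borel_measurable M) \<and>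
    (\<forall>k\<ge>1. \<exists>C. \<forall>N. \<forall>n\<ge>1. integrable M (\<lambda>\<omega>. F N n \<omega> ^ (2 * k)) \<and> (\<integral>\<omega>. F N n \<omega> ^ (2 * k) \<partial>M) \<le> C)"

text \<open>Smallness in mean square suffices: by \<open>vanishing_moments\<close> below, all moments then vanish.\<close>

definition vanishing :: "(nat \<Rightarrow> nat \<Rightarrow> 'a \<Rightarrow> real) \<Rightarrow> bool" where
  "vanishing F \<longleftrightarrow> bounded_moments F \<and>
    (\<exists>\<epsilon>. \<epsilon> \<longlonglongrightarrow> 0 \<and> (\<forall>N. \<forall>n\<ge>1. (\<integral>\<omega>. (F N n \<omega>)\<^sup>2 \<partial>M) \<le> \<epsilon> N))"

text \<open>Bounded moments on both sides are part of the relation because the product rule F G - F'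
  G' = (F - F') G + (G - G') F' multiplies a small difference by G and by F'.\<close>

definition asymp_eq :: "(nat \<Rightarrow> nat \<Rightarrow> 'a \<Rightarrow> real) \<Rightarrow> (nat \<Rightarrow> nat \<Rightarrow> 'a \<Rightarrow> real) \<Rightarrow> bool" where
  "asymp_eq F G \<longleftrightarrow> bounded_moments F \<and> bounded_moments G \<and> vanishing (\<lambda>N n \<omega>. F N n \<omega> - G N n \<omega>)"

text \<open>An integrable majorant with uniformly bounded integral suffices, since even powers are
  nonnegative.\<close>

lemma bounded_momentsI:
  assumes "\<And>N n. 1 \<le> n \<Longrightarrow> F N n \<in> borel_measurable M"
    and "\<And>k. 1 \<le> k \<Longrightarrow> \<exists>g C. \<forall>N. \<forall>n\<ge>1. integrable M (g N n) \<and> (\<integral>\<omega>. g N n \<omega> \<partial>M) \<le> C \<and>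
      (\<forall>\<omega> \<in> space M. F N n \<omega> ^ (2 * k) \<le> g N n \<omega>)"
  shows "bounded_moments F"
  unfolding bounded_moments_def
proof (intro conjI allI impI assms(1))
  fix k :: nat assume k: "1 \<le> k"
  from assms(2)[OF k] obtain g C where g: "\<And>N n. 1 \<le> n \<Longrightarrow> integrable M (g N n)"
    "\<And>N n. 1 \<le> n \<Longrightarrow> (\<integral>\<omega>. g N n \<omega> \<partial>M) \<le> C"
    "\<And>N n \<omega>. 1 \<le> n \<Longrightarrow> \<omega> \<in> space M \<Longrightarrow> F N n \<omega> ^ (2 * k) \<le> g N n \<omega>" by metis
  have i: "integrable M (\<lambda>\<omega>. F N n \<omega> ^ (2 * k))" if "1 \<le> n" for N n
  proof (rule Bochner_Integration.integrable_bound[OF g(1)[OF that]])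
    show "(\<lambda>\<omega>. F N n \<omega> ^ (2 * k)) \<in> borel_measurable M"
      using assms(1)[OF that, of N] by simp
    have "norm (F N n \<omega> ^ (2 * k)) \<le> norm (g N n \<omega>)" if "\<omega> \<in> space M" for \<omega>
      using g(3)[OF \<open>1 \<le> n\<close> that, of N] zero_le_even_power[of "2 * k" "F N n \<omega>"] by simp
    then show "AE \<omega> in M. norm (F N n \<omega> ^ (2 * k)) \<le> norm (g N n \<omega>)" by (intro AE_I2)
  qed
  have "(\<integral>\<omega>. F N n \<omega> ^ (2 * k) \<partial>M) \<le> C" if "1 \<le> n" for N n
    using integral_mono[OF i[OF that] g(1)[OF that]] g(2)[OF that] g(3)[OF that] by (meson order_trans)
  with i show "\<exists>C. \<forall>N. \<forall>n\<ge>1. integrable M (\<lambda>\<omega>. F N n \<omega> ^ (2 * k)) \<and> (\<integral>\<omega>. F N n \<omega> ^ (2 * k) \<partial>M) \<le> C"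
    by blast
qed

lemma bounded_momentsD:
  assumes "bounded_moments F"
  shows "1 \<le> n \<Longrightarrow> F N n \<in> borel_measurable M"
    "1 \<le> n \<Longrightarrow> 1 \<le> k \<Longrightarrow> integrable M (\<lambda>\<omega>. F N n \<omega> ^ (2 * k))"
    "1 \<le> n \<Longrightarrow> integrable M (\<lambda>\<omega>. (F N n \<omega>)\<^sup>2)"
    "1 \<le> k \<Longrightarrow> \<exists>C\<ge>0. \<forall>N. \<forall>n\<ge>1. (\<integral>\<omega>. F N n \<omega> ^ (2 * k) \<partial>M) \<le> C"
proof -
  show "1 \<le> n \<Longrightarrow> F N n \<in> borel_measurable M"
    and i: "1 \<le> n \<Longrightarrow> 1 \<le> k \<Longrightarrow> integrable M (\<lambda>\<omega>. F N n \<omega> ^ (2 * k))" for k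
    using assms by (auto simp: bounded_moments_def)
  from i[of 1] show "1 \<le> n \<Longrightarrow> integrable M (\<lambda>\<omega>. (F N n \<omega>)\<^sup>2)" by (simp add: power2_eq_square)
  show "1 \<le> k \<Longrightarrow> \<exists>C\<ge>0. \<forall>N. \<forall>n\<ge>1. (\<integral>\<omega>. F N n \<omega> ^ (2 * k) \<partial>M) \<le> C"
  proof -
    assume "1 \<le> k"
    with assms obtain C where "\<forall>N. \<forall>n\<ge>1. (\<integral>\<omega>. F N n \<omega> ^ (2 * k) \<partial>M) \<le> C"
      unfolding bounded_moments_def by blast
    then have "\<forall>N. \<forall>n\<ge>1. (\<integral>\<omega>. F N n \<omega> ^ (2 * k) \<partial>M) \<le> max C 0" by (auto intro: le_max_iff_disj[THEN iffD2])
    then show ?thesis by (intro exI[of _ "max C 0"]) simp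
  qed
qed

text \<open>Entry formulas for vectors and matrices hold only on the sample space and for member
  numbers from 1 on, so equality is asked for only there.\<close>

lemma bounded_moments_cong:
  assumes "\<And>N n \<omega>. 1 \<le> n \<Longrightarrow> \<omega> \<in> space M \<Longrightarrow> F N n \<omega> = G N n \<omega>"
  shows "bounded_moments F \<longleftrightarrow> bounded_moments G"
proof -
  have *: "bounded_moments G" if F: "bounded_moments F"
    and eq: "\<And>N n \<omega>. 1 \<le> n \<Longrightarrow> \<omega> \<in> space M \<Longrightarrow> F N n \<omega> = G N n \<omega>" for F G
  proof (rule bounded_momentsI)
    show "G N n \<in> borel_measurable M" if "1 \<le> n" for N n
      using bounded_momentsD(1)[OF F that, of N] measurable_cong[of M "F N n" "G N n" borel] eq[OF that]
      by auto
    fix k :: nat assume k: "1 \<le> k"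
    obtain C where "\<forall>N. \<forall>n\<ge>1. (\<integral>\<omega>. F N n \<omega> ^ (2 * k) \<partial>M) \<le> C"
      using bounded_momentsD(4)[OF F k] by blast
    then show "\<exists>g C. \<forall>N. \<forall>n\<ge>1. integrable M (g N n) \<and> (\<integral>\<omega>. g N n \<omega> \<partial>M) \<le> C \<and>
        (\<forall>\<omega> \<in> space M. G N n \<omega> ^ (2 * k) \<le> g N n \<omega>)"
      using bounded_momentsD(2)[OF F _ k] eq
      by (intro exI[of _ "\<lambda>N n \<omega>. F N n \<omega> ^ (2 * k)"] exI[of _ C]) auto
  qed
  show ?thesis using *[of F G] *[of G F] assms by auto
qed

lemma bounded_moments_add:
  assumes F: "bounded_moments F" and G: "bounded_moments G"
  shows "bounded_moments (\<lambda>N n \<omega>. F N n \<omega> + G N n \<omega>)"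
proof (rule bounded_momentsI)
  show "(\<lambda>\<omega>. F N n \<omega> + G N n \<omega>) \<in> borel_measurable M" if "1 \<le> n" for N n
    using bounded_momentsD(1)[OF F that] bounded_momentsD(1)[OF G that] by simp
  fix k :: nat assume k: "1 \<le> k"
  obtain C D where C: "\<forall>N. \<forall>n\<ge>1. (\<integral>\<omega>. F N n \<omega> ^ (2 * k) \<partial>M) \<le> C"
    and D: "\<forall>N. \<forall>n\<ge>1. (\<integral>\<omega>. G N n \<omega> ^ (2 * k) \<partial>M) \<le> D"
    using bounded_momentsD(4)[OF F k] bounded_momentsD(4)[OF G k] by blast
  show "\<exists>g C. \<forall>N. \<forall>n\<ge>1. integrable M (g N n) \<and> (\<integral>\<omega>. g N n \<omega> \<partial>M) \<le> C \<and>
      (\<forall>\<omega> \<in> space M. (F N n \<omega> + G N n \<omega>) ^ (2 * k) \<le> g N n \<omega>)"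
  proof (intro exI allI impI conjI ballI)
    fix N n :: nat assume n: "1 \<le> n"
    note i = bounded_momentsD(2)[OF F n k] bounded_momentsD(2)[OF G n k]
    show "integrable M (\<lambda>\<omega>. 4 ^ k * (F N n \<omega> ^ (2 * k) + G N n \<omega> ^ (2 * k)))"
      using i by simp
    have "(\<integral>\<omega>. 4 ^ k * (F N n \<omega> ^ (2 * k) + G N n \<omega> ^ (2 * k)) \<partial>M) =
        4 ^ k * ((\<integral>\<omega>. F N n \<omega> ^ (2 * k) \<partial>M) + (\<integral>\<omega>. G N n \<omega> ^ (2 * k) \<partial>M))"
      using i by simp
    also have "\<dots> \<le> 4 ^ k * (C + D)"
      using C D n by (intro mult_left_mono add_mono) auto
    finally show "(\<integral>\<omega>. 4 ^ k * (F N n \<omega> ^ (2 * k) + G N n \<omega> ^ (2 * k)) \<partial>M) \<le> 4 ^ k * (C + D)" .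
  qed (rule power_add_le_even)
qed

text \<open>From ab <= a^2 + b^2 with a = F^(2k) and b = G^(2k): the 2k-th moment of a product is
  bounded through the 4k-th moments of its factors.\<close>

lemma bounded_moments_mult:
  assumes F: "bounded_moments F" and G: "bounded_moments G"
  shows "bounded_moments (\<lambda>N n \<omega>. F N n \<omega> * G N n \<omega>)"
proof (rule bounded_momentsI)
  show "(\<lambda>\<omega>. F N n \<omega> * G N n \<omega>) \<in> borel_measurable M" if "1 \<le> n" for N n
    using bounded_momentsD(1)[OF F that] bounded_momentsD(1)[OF G that] by simp
  fix k :: nat assume k: "1 \<le> k"
  then have k2: "1 \<le> 2 * k" by simp
  obtain C D where C: "\<forall>N. \<forall>n\<ge>1. (\<integral>\<omega>. F N n \<omega> ^ (2 * (2 * k)) \<partial>M) \<le> C"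
    and D: "\<forall>N. \<forall>n\<ge>1. (\<integral>\<omega>. G N n \<omega> ^ (2 * (2 * k)) \<partial>M) \<le> D"
    using bounded_momentsD(4)[OF F k2] bounded_momentsD(4)[OF G k2] by blast
  show "\<exists>g C. \<forall>N. \<forall>n\<ge>1. integrable M (g N n) \<and> (\<integral>\<omega>. g N n \<omega> \<partial>M) \<le> C \<and>
      (\<forall>\<omega> \<in> space M. (F N n \<omega> * G N n \<omega>) ^ (2 * k) \<le> g N n \<omega>)"
  proof (intro exI allI impI conjI ballI)
    fix N n :: nat assume n: "1 \<le> n"
    note i = bounded_momentsD(2)[OF F n k2] bounded_momentsD(2)[OF G n k2]
    show "integrable M (\<lambda>\<omega>. F N n \<omega> ^ (2 * (2 * k)) + G N n \<omega> ^ (2 * (2 * k)))"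
      using i by simp
    have "(\<integral>\<omega>. F N n \<omega> ^ (2 * (2 * k)) + G N n \<omega> ^ (2 * (2 * k)) \<partial>M) =
        (\<integral>\<omega>. F N n \<omega> ^ (2 * (2 * k)) \<partial>M) + (\<integral>\<omega>. G N n \<omega> ^ (2 * (2 * k)) \<partial>M)"
      using i by simp
    also have "\<dots> \<le> C + D" using C D n by (intro add_mono) auto
    finally show "(\<integral>\<omega>. F N n \<omega> ^ (2 * (2 * k)) + G N n \<omega> ^ (2 * (2 * k)) \<partial>M) \<le> C + D" .
    fix \<omega>
    define a where "a = F N n \<omega> ^ (2 * k)"
    define b where "b = G N n \<omega> ^ (2 * k)"
    have "a * b \<le> a\<^sup>2 + b\<^sup>2"
      by (rule mult_le_sum_squares)
    then show "(F N n \<omega> * G N n \<omega>) ^ (2 * k) \<le> F N n \<omega> ^ (2 * (2 * k)) + G N n \<omega> ^ (2 * (2 * k))"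
      by (simp add: a_def b_def power_mult_distrib mult.commute[of 2 "2 * k"] flip: power_mult)
  qed
qed

lemma bounded_moments_bounded:
  assumes [measurable]: "\<And>N n. 1 \<le> n \<Longrightarrow> F N n \<in> borel_measurable M"
    and C: "\<And>N n \<omega>. 1 \<le> n \<Longrightarrow> \<omega> \<in> space M \<Longrightarrow> \<bar>F N n \<omega>\<bar> \<le> C"
  shows "bounded_moments F"
proof (rule bounded_momentsI)
  fix k :: nat
  have "F N n \<omega> ^ (2 * k) \<le> C ^ (2 * k)" if "1 \<le> n" "\<omega> \<in> space M" for N n \<omega>
    using power_mono[OF C[OF that], of N "2 * k"] by (simp add: power_even_abs)
  then show "\<exists>g D. \<forall>N. \<forall>n\<ge>1. integrable M (g N n) \<and> (\<integral>\<omega>. g N n \<omega> \<partial>M) \<le> D \<and>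
      (\<forall>\<omega> \<in> space M. F N n \<omega> ^ (2 * k) \<le> g N n \<omega>)"
    by (intro exI[of _ "\<lambda>_ _ _. C ^ (2 * k)"] exI[of _ "C ^ (2 * k)"]) (auto simp: prob_space)
qed simp

lemma bounded_moments_const: "bounded_moments (\<lambda>N n \<omega>. c)"
  by (rule bounded_moments_bounded[of _ "\<bar>c\<bar>"]) auto

lemma bounded_moments_uminus:
  assumes "bounded_moments F"
  shows "bounded_moments (\<lambda>N n \<omega>. - F N n \<omega>)"
  using bounded_moments_mult[OF bounded_moments_const[of "-1"] assms] by simp

lemma bounded_moments_diff:
  assumes "bounded_moments F" "bounded_moments G"
  shows "bounded_moments (\<lambda>N n \<omega>. F N n \<omega> - G N n \<omega>)"
  using bounded_moments_add[OF assms(1) bounded_moments_uminus[OF assms(2)]] by simp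

lemma bounded_moments_sum:
  assumes "\<And>j. j \<in> J \<Longrightarrow> bounded_moments (F j)"
  shows "bounded_moments (\<lambda>N n \<omega>. \<Sum>j\<in>J. F j N n \<omega>)"
  using assms
proof (induction J rule: infinite_finite_induct)
  case (insert x J)
  then show ?case using bounded_moments_add[of "F x" "\<lambda>N n \<omega>. \<Sum>j\<in>J. F j N n \<omega>"] by simp
qed (simp_all add: bounded_moments_const)

text \<open>The condition \<open>0 \<le> c\<close> accounts for the empty ensemble, whose average is
  0.\<close>

lemma average_integral_le:
  fixes g :: "nat \<Rightarrow> 'a \<Rightarrow> real"
  assumes "\<And>n. 1 \<le> n \<Longrightarrow> integrable M (g n)" "\<And>n. 1 \<le> n \<Longrightarrow> (\<integral>\<omega>. g n \<omega> \<partial>M) \<le> c" "0 \<le> c"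
  shows "integrable M (\<lambda>\<omega>. (\<Sum>n=1..N. g n \<omega>) / real N)" "(\<integral>\<omega>. (\<Sum>n=1..N. g n \<omega>) / real N \<partial>M) \<le> c"
proof -
  have i: "integrable M (g n)" if "n \<in> {1..N}" for n
    using assms(1) that by simp
  then show "integrable M (\<lambda>\<omega>. (\<Sum>n=1..N. g n \<omega>) / real N)"
    by (intro Bochner_Integration.integrable_divide Bochner_Integration.integrable_sum)
  have "(\<integral>\<omega>. (\<Sum>n=1..N. g n \<omega>) / real N \<partial>M) = (\<Sum>n=1..N. \<integral>\<omega>. g n \<omega> \<partial>M) / real N"
    by (subst Bochner_Integration.integral_sum[symmetric]) (simp_all add: i)
  also have "\<dots> \<le> (\<Sum>n=1..N. c) / real N"
    using assms(2) by (intro divide_right_mono sum_mono) auto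
  also have "\<dots> \<le> c" using assms(3) by (cases "N = 0") auto
  finally show "(\<integral>\<omega>. (\<Sum>n=1..N. g n \<omega>) / real N \<partial>M) \<le> c" .
qed

text \<open>By Jensen the moment of an average is at most the average of the moments, and the bound
  on these is uniform in the member number.\<close>

lemma bounded_moments_average:
  assumes F: "bounded_moments F"
  shows "bounded_moments (\<lambda>N n \<omega>. (\<Sum>l=1..N. F N l \<omega>) / real N)"
proof (rule bounded_momentsI)
  show "(\<lambda>\<omega>. (\<Sum>l=1..N. F N l \<omega>) / real N) \<in> borel_measurable M" for N
    using bounded_momentsD(1)[OF F] by simp
  fix k :: nat assume k: "1 \<le> k"
  obtain C where C: "0 \<le> C" "\<forall>N. \<forall>n\<ge>1. (\<integral>\<omega>. F N n \<omega> ^ (2 * k) \<partial>M) \<le> C"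
    using bounded_momentsD(4)[OF F k] by blast
  show "\<exists>g C. \<forall>N. \<forall>n\<ge>1. integrable M (g N n) \<and> (\<integral>\<omega>. g N n \<omega> \<partial>M) \<le> C \<and>
      (\<forall>\<omega> \<in> space M. ((\<Sum>l=1..N. F N l \<omega>) / real N) ^ (2 * k) \<le> g N n \<omega>)"
    using average_integral_le[of "\<lambda>n \<omega>. F N n \<omega> ^ (2 * k)" C N for N] bounded_momentsD(2)[OF F _ k] C
      power_mean_le[OF k]
    by (intro exI[of _ "\<lambda>N n \<omega>. (\<Sum>l=1..N. F N l \<omega> ^ (2 * k)) / real N"] exI[of _ C]) auto
qed

lemma bounded_moments_integrable:
  assumes F: "bounded_moments F" and n: "1 \<le> n"
  shows "integrable M (F N n)"
  using cauchy_schwarz_expectation(1)[of "F N n" "\<lambda>_. 1"] bounded_momentsD(1)[OF F n] bounded_momentsD(3)[OF F n]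
  by simp

section \<open>Families vanishing in mean square\<close>

lemma vanishingI:
  assumes "bounded_moments F" "\<epsilon> \<longlonglongrightarrow> 0" "\<And>N n. 1 \<le> n \<Longrightarrow> (\<integral>\<omega>. (F N n \<omega>)\<^sup>2 \<partial>M) \<le> \<epsilon> N"
  shows "vanishing F"
  using assms by (auto simp: vanishing_def)

lemma vanishingD:
  assumes "vanishing F"
  obtains \<epsilon> where "\<epsilon> \<longlonglongrightarrow> 0" "\<And>N. 0 \<le> \<epsilon> N" "\<And>N n. 1 \<le> n \<Longrightarrow> (\<integral>\<omega>. (F N n \<omega>)\<^sup>2 \<partial>M) \<le> \<epsilon> N"
proof -
  from assms obtain \<epsilon> where e: "\<epsilon> \<longlonglongrightarrow> 0" "\<And>N n. 1 \<le> n \<Longrightarrow> (\<integral>\<omega>. (F N n \<omega>)\<^sup>2 \<partial>M) \<le> \<epsilon> N"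
    by (auto simp: vanishing_def)
  have "0 \<le> \<epsilon> N" for N
    by (rule order_trans[OF Bochner_Integration.integral_nonneg e(2)[of 1 N]]) simp_all
  with e show ?thesis using that by blast
qed

lemma vanishing_bounded: "vanishing F \<Longrightarrow> bounded_moments F"
  by (simp add: vanishing_def)

text \<open>Split (F G)^2 = F (F G^2) and apply Cauchy-Schwarz: one factor is the mean square of F,
  the other a second moment of F G^2, which is bounded. The rate drops from
  \<open>\<epsilon>\<close> to a multiple of its square root.\<close>

lemma vanishing_mult:
  assumes F: "vanishing F" and G: "bounded_moments G"
  shows "vanishing (\<lambda>N n \<omega>. F N n \<omega> * G N n \<omega>)"
proof -
  note Fb = vanishing_bounded[OF F]
  note H = bounded_moments_mult[OF Fb bounded_moments_mult[OF G G]]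
  obtain \<epsilon> where e: "\<epsilon> \<longlonglongrightarrow> 0" "\<And>N. 0 \<le> \<epsilon> N" "\<And>N n. 1 \<le> n \<Longrightarrow> (\<integral>\<omega>. (F N n \<omega>)\<^sup>2 \<partial>M) \<le> \<epsilon> N"
    using vanishingD[OF F] by blast
  obtain C where C: "0 \<le> C" "\<forall>N. \<forall>n\<ge>1. (\<integral>\<omega>. (F N n \<omega> * (G N n \<omega> * G N n \<omega>)) ^ (2 * 1) \<partial>M) \<le> C"
    using bounded_momentsD(4)[OF H, of 1] by auto
  show ?thesis
  proof (rule vanishingI[OF bounded_moments_mult[OF Fb G]])
    have "(\<lambda>N. sqrt (\<epsilon> N) * sqrt C) \<longlonglongrightarrow> sqrt 0 * sqrt C"
      by (intro tendsto_intros e)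
    then show "(\<lambda>N. sqrt (\<epsilon> N) * sqrt C) \<longlonglongrightarrow> 0" by simp
    fix N n :: nat assume n: "1 \<le> n"
    have "(\<integral>\<omega>. (F N n \<omega> * G N n \<omega>)\<^sup>2 \<partial>M) = (\<integral>\<omega>. \<bar>F N n \<omega> * (F N n \<omega> * (G N n \<omega> * G N n \<omega>))\<bar> \<partial>M)"
    proof (intro Bochner_Integration.integral_cong refl)
      fix \<omega>
      have "F N n \<omega> * (F N n \<omega> * (G N n \<omega> * G N n \<omega>)) = (F N n \<omega> * G N n \<omega>)\<^sup>2"
        by (simp add: power2_eq_square)
      then show "(F N n \<omega> * G N n \<omega>)\<^sup>2 = \<bar>F N n \<omega> * (F N n \<omega> * (G N n \<omega> * G N n \<omega>))\<bar>" by simp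
    qed
    also have "\<dots> \<le> sqrt (\<integral>\<omega>. (F N n \<omega>)\<^sup>2 \<partial>M) * sqrt (\<integral>\<omega>. (F N n \<omega> * (G N n \<omega> * G N n \<omega>))\<^sup>2 \<partial>M)"
      by (rule cauchy_schwarz_expectation(2)[OF bounded_momentsD(1)[OF Fb n] bounded_momentsD(1)[OF H n]
            bounded_momentsD(3)[OF Fb n] bounded_momentsD(3)[OF H n]])
    also have "\<dots> \<le> sqrt (\<epsilon> N) * sqrt C"
      using e(3)[OF n, of N] C(2) n by (intro mult_mono real_sqrt_le_mono) (auto intro!: e C)
    finally show "(\<integral>\<omega>. (F N n \<omega> * G N n \<omega>)\<^sup>2 \<partial>M) \<le> sqrt (\<epsilon> N) * sqrt C" .
  qed
qed

lemma vanishing_add: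
  assumes F: "vanishing F" and G: "vanishing G"
  shows "vanishing (\<lambda>N n \<omega>. F N n \<omega> + G N n \<omega>)"
proof -
  note Fb = vanishing_bounded[OF F] and Gb = vanishing_bounded[OF G]
  obtain \<epsilon> where e: "\<epsilon> \<longlonglongrightarrow> 0" "\<And>N. 0 \<le> \<epsilon> N" "\<And>N n. 1 \<le> n \<Longrightarrow> (\<integral>\<omega>. (F N n \<omega>)\<^sup>2 \<partial>M) \<le> \<epsilon> N"
    using vanishingD[OF F] by blast
  obtain \<delta> where d: "\<delta> \<longlonglongrightarrow> 0" "\<And>N. 0 \<le> \<delta> N" "\<And>N n. 1 \<le> n \<Longrightarrow> (\<integral>\<omega>. (G N n \<omega>)\<^sup>2 \<partial>M) \<le> \<delta> N"
    using vanishingD[OF G] by blast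
  show ?thesis
  proof (rule vanishingI[OF bounded_moments_add[OF Fb Gb]])
    have "(\<lambda>N. 4 * (\<epsilon> N + \<delta> N)) \<longlonglongrightarrow> 4 * (0 + 0)"
      by (intro tendsto_intros e d)
    then show "(\<lambda>N. 4 * (\<epsilon> N + \<delta> N)) \<longlonglongrightarrow> 0" by simp
    fix N n :: nat assume n: "1 \<le> n"
    note i = bounded_momentsD(3)[OF Fb n] bounded_momentsD(3)[OF Gb n]
      bounded_momentsD(3)[OF bounded_moments_add[OF Fb Gb] n]
    have "(\<integral>\<omega>. (F N n \<omega> + G N n \<omega>)\<^sup>2 \<partial>M) \<le> (\<integral>\<omega>. 4 * ((F N n \<omega>)\<^sup>2 + (G N n \<omega>)\<^sup>2) \<partial>M)"
      using power_add_le_even[of _ _ 1] i by (intro integral_mono) auto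
    also have "\<dots> = 4 * ((\<integral>\<omega>. (F N n \<omega>)\<^sup>2 \<partial>M) + (\<integral>\<omega>. (G N n \<omega>)\<^sup>2 \<partial>M))"
      using i by simp
    also have "\<dots> \<le> 4 * (\<epsilon> N + \<delta> N)"
      using e(3)[OF n] d(3)[OF n] by (intro mult_left_mono add_mono) auto
    finally show "(\<integral>\<omega>. (F N n \<omega> + G N n \<omega>)\<^sup>2 \<partial>M) \<le> 4 * (\<epsilon> N + \<delta> N)" .
  qed
qed

lemma vanishing_zero: "vanishing (\<lambda>N n \<omega>. 0)"
  by (rule vanishingI[OF bounded_moments_const tendsto_const]) simp

lemma vanishing_sum:
  assumes "\<And>j. j \<in> J \<Longrightarrow> vanishing (F j)"
  shows "vanishing (\<lambda>N n \<omega>. \<Sum>j\<in>J. F j N n \<omega>)"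
  using assms
proof (induction J rule: infinite_finite_induct)
  case (insert x J)
  then show ?case using vanishing_add[of "F x" "\<lambda>N n \<omega>. \<Sum>j\<in>J. F j N n \<omega>"] by simp
qed (simp_all add: vanishing_zero)

lemma vanishing_average:
  assumes F: "vanishing F"
  shows "vanishing (\<lambda>N n \<omega>. (\<Sum>l=1..N. F N l \<omega>) / real N)"
proof -
  note Fb = vanishing_bounded[OF F]
  obtain \<epsilon> where e: "\<epsilon> \<longlonglongrightarrow> 0" "\<And>N. 0 \<le> \<epsilon> N" "\<And>N n. 1 \<le> n \<Longrightarrow> (\<integral>\<omega>. (F N n \<omega>)\<^sup>2 \<partial>M) \<le> \<epsilon> N"
    using vanishingD[OF F] by blast
  show ?thesis
  proof (rule vanishingI[OF bounded_moments_average[OF Fb] e(1)])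
    fix N n :: nat assume n: "1 \<le> n"
    note a = average_integral_le[of "\<lambda>n \<omega>. (F N n \<omega>)\<^sup>2" "\<epsilon> N" N, OF bounded_momentsD(3)[OF Fb] e(3) e(2)]
    have "(\<integral>\<omega>. ((\<Sum>l=1..N. F N l \<omega>) / real N)\<^sup>2 \<partial>M) \<le> (\<integral>\<omega>. (\<Sum>l=1..N. (F N l \<omega>)\<^sup>2) / real N \<partial>M)"
      using power_mean_le[of 1] a bounded_momentsD(3)[OF bounded_moments_average[OF Fb] n]
      by (intro integral_mono) auto
    with a(2) show "(\<integral>\<omega>. ((\<Sum>l=1..N. F N l \<omega>) / real N)\<^sup>2 \<partial>M) \<le> \<epsilon> N" by simp
  qed
qed

lemma vanishing_cong:
  assumes "\<And>N n \<omega>. 1 \<le> n \<Longrightarrow> \<omega> \<in> space M \<Longrightarrow> F N n \<omega> = G N n \<omega>"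
  shows "vanishing F \<longleftrightarrow> vanishing G"
proof -
  have "(\<integral>\<omega>. (F N n \<omega>)\<^sup>2 \<partial>M) = (\<integral>\<omega>. (G N n \<omega>)\<^sup>2 \<partial>M)" if "1 \<le> n" for N n
    using assms[OF that] by (intro Bochner_Integration.integral_cong) auto
  then show ?thesis
    using bounded_moments_cong[of F G, OF assms] by (auto simp: vanishing_def)
qed

text \<open>F^k = F F^(k-1) is a vanishing family times one with bounded moments, hence vanishing,
  and its mean square is the 2k-th moment of F.\<close>

lemma vanishing_moments:
  assumes F: "vanishing F" and k: "1 \<le> k"
  shows "(\<lambda>N. \<integral>\<omega>. F N 1 \<omega> ^ (2 * k) \<partial>M) \<longlonglongrightarrow> 0"
proof -
  note Fb = vanishing_bounded[OF F]
  have Gb: "bounded_moments (\<lambda>N n \<omega>. F N n \<omega> ^ j)" for j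
    by (induction j) (simp_all add: bounded_moments_const bounded_moments_mult[OF Fb])
  have "vanishing (\<lambda>N n \<omega>. F N n \<omega> ^ k)"
    using vanishing_mult[OF F Gb[of "k - 1"]] k by (cases k) simp_all
  then obtain \<epsilon> where e: "\<epsilon> \<longlonglongrightarrow> 0" "\<And>N n. 1 \<le> n \<Longrightarrow> (\<integral>\<omega>. (F N n \<omega> ^ k)\<^sup>2 \<partial>M) \<le> \<epsilon> N"
    by (rule vanishingD) blast
  show ?thesis
  proof (rule tendsto_sandwich[OF _ _ tendsto_const e(1)])
    show "\<forall>\<^sub>F N in sequentially. 0 \<le> (\<integral>\<omega>. F N 1 \<omega> ^ (2 * k) \<partial>M)"
      by (simp add: zero_le_even_power)
    show "\<forall>\<^sub>F N in sequentially. (\<integral>\<omega>. F N 1 \<omega> ^ (2 * k) \<partial>M) \<le> \<epsilon> N"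
      using e(2)[of 1] by (simp add: mult.commute flip: power_mult)
  qed
qed

section \<open>Asymptotic equality of scalar families\<close>

lemma asymp_eqD:
  assumes "asymp_eq F G"
  shows "bounded_moments F" "bounded_moments G" "vanishing (\<lambda>N n \<omega>. F N n \<omega> - G N n \<omega>)"
  using assms by (auto simp: asymp_eq_def)

lemma asymp_eq_refl: "bounded_moments F \<Longrightarrow> asymp_eq F F"
  by (simp add: asymp_eq_def vanishing_zero)

lemma asymp_eq_const: "asymp_eq (\<lambda>N n \<omega>. c) (\<lambda>N n \<omega>. c)"
  by (rule asymp_eq_refl[OF bounded_moments_const])

lemma asymp_eq_trans:
  assumes "asymp_eq F G" "asymp_eq G H"
  shows "asymp_eq F H"
  using vanishing_add[OF asymp_eqD(3)[OF assms(1)] asymp_eqD(3)[OF assms(2)]] asymp_eqD[OF assms(1)] asymp_eqD[OF assms(2)]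
  by (simp add: asymp_eq_def)

lemma asymp_eq_add:
  assumes "asymp_eq F F'" "asymp_eq G G'"
  shows "asymp_eq (\<lambda>N n \<omega>. F N n \<omega> + G N n \<omega>) (\<lambda>N n \<omega>. F' N n \<omega> + G' N n \<omega>)"
  using asymp_eqD[OF assms(1)] asymp_eqD[OF assms(2)]
    vanishing_add[OF asymp_eqD(3)[OF assms(1)] asymp_eqD(3)[OF assms(2)]]
  by (simp add: asymp_eq_def bounded_moments_add algebra_simps)

lemma asymp_eq_mult:
  assumes F: "asymp_eq F F'" and G: "asymp_eq G G'"
  shows "asymp_eq (\<lambda>N n \<omega>. F N n \<omega> * G N n \<omega>) (\<lambda>N n \<omega>. F' N n \<omega> * G' N n \<omega>)"
proof -
  note F = asymp_eqD[OF F] and G = asymp_eqD[OF G]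
  show ?thesis
    using vanishing_add[OF vanishing_mult[OF F(3) G(1)] vanishing_mult[OF G(3) F(2)]] F G
    by (simp add: asymp_eq_def bounded_moments_mult algebra_simps)
qed

lemma asymp_eq_diff:
  assumes "asymp_eq F F'" "asymp_eq G G'"
  shows "asymp_eq (\<lambda>N n \<omega>. F N n \<omega> - G N n \<omega>) (\<lambda>N n \<omega>. F' N n \<omega> - G' N n \<omega>)"
  using asymp_eq_add[OF assms(1) asymp_eq_mult[OF asymp_eq_const[of "-1"] assms(2)]] by simp

lemma asymp_eq_sum:
  assumes "\<And>j. j \<in> J \<Longrightarrow> asymp_eq (F j) (G j)"
  shows "asymp_eq (\<lambda>N n \<omega>. \<Sum>j\<in>J. F j N n \<omega>) (\<lambda>N n \<omega>. \<Sum>j\<in>J. G j N n \<omega>)"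
  using assms unfolding asymp_eq_def sum_subtractf[symmetric]
  by (intro conjI bounded_moments_sum vanishing_sum) auto

lemma asymp_eq_average:
  assumes "asymp_eq F G"
  shows "asymp_eq (\<lambda>N n \<omega>. (\<Sum>l=1..N. F N l \<omega>) / real N) (\<lambda>N n \<omega>. (\<Sum>l=1..N. G N l \<omega>) / real N)"
  using assms bounded_moments_average[of F] bounded_moments_average[of G]
    vanishing_average[of "\<lambda>N n \<omega>. F N n \<omega> - G N n \<omega>"]
  by (auto simp: asymp_eq_def sum_subtractf diff_divide_distrib)

lemma asymp_eq_cong:
  assumes "\<And>N n \<omega>. 1 \<le> n \<Longrightarrow> \<omega> \<in> space M \<Longrightarrow> F N n \<omega> = F' N n \<omega>"
    and "\<And>N n \<omega>. 1 \<le> n \<Longrightarrow> \<omega> \<in> space M \<Longrightarrow> G N n \<omega> = G' N n \<omega>"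
  shows "asymp_eq F G \<longleftrightarrow> asymp_eq F' G'"
  using bounded_moments_cong[of F F'] bounded_moments_cong[of G G']
    vanishing_cong[of "\<lambda>N n \<omega>. F N n \<omega> - G N n \<omega>" "\<lambda>N n \<omega>. F' N n \<omega> - G' N n \<omega>"] assms
  by (simp add: asymp_eq_def)

text \<open>A convergent sequence is bounded, so as a deterministic family it has bounded moments.
  This handles the factor N/(N - 1) and exceptional small N.\<close>

lemma asymp_eq_sequence:
  assumes c: "c \<longlonglongrightarrow> c'"
  shows "asymp_eq (\<lambda>N n \<omega>. c N) (\<lambda>N n \<omega>. c')"
proof -
  obtain K where K: "\<And>N. \<bar>c N\<bar> \<le> K"
    using convergent_imp_Bseq[of c] c by (auto simp: convergent_def Bseq_def)
  have b: "bounded_moments (\<lambda>N n \<omega>. c N)"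
    by (rule bounded_moments_bounded[of _ K]) (use K in auto)
  have "(\<lambda>N. (c N - c')\<^sup>2) \<longlonglongrightarrow> (c' - c')\<^sup>2" by (intro tendsto_intros c)
  then have "vanishing (\<lambda>N n \<omega>. c N - c')"
    by (intro vanishingI[OF bounded_moments_diff[OF b bounded_moments_const], of "\<lambda>N. (c N - c')\<^sup>2"])
      (auto simp: prob_space)
  with b show ?thesis by (simp add: asymp_eq_def bounded_moments_const)
qed

text \<open>The law of large numbers in mean square: the mixed terms of the squared centred average
  integrate to 0, and the N diagonal terms contribute at most C/N after division by N^2.\<close>

lemma asymp_eq_average_uncorrelated:
  fixes Y :: "nat \<Rightarrow> 'a \<Rightarrow> real"
  assumes Y: "bounded_moments (\<lambda>N. Y)"
    and mean: "\<And>n. 1 \<le> n \<Longrightarrow> (\<integral>\<omega>. Y n \<omega> \<partial>M) = \<mu>"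
    and uncorr: "\<And>n l. 1 \<le> n \<Longrightarrow> 1 \<le> l \<Longrightarrow> n \<noteq> l \<Longrightarrow> (\<integral>\<omega>. Y n \<omega> * Y l \<omega> \<partial>M) = \<mu> * \<mu>"
  shows "asymp_eq (\<lambda>N n \<omega>. (\<Sum>l=1..N. Y l \<omega>) / real N) (\<lambda>N n \<omega>. \<mu>)"
proof -
  define D where "D n \<omega> = Y n \<omega> - \<mu>" for n \<omega>
  have D: "bounded_moments (\<lambda>N. D)"
    unfolding D_def by (rule bounded_moments_diff[OF Y bounded_moments_const])
  obtain C where C: "0 \<le> C" "\<And>n. 1 \<le> n \<Longrightarrow> (\<integral>\<omega>. (D n \<omega>)\<^sup>2 \<partial>M) \<le> C"
    using bounded_momentsD(4)[OF D, of 1] by auto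
  have iD: "integrable M (\<lambda>\<omega>. D n \<omega> * D l \<omega>)" if "1 \<le> n" "1 \<le> l" for n l
    using that by (intro cauchy_schwarz_expectation(1) bounded_momentsD(1,3)[OF D])
  have cross: "(\<integral>\<omega>. D n \<omega> * D l \<omega> \<partial>M) = 0" if "1 \<le> n" "1 \<le> l" "n \<noteq> l" for n l
  proof -
    have i: "integrable M (Y n)" "integrable M (Y l)" "integrable M (\<lambda>\<omega>. Y n \<omega> * Y l \<omega>)"
      using that by (auto intro!: bounded_moments_integrable[OF Y]
          cauchy_schwarz_expectation(1) bounded_momentsD(1,3)[OF Y])
    have "(\<integral>\<omega>. D n \<omega> * D l \<omega> \<partial>M) = (\<integral>\<omega>. Y n \<omega> * Y l \<omega> - \<mu> * Y n \<omega> - \<mu> * Y l \<omega> + \<mu> * \<mu> \<partial>M)"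
      unfolding D_def by (intro Bochner_Integration.integral_cong refl) (simp add: algebra_simps)
    also have "\<dots> = 0" using i mean uncorr that by (simp add: prob_space)
    finally show ?thesis .
  qed
  \<comment> \<open>For N = 0 both averages are 0, so there the centring term is 0 and not
    \<open>\<mu>\<close>. The corrected constant is replaced by \<open>\<mu>\<close> at the end, as
    it differs from it only at N = 0.\<close>
  have eq: "(\<Sum>l=1..N. D l \<omega>) / real N = (\<Sum>l=1..N. Y l \<omega>) / real N - (if N = 0 then 0 else \<mu>)" for N \<omega>
    by (simp add: D_def sum_subtractf diff_divide_distrib)
  have "vanishing (\<lambda>N n \<omega>. (\<Sum>l=1..N. D l \<omega>) / real N)"
  proof (rule vanishingI[OF bounded_moments_average[OF D]])
    show "(\<lambda>N. C / real N) \<longlonglongrightarrow> 0" by (rule lim_const_over_n)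
    fix N
    have "(\<integral>\<omega>. ((\<Sum>l=1..N. D l \<omega>) / real N)\<^sup>2 \<partial>M) = (\<integral>\<omega>. (\<Sum>n=1..N. \<Sum>l=1..N. D n \<omega> * D l \<omega>) / (real N)\<^sup>2 \<partial>M)"
      by (simp add: power_divide power2_eq_square sum_product)
    also have "\<dots> = (\<Sum>n=1..N. \<Sum>l=1..N. \<integral>\<omega>. D n \<omega> * D l \<omega> \<partial>M) / (real N)\<^sup>2"
    proof -
      have i: "integrable M (\<lambda>\<omega>. D n \<omega> * D l \<omega>)" if "n \<in> {1..N}" "l \<in> {1..N}" for n l
        using iD that by simp
      have "(\<integral>\<omega>. (\<Sum>n=1..N. \<Sum>l=1..N. D n \<omega> * D l \<omega>) \<partial>M) = (\<Sum>n=1..N. \<integral>\<omega>. (\<Sum>l=1..N. D n \<omega> * D l \<omega>) \<partial>M)"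
        by (intro Bochner_Integration.integral_sum Bochner_Integration.integrable_sum i)
      also have "\<dots> = (\<Sum>n=1..N. \<Sum>l=1..N. \<integral>\<omega>. D n \<omega> * D l \<omega> \<partial>M)"
        by (intro sum.cong refl Bochner_Integration.integral_sum i)
      finally show ?thesis by simp
    qed
    also have "(\<Sum>n=1..N. \<Sum>l=1..N. \<integral>\<omega>. D n \<omega> * D l \<omega> \<partial>M) = (\<Sum>n=1..N. \<Sum>l=1..N. if l = n then \<integral>\<omega>. (D n \<omega>)\<^sup>2 \<partial>M else 0)"
      using cross by (intro sum.cong refl) (auto simp: power2_eq_square)
    also have "\<dots> = (\<Sum>n=1..N. \<integral>\<omega>. (D n \<omega>)\<^sup>2 \<partial>M)" by simp
    also have "\<dots> / (real N)\<^sup>2 \<le> (\<Sum>n=1..N. C) / (real N)\<^sup>2"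
      using C(2) by (intro divide_right_mono sum_mono) auto
    also have "\<dots> = C / real N" by (simp add: power2_eq_square)
    finally show "(\<integral>\<omega>. ((\<Sum>l=1..N. D l \<omega>) / real N)\<^sup>2 \<partial>M) \<le> C / real N" .
  qed
  then have 1: "asymp_eq (\<lambda>N n \<omega>. (\<Sum>l=1..N. Y l \<omega>) / real N) (\<lambda>N n \<omega>. if N = 0 then 0 else \<mu>)"
    unfolding eq asymp_eq_def
    by (intro conjI bounded_moments_average[OF Y] bounded_moments_bounded[of _ "\<bar>\<mu>\<bar>"]) auto
  have "(\<lambda>N. if N = 0 then 0 else \<mu>) \<longlonglongrightarrow> \<mu>"
    by (rule tendsto_eventually, rule eventually_sequentiallyI[of 1]) simp
  from asymp_eq_trans[OF 1 asymp_eq_sequence[OF this]] show ?thesis .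
qed

end

section \<open>Asymptotic equality of random vectors and matrices\<close>

context prob_space
begin

definition vec_asymp_eq ::
  "nat \<Rightarrow> (nat \<Rightarrow> nat \<Rightarrow> 'a \<Rightarrow> real vec) \<Rightarrow> (nat \<Rightarrow> nat \<Rightarrow> 'a \<Rightarrow> real vec) \<Rightarrow> bool" where
  "vec_asymp_eq d X Y \<longleftrightarrow>
    (\<forall>N. \<forall>n\<ge>1. \<forall>\<omega> \<in> space M. X N n \<omega> \<in> carrier_vec d \<and> Y N n \<omega> \<in> carrier_vec d) \<and>
    (\<forall>j<d. asymp_eq (\<lambda>N n \<omega>. X N n \<omega> $ j) (\<lambda>N n \<omega>. Y N n \<omega> $ j))"

definition mat_asymp_eq ::
  "nat \<Rightarrow> nat \<Rightarrow> (nat \<Rightarrow> nat \<Rightarrow> 'a \<Rightarrow> real mat) \<Rightarrow> (nat \<Rightarrow> nat \<Rightarrow> 'a \<Rightarrow> real mat) \<Rightarrow> bool" where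
  "mat_asymp_eq r c A B \<longleftrightarrow>
    (\<forall>N. \<forall>n\<ge>1. \<forall>\<omega> \<in> space M. A N n \<omega> \<in> carrier_mat r c \<and> B N n \<omega> \<in> carrier_mat r c) \<and>
    (\<forall>a<r. \<forall>b<c. asymp_eq (\<lambda>N n \<omega>. A N n \<omega> $$ (a, b)) (\<lambda>N n \<omega>. B N n \<omega> $$ (a, b)))"

lemma vec_asymp_eqD:
  assumes "vec_asymp_eq d X Y"
  shows "1 \<le> n \<Longrightarrow> \<omega> \<in> space M \<Longrightarrow> X N n \<omega> \<in> carrier_vec d"
    "1 \<le> n \<Longrightarrow> \<omega> \<in> space M \<Longrightarrow> Y N n \<omega> \<in> carrier_vec d"
    "j < d \<Longrightarrow> asymp_eq (\<lambda>N n \<omega>. X N n \<omega> $ j) (\<lambda>N n \<omega>. Y N n \<omega> $ j)"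
  using assms by (auto simp: vec_asymp_eq_def)

lemma mat_asymp_eqD:
  assumes "mat_asymp_eq r c A B"
  shows "1 \<le> n \<Longrightarrow> \<omega> \<in> space M \<Longrightarrow> A N n \<omega> \<in> carrier_mat r c"
    "1 \<le> n \<Longrightarrow> \<omega> \<in> space M \<Longrightarrow> B N n \<omega> \<in> carrier_mat r c"
    "a < r \<Longrightarrow> b < c \<Longrightarrow> asymp_eq (\<lambda>N n \<omega>. A N n \<omega> $$ (a, b)) (\<lambda>N n \<omega>. B N n \<omega> $$ (a, b))"
  using assms by (auto simp: mat_asymp_eq_def)

lemma vec_asymp_eq_const: "x \<in> carrier_vec d \<Longrightarrow> vec_asymp_eq d (\<lambda>N n \<omega>. x) (\<lambda>N n \<omega>. x)"
  by (simp add: vec_asymp_eq_def asymp_eq_const)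

lemma mat_asymp_eq_const: "A \<in> carrier_mat r c \<Longrightarrow> mat_asymp_eq r c (\<lambda>N n \<omega>. A) (\<lambda>N n \<omega>. A)"
  by (simp add: mat_asymp_eq_def asymp_eq_const)

lemma vec_asymp_eq_add:
  assumes X: "vec_asymp_eq d X X'" and Y: "vec_asymp_eq d Y Y'"
  shows "vec_asymp_eq d (\<lambda>N n \<omega>. X N n \<omega> + Y N n \<omega>) (\<lambda>N n \<omega>. X' N n \<omega> + Y' N n \<omega>)"
    "vec_asymp_eq d (\<lambda>N n \<omega>. X N n \<omega> - Y N n \<omega>) (\<lambda>N n \<omega>. X' N n \<omega> - Y' N n \<omega>)"
proof -
  note c = vec_asymp_eqD(1)[OF X] vec_asymp_eqD(1)[OF Y] and c' = vec_asymp_eqD(2)[OF X] vec_asymp_eqD(2)[OF Y]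
  show "vec_asymp_eq d (\<lambda>N n \<omega>. X N n \<omega> + Y N n \<omega>) (\<lambda>N n \<omega>. X' N n \<omega> + Y' N n \<omega>)"
    unfolding vec_asymp_eq_def
  proof (intro conjI allI impI ballI)
    fix j assume j: "j < d"
    show "asymp_eq (\<lambda>N n \<omega>. (X N n \<omega> + Y N n \<omega>) $ j) (\<lambda>N n \<omega>. (X' N n \<omega> + Y' N n \<omega>) $ j)"
      using asymp_eq_add[OF vec_asymp_eqD(3)[OF X j] vec_asymp_eqD(3)[OF Y j]]
      by (subst asymp_eq_cong[OF add_vec_entry(1)[OF c j] add_vec_entry(1)[OF c' j]])
  qed (use c c' in auto)
  show "vec_asymp_eq d (\<lambda>N n \<omega>. X N n \<omega> - Y N n \<omega>) (\<lambda>N n \<omega>. X' N n \<omega> - Y' N n \<omega>)"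
    unfolding vec_asymp_eq_def
  proof (intro conjI allI impI ballI)
    fix j assume j: "j < d"
    show "asymp_eq (\<lambda>N n \<omega>. (X N n \<omega> - Y N n \<omega>) $ j) (\<lambda>N n \<omega>. (X' N n \<omega> - Y' N n \<omega>) $ j)"
      using asymp_eq_diff[OF vec_asymp_eqD(3)[OF X j] vec_asymp_eqD(3)[OF Y j]]
      by (subst asymp_eq_cong[OF add_vec_entry(2)[OF c j] add_vec_entry(2)[OF c' j]])
  qed (use c c' in auto)
qed

lemma mat_asymp_eq_add:
  assumes A: "mat_asymp_eq r c A A'" and B: "mat_asymp_eq r c B B'"
  shows "mat_asymp_eq r c (\<lambda>N n \<omega>. A N n \<omega> + B N n \<omega>) (\<lambda>N n \<omega>. A' N n \<omega> + B' N n \<omega>)"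
  unfolding mat_asymp_eq_def
proof (intro conjI allI impI ballI)
  note c = mat_asymp_eqD(1)[OF A] mat_asymp_eqD(1)[OF B] and c' = mat_asymp_eqD(2)[OF A] mat_asymp_eqD(2)[OF B]
  fix a b assume ab: "a < r" "b < c"
  show "asymp_eq (\<lambda>N n \<omega>. (A N n \<omega> + B N n \<omega>) $$ (a, b)) (\<lambda>N n \<omega>. (A' N n \<omega> + B' N n \<omega>) $$ (a, b))"
    using asymp_eq_add[OF mat_asymp_eqD(3)[OF A ab] mat_asymp_eqD(3)[OF B ab]]
    by (subst asymp_eq_cong[OF add_mat_entry[OF c ab] add_mat_entry[OF c' ab]])
qed (use mat_asymp_eqD[OF A] mat_asymp_eqD[OF B] in auto)

lemma mat_asymp_eq_mult:
  assumes A: "mat_asymp_eq r m A A'" and B: "mat_asymp_eq m c B B'"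
  shows "mat_asymp_eq r c (\<lambda>N n \<omega>. A N n \<omega> * B N n \<omega>) (\<lambda>N n \<omega>. A' N n \<omega> * B' N n \<omega>)"
  unfolding mat_asymp_eq_def
proof (intro conjI allI impI ballI)
  note c = mat_asymp_eqD(1)[OF A] mat_asymp_eqD(1)[OF B] and c' = mat_asymp_eqD(2)[OF A] mat_asymp_eqD(2)[OF B]
  show "A N n \<omega> * B N n \<omega> \<in> carrier_mat r c" "A' N n \<omega> * B' N n \<omega> \<in> carrier_mat r c"
    if "1 \<le> n" "\<omega> \<in> space M" for N n \<omega>
    using mult_carrier_mat[OF c(1)[OF that] c(2)[OF that]] mult_carrier_mat[OF c'(1)[OF that] c'(2)[OF that]] .
  fix a b assume ab: "a < r" "b < c"
  have "asymp_eq (\<lambda>N n \<omega>. \<Sum>k<m. A N n \<omega> $$ (a, k) * B N n \<omega> $$ (k, b))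
      (\<lambda>N n \<omega>. \<Sum>k<m. A' N n \<omega> $$ (a, k) * B' N n \<omega> $$ (k, b))"
    using ab by (intro asymp_eq_sum asymp_eq_mult mat_asymp_eqD(3)[OF A] mat_asymp_eqD(3)[OF B]) auto
  then show "asymp_eq (\<lambda>N n \<omega>. (A N n \<omega> * B N n \<omega>) $$ (a, b)) (\<lambda>N n \<omega>. (A' N n \<omega> * B' N n \<omega>) $$ (a, b))"
    by (subst asymp_eq_cong[OF mult_mat_entry[OF c ab] mult_mat_entry[OF c' ab]])
qed

lemma vec_asymp_eq_mult:
  assumes A: "mat_asymp_eq r c A A'" and X: "vec_asymp_eq c X X'"
  shows "vec_asymp_eq r (\<lambda>N n \<omega>. A N n \<omega> *\<^sub>v X N n \<omega>) (\<lambda>N n \<omega>. A' N n \<omega> *\<^sub>v X' N n \<omega>)"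
  unfolding vec_asymp_eq_def
proof (intro conjI allI impI ballI)
  note c = mat_asymp_eqD(1)[OF A] vec_asymp_eqD(1)[OF X] and c' = mat_asymp_eqD(2)[OF A] vec_asymp_eqD(2)[OF X]
  show "A N n \<omega> *\<^sub>v X N n \<omega> \<in> carrier_vec r" "A' N n \<omega> *\<^sub>v X' N n \<omega> \<in> carrier_vec r"
    if "1 \<le> n" "\<omega> \<in> space M" for N n \<omega>
    using mult_mat_vec_carrier[OF c(1)[OF that] c(2)[OF that]] mult_mat_vec_carrier[OF c'(1)[OF that] c'(2)[OF that]] .
  fix a assume a: "a < r"
  have "asymp_eq (\<lambda>N n \<omega>. \<Sum>k<c. A N n \<omega> $$ (a, k) * X N n \<omega> $ k)
      (\<lambda>N n \<omega>. \<Sum>k<c. A' N n \<omega> $$ (a, k) * X' N n \<omega> $ k)"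
    using a by (intro asymp_eq_sum asymp_eq_mult mat_asymp_eqD(3)[OF A] vec_asymp_eqD(3)[OF X]) auto
  then show "asymp_eq (\<lambda>N n \<omega>. (A N n \<omega> *\<^sub>v X N n \<omega>) $ a) (\<lambda>N n \<omega>. (A' N n \<omega> *\<^sub>v X' N n \<omega>) $ a)"
    by (subst asymp_eq_cong[OF mult_mat_vec_entry[OF c a] mult_mat_vec_entry[OF c' a]])
qed

lemma mat_asymp_eq_random_matrix:
  assumes A: "mat_asymp_eq r c A A'" and n: "1 \<le> n"
  shows "random_matrix M r c (A N n)"
  unfolding random_matrix_def
  using mat_asymp_eqD(1)[OF A n] bounded_momentsD(1)[OF asymp_eqD(1)[OF mat_asymp_eqD(3)[OF A]] n]
  by auto

text \<open>The pointwise bound of \<open>mat_inverse_psd_add_pd_bound\<close> depends on R alone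
  and so gives bounded moments for the inverse, whatever the tails of T. The resolvent identity then
  turns the difference of the inverses into sums of products of the vanishing difference of T with
  bounded factors.\<close>

lemma mat_asymp_eq_inverse:
  assumes T: "mat_asymp_eq r r T (\<lambda>N n \<omega>. T0)" and R: "pd_matrix r R"
    and psd: "\<And>N n \<omega>. 1 \<le> n \<Longrightarrow> \<omega> \<in> space M \<Longrightarrow> psd_matrix r (T N n \<omega>)" and psd0: "psd_matrix r T0"
  shows "mat_asymp_eq r r (\<lambda>N n \<omega>. the (mat_inverse (T N n \<omega> + R))) (\<lambda>N n \<omega>. the (mat_inverse (T0 + R)))"
proof -
  define B where "B N n \<omega> = the (mat_inverse (T N n \<omega> + R))" for N n \<omega>
  define B0 where "B0 = the (mat_inverse (T0 + R))"
  have Rc: "R \<in> carrier_mat r r" using R by (simp add: pd_matrix_def)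
  have A: "mat_asymp_eq r r (\<lambda>N n \<omega>. T N n \<omega> + R) (\<lambda>N n \<omega>. T0 + R)"
    by (rule mat_asymp_eq_add[OF T mat_asymp_eq_const[OF Rc]])
  have pd: "pd_matrix r (T N n \<omega> + R)" if "1 \<le> n" "\<omega> \<in> space M" for N n \<omega>
    using pd_matrix_add[OF psd[OF that] R] .
  have pd0: "pd_matrix r (T0 + R)" using pd_matrix_add[OF psd0 R] .
  have rm: "random_matrix M r r (B N n)" if "1 \<le> n" for N n
    unfolding B_def by (rule random_matrix_inverse[OF mat_asymp_eq_random_matrix[OF A that] pd[OF that]])
  have bm: "bounded_moments (\<lambda>N n \<omega>. B N n \<omega> $$ (j, k))" if jk: "j < r" "k < r" for j k
  proof (rule bounded_moments_bounded)
    show "(\<lambda>\<omega>. B N n \<omega> $$ (j, k)) \<in> borel_measurable M" if "1 \<le> n" for N n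
      using random_matrixD(2)[OF rm[OF that] jk] .
    show "\<bar>B N n \<omega> $$ (j, k)\<bar> \<le> (the (mat_inverse R) $$ (j, j) + the (mat_inverse R) $$ (k, k)) / 2"
      if "1 \<le> n" "\<omega> \<in> space M" for N n \<omega>
      unfolding B_def by (rule mat_inverse_psd_add_pd_bound[OF psd[OF that] R jk])
  qed
  have "asymp_eq (\<lambda>N n \<omega>. B N n \<omega> $$ (j, k)) (\<lambda>N n \<omega>. B0 $$ (j, k))" if jk: "j < r" "k < r" for j k
  proof -
    \<comment> \<open>The factors are arranged with the small difference in front, the form in which
      products of a vanishing and a bounded family are treated.\<close>
    have "vanishing (\<lambda>N n \<omega>. \<Sum>p<r. (\<Sum>q<r. ((T0 + R) $$ (p, q) - (T N n \<omega> + R) $$ (p, q)) * B0 $$ (q, k)) * B N n \<omega> $$ (j, p))"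
    proof (intro vanishing_sum vanishing_mult bounded_moments_const)
      fix p q assume pq: "p \<in> {..<r}" "q \<in> {..<r}"
      show "bounded_moments (\<lambda>N n \<omega>. B N n \<omega> $$ (j, p))" using bm jk pq by simp
      have "vanishing (\<lambda>N n \<omega>. (T N n \<omega> + R) $$ (p, q) - (T0 + R) $$ (p, q))"
        using asymp_eqD(3)[OF mat_asymp_eqD(3)[OF A]] pq by simp
      from vanishing_mult[OF this bounded_moments_const[of "-1"]]
      show "vanishing (\<lambda>N n \<omega>. (T0 + R) $$ (p, q) - (T N n \<omega> + R) $$ (p, q))" by simp
    qed
    also have "?this \<longleftrightarrow> vanishing (\<lambda>N n \<omega>. B N n \<omega> $$ (j, k) - B0 $$ (j, k))"
      unfolding B_def B0_def
      by (intro vanishing_cong, subst the_mat_inverse_diff_entry[OF pd pd0 jk]) (simp_all add: mult.commute)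
    finally show ?thesis using bm[OF jk] by (simp add: asymp_eq_def bounded_moments_const)
  qed
  moreover have "B N n \<omega> \<in> carrier_mat r r" if "1 \<le> n" "\<omega> \<in> space M" for N n \<omega>
    using random_matrixD(1)[OF rm[OF that(1)] that(2)] .
  moreover have "B0 \<in> carrier_mat r r" using mat_inverse_pd(1)[OF pd0] by (simp add: B0_def)
  ultimately show ?thesis by (simp add: mat_asymp_eq_def B_def B0_def)
qed

text \<open>The gain is a polynomial in C and the inverse of H C H^T + R. Semidefiniteness of C at
  each sample point is what makes the uniform bound on that inverse available.\<close>

lemma mat_asymp_eq_kalman_gain:
  assumes S: "well_formed_model S" and i: "i \<in> {1..horizon S}"
    and C: "mat_asymp_eq (comp_dim S i) (comp_dim S i) C (\<lambda>N n \<omega>. C0)"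
    and psd: "\<And>N n \<omega>. 1 \<le> n \<Longrightarrow> \<omega> \<in> space M \<Longrightarrow> psd_matrix (comp_dim S i) (C N n \<omega>)"
    and psd0: "psd_matrix (comp_dim S i) C0"
  shows "mat_asymp_eq (comp_dim S i) (obs_dim S i)
    (\<lambda>N n \<omega>. kalman_gain S i (C N n \<omega>)) (\<lambda>N n \<omega>. kalman_gain S i C0)"
proof -
  let ?H = "composite_obs_op S i"
  have H: "?H \<in> carrier_mat (obs_dim S i) (comp_dim S i)" by (rule composite_obs_op_carrier[OF S i refl])
  then have HT: "?H\<^sup>T \<in> carrier_mat (comp_dim S i) (obs_dim S i)" by simp
  have R: "pd_matrix (obs_dim S i) (obs_cov S i)" using S i by (auto simp: well_formed_model_def)
  note Hc = mat_asymp_eq_const[OF H] and HTc = mat_asymp_eq_const[OF HT]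
  have "mat_asymp_eq (obs_dim S i) (obs_dim S i) (\<lambda>N n \<omega>. ?H * C N n \<omega> * ?H\<^sup>T) (\<lambda>N n \<omega>. ?H * C0 * ?H\<^sup>T)"
    by (intro mat_asymp_eq_mult[OF mat_asymp_eq_mult[OF Hc C] HTc])
  from mat_asymp_eq_inverse[OF this R psd_matrix_congruence[OF psd H] psd_matrix_congruence[OF psd0 H]]
  have "mat_asymp_eq (obs_dim S i) (obs_dim S i)
      (\<lambda>N n \<omega>. the (mat_inverse (?H * C N n \<omega> * ?H\<^sup>T + obs_cov S i)))
      (\<lambda>N n \<omega>. the (mat_inverse (?H * C0 * ?H\<^sup>T + obs_cov S i)))" .
  from mat_asymp_eq_mult[OF mat_asymp_eq_mult[OF C HTc] this]
  show ?thesis by (simp add: kalman_gain_def Let_def composite_obs_op_def)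
qed

definition pairwise_uncorrelated :: "(nat \<Rightarrow> 'a \<Rightarrow> real) \<Rightarrow> bool" where
  "pairwise_uncorrelated Y \<longleftrightarrow> (\<forall>n\<ge>1. \<forall>l\<ge>1. n \<noteq> l \<longrightarrow>
    (\<integral>\<omega>. Y n \<omega> * Y l \<omega> \<partial>M) = (\<integral>\<omega>. Y n \<omega> \<partial>M) * (\<integral>\<omega>. Y l \<omega> \<partial>M))"

text \<open>The family F may be dependent across members: the law of large numbers is used for Y,
  and closeness of the averages transfers its conclusion to F.\<close>

lemma asymp_eq_sample_average:
  assumes F: "asymp_eq F (\<lambda>N. Y)"
    and mean: "\<And>n. 1 \<le> n \<Longrightarrow> (\<integral>\<omega>. Y n \<omega> \<partial>M) = \<mu>" and "pairwise_uncorrelated Y"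
  shows "asymp_eq (\<lambda>N n \<omega>. (\<Sum>l=1..N. F N l \<omega>) / real N) (\<lambda>N n \<omega>. \<mu>)"
  by (rule asymp_eq_trans[OF asymp_eq_average[OF F] asymp_eq_average_uncorrelated[OF asymp_eqD(2)[OF F] mean]])
    (use assms(3) in \<open>simp_all add: pairwise_uncorrelated_def mean\<close>)

text \<open>By \<open>sample_cov_entry\<close> the law of large numbers is needed for coordinates
  and for products of two coordinates. The limit is C + \<mu> \<mu>^T minus \<mu> \<mu>^T, and the
  factor N/(N - 1) tends to 1.\<close>

lemma mat_asymp_eq_sample_cov:
  assumes X: "vec_asymp_eq d X (\<lambda>N. U)"
    and mean: "\<And>n j. 1 \<le> n \<Longrightarrow> j < d \<Longrightarrow> (\<integral>\<omega>. U n \<omega> $ j \<partial>M) = \<mu> j"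
    and second: "\<And>n a b. 1 \<le> n \<Longrightarrow> a < d \<Longrightarrow> b < d \<Longrightarrow> (\<integral>\<omega>. U n \<omega> $ a * U n \<omega> $ b \<partial>M) = C $$ (a, b) + \<mu> a * \<mu> b"
    and C: "C \<in> carrier_mat d d"
    and uncorr1: "\<And>j. j < d \<Longrightarrow> pairwise_uncorrelated (\<lambda>n \<omega>. U n \<omega> $ j)"
    and uncorr2: "\<And>a b. a < d \<Longrightarrow> b < d \<Longrightarrow> pairwise_uncorrelated (\<lambda>n \<omega>. U n \<omega> $ a * U n \<omega> $ b)"
  shows "mat_asymp_eq d d (\<lambda>N n \<omega>. sample_cov d N (\<lambda>l. X N l \<omega>)) (\<lambda>N n \<omega>. C)"
  unfolding mat_asymp_eq_def
proof (intro conjI allI impI ballI)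
  fix a b assume ab: "a < d" "b < d"
  have s: "asymp_eq (\<lambda>N n \<omega>. (\<Sum>l=1..N. X N l \<omega> $ a * X N l \<omega> $ b) / real N) (\<lambda>N n \<omega>. C $$ (a, b) + \<mu> a * \<mu> b)"
    by (rule asymp_eq_sample_average[OF asymp_eq_mult[OF vec_asymp_eqD(3)[OF X ab(1)] vec_asymp_eqD(3)[OF X ab(2)]]
          second[OF _ ab] uncorr2[OF ab]])
  have m: "asymp_eq (\<lambda>N n \<omega>. (\<Sum>l=1..N. X N l \<omega> $ j) / real N) (\<lambda>N n \<omega>. \<mu> j)" if "j < d" for j
    by (rule asymp_eq_sample_average[OF vec_asymp_eqD(3)[OF X that] mean[OF _ that] uncorr1[OF that]])
  have "(\<lambda>N. real N / (real N - 1)) \<longlonglongrightarrow> 1" by real_asymp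
  from asymp_eq_mult[OF asymp_eq_sequence[OF this] asymp_eq_diff[OF s asymp_eq_mult[OF m[OF ab(1)] m[OF ab(2)]]]]
  show "asymp_eq (\<lambda>N n \<omega>. sample_cov d N (\<lambda>l. X N l \<omega>) $$ (a, b)) (\<lambda>N n \<omega>. C $$ (a, b))"
    by (simp add: sample_cov_entry[OF ab])
qed (use C in auto)

lemma vec_asymp_eq_sample_mean:
  assumes X: "vec_asymp_eq d X (\<lambda>N. U)"
    and mean: "\<And>n j. 1 \<le> n \<Longrightarrow> j < d \<Longrightarrow> (\<integral>\<omega>. U n \<omega> $ j \<partial>M) = \<mu> j"
    and uncorr1: "\<And>j. j < d \<Longrightarrow> pairwise_uncorrelated (\<lambda>n \<omega>. U n \<omega> $ j)"
  shows "vec_asymp_eq d (\<lambda>N n \<omega>. sample_mean d N (\<lambda>l. X N l \<omega>)) (\<lambda>N n \<omega>. vec d \<mu>)"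
  unfolding vec_asymp_eq_def
  using asymp_eq_sample_average[OF vec_asymp_eqD(3)[OF X] mean uncorr1]
  by (simp add: sample_mean_def)

end

section \<open>The limiting ensemble\<close>

context
  fixes S :: linear_model and i :: nat
  assumes S: "well_formed_model S" and i: "i \<in> {1..horizon S}"
begin

lemma model_psd:
  "psd_matrix (state_dim S) (model_cov S i)" "pd_matrix (obs_dim S i) (obs_cov S i)"
  using S i by (auto simp: well_formed_model_def)

lemma psd_kalman_forecast_cov:
  assumes "psd_matrix (comp_dim S (i - 1)) C"
  shows "psd_matrix (comp_dim S i) (kalman_forecast_cov S i C)"
  unfolding kalman_forecast_cov_eq[OF S i refl psd_matrix_carrier[OF assms]]
  by (rule psd_matrix_add[OF psd_matrix_congruence[OF assms forecast_mat_carrier[OF S i refl]]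
        psd_matrix_congruence[OF model_psd(1) noise_mat_carrier[OF S i refl]]])

lemma innovation_cov_pd:
  assumes "psd_matrix (comp_dim S i) C"
  shows "pd_matrix (obs_dim S i) (composite_obs_op S i * C * (composite_obs_op S i)\<^sup>T + obs_cov S i)"
  by (rule pd_matrix_add[OF psd_matrix_congruence[OF assms composite_obs_op_carrier[OF S i refl]] model_psd(2)])

lemma kalman_gain_eq:
  "kalman_gain S i C = C * (composite_obs_op S i)\<^sup>T *
    the (mat_inverse (composite_obs_op S i * C * (composite_obs_op S i)\<^sup>T + obs_cov S i))"
  by (simp add: kalman_gain_def Let_def composite_obs_op_def)

lemma kalman_gain_carrier:
  assumes "psd_matrix (comp_dim S i) C"
  shows "kalman_gain S i C \<in> carrier_mat (comp_dim S i) (obs_dim S i)"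
  unfolding kalman_gain_eq
  using psd_matrix_carrier[OF assms] composite_obs_op_carrier[OF S i refl]
    mat_inverse_pd(1)[OF innovation_cov_pd[OF assms]]
  by (meson mult_carrier_mat transpose_carrier_mat)

lemma kalman_update_cov:
  assumes C: "psd_matrix (comp_dim S i) C"
  shows "(1\<^sub>m (comp_dim S i) - kalman_gain S i C * composite_obs_op S i) * C *
        (1\<^sub>m (comp_dim S i) - kalman_gain S i C * composite_obs_op S i)\<^sup>T +
      (- kalman_gain S i C) * obs_cov S i * (- kalman_gain S i C)\<^sup>T =
    (1\<^sub>m (comp_dim S i) - kalman_gain S i C * composite_obs_op S i) * C"
  unfolding kalman_gain_eq
  by (rule joseph_form[OF psd_matrix_carrier[OF C] composite_obs_op_carrier[OF S i refl]
        psd_matrix_carrier[OF pd_matrix_imp_psd[OF model_psd(2)]]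
        mat_inverse_pd(1)[OF innovation_cov_pd[OF C]] mat_inverse_pd(3)[OF innovation_cov_pd[OF C]]])

lemma update_mat_carrier:
  assumes C: "psd_matrix (comp_dim S i) C"
  shows "1\<^sub>m (comp_dim S i) - kalman_gain S i C * composite_obs_op S i \<in> carrier_mat (comp_dim S i) (comp_dim S i)"
  using mult_carrier_mat[OF kalman_gain_carrier[OF C] composite_obs_op_carrier[OF S i refl]]
  by (rule minus_carrier_mat)

text \<open>The product (I - K H) C does not show its symmetry or sign; the Joseph form rewrites it
  as a sum of two congruences. Without this the induction on the time step could not
  continue.\<close>

lemma psd_kalman_update:
  assumes C: "psd_matrix (comp_dim S i) C"
  shows "psd_matrix (comp_dim S i) ((1\<^sub>m (comp_dim S i) - kalman_gain S i C * composite_obs_op S i) * C)"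
proof -
  have K: "- kalman_gain S i C \<in> carrier_mat (comp_dim S i) (obs_dim S i)"
    using kalman_gain_carrier[OF C] by simp
  show ?thesis
    using psd_matrix_add[OF psd_matrix_congruence[OF C update_mat_carrier[OF C]]
        psd_matrix_congruence[OF pd_matrix_imp_psd[OF model_psd(2)] K]]
    unfolding kalman_update_cov[OF C] .
qed

lemma measurable_forecast:
  assumes x: "x \<in> M \<rightarrow>\<^sub>M vec_borel (comp_dim S (i - 1))" and v: "v \<in> M \<rightarrow>\<^sub>M vec_borel (state_dim S)"
  shows "(\<lambda>\<omega>. forecast S i (x \<omega>) (v \<omega>)) \<in> M \<rightarrow>\<^sub>M vec_borel (comp_dim S i)"
proof -
  have "(\<lambda>\<omega>. forecast_shift S i) \<in> M \<rightarrow>\<^sub>M vec_borel (comp_dim S i)"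
    using forecast_shift_carrier[OF S i refl] by (intro measurable_const) simp
  then have "(\<lambda>\<omega>. forecast_mat S i *\<^sub>v x \<omega> + noise_mat S i *\<^sub>v v \<omega> + forecast_shift S i)
      \<in> M \<rightarrow>\<^sub>M vec_borel (comp_dim S i)"
    by (intro measurable_add_vec(1) measurable_mult_mat_vec[OF random_matrix_const x]
        measurable_mult_mat_vec[OF random_matrix_const v]
        forecast_mat_carrier[OF S i refl] noise_mat_carrier[OF S i refl])
  also have "?this \<longleftrightarrow> ?thesis"
    by (intro measurable_cong forecast_affine[OF S i refl, symmetric]
        measurable_vec_borelD(1)[OF x] measurable_vec_borelD(1)[OF v])
  finally show ?thesis .
qed

lemma random_matrix_kalman_gain:
  assumes C: "random_matrix M (comp_dim S i) (comp_dim S i) C"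
    and psd: "\<And>\<omega>. \<omega> \<in> space M \<Longrightarrow> psd_matrix (comp_dim S i) (C \<omega>)"
  shows "random_matrix M (comp_dim S i) (obs_dim S i) (\<lambda>\<omega>. kalman_gain S i (C \<omega>))"
proof -
  let ?H = "composite_obs_op S i"
  have H: "?H \<in> carrier_mat (obs_dim S i) (comp_dim S i)" by (rule composite_obs_op_carrier[OF S i refl])
  then have HT: "?H\<^sup>T \<in> carrier_mat (comp_dim S i) (obs_dim S i)" by simp
  have R: "obs_cov S i \<in> carrier_mat (obs_dim S i) (obs_dim S i)"
    by (rule psd_matrix_carrier[OF pd_matrix_imp_psd[OF model_psd(2)]])
  show ?thesis
    unfolding kalman_gain_eq
    by (intro random_matrix_mult[OF random_matrix_mult[OF C random_matrix_const[OF HT]]]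
        random_matrix_inverse random_matrix_add innovation_cov_pd psd
        random_matrix_mult[OF random_matrix_mult[OF random_matrix_const[OF H] C] random_matrix_const[OF HT]]
        random_matrix_const R)
qed

lemma measurable_analysis:
  assumes x: "x \<in> M \<rightarrow>\<^sub>M vec_borel (comp_dim S i)" and w: "w \<in> M \<rightarrow>\<^sub>M vec_borel (obs_dim S i)"
    and C: "random_matrix M (comp_dim S i) (comp_dim S i) C"
    and psd: "\<And>\<omega>. \<omega> \<in> space M \<Longrightarrow> psd_matrix (comp_dim S i) (C \<omega>)"
  shows "(\<lambda>\<omega>. analysis S i (C \<omega>) (x \<omega>) (w \<omega>)) \<in> M \<rightarrow>\<^sub>M vec_borel (comp_dim S i)"
proof -
  have y: "(\<lambda>\<omega>. obs_data S i) \<in> M \<rightarrow>\<^sub>M vec_borel (obs_dim S i)"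
    using model_carriers(4)[OF S i refl] by (intro measurable_const) simp
  have "(\<lambda>\<omega>. x \<omega> + kalman_gain S i (C \<omega>) *\<^sub>v (obs_data S i - w \<omega> - composite_obs_op S i *\<^sub>v x \<omega>))
      \<in> M \<rightarrow>\<^sub>M vec_borel (comp_dim S i)"
    by (intro measurable_add_vec x w y measurable_mult_mat_vec[OF random_matrix_kalman_gain[OF C psd]]
        measurable_mult_mat_vec[OF random_matrix_const[OF composite_obs_op_carrier[OF S i refl]] x])
  also have "?this \<longleftrightarrow> ?thesis"
    by (intro measurable_cong analysis_eq[OF S i refl, symmetric] measurable_vec_borelD(1)[OF x])
  finally show ?thesis .
qed

end

lemma kalman_cov_psd:
  assumes S: "well_formed_model S"
  shows "i \<le> horizon S \<Longrightarrow> psd_matrix (comp_dim S i) (kalman_cov S i)"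
proof (induction i)
  case 0
  then show ?case using S by (simp add: well_formed_model_def comp_dim_def)
next
  case (Suc j)
  then have i: "Suc j \<in> {1..horizon S}" by auto
  have "psd_matrix (comp_dim S (Suc j)) (kalman_forecast_cov S (Suc j) (kalman_cov S j))"
    using Suc by (intro psd_kalman_forecast_cov[OF S i]) simp
  from psd_kalman_update[OF S i this] show ?case
    by (simp add: Let_def composite_obs_op_def)
qed

text \<open>The matrix P_{0:i|i-1} of the smoother. It turns out to be the exact forecast covariance
  C_i of the reference ensemble.\<close>

definition forecast_cov :: "linear_model \<Rightarrow> nat \<Rightarrow> real mat" where
  "forecast_cov S i = kalman_forecast_cov S i (kalman_cov S (i - 1))"

lemma psd_forecast_cov:
  assumes "well_formed_model S" "i \<in> {1..horizon S}"
  shows "psd_matrix (comp_dim S i) (forecast_cov S i)"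
  unfolding forecast_cov_def using assms by (intro psd_kalman_forecast_cov kalman_cov_psd) auto

lemma kalman_cov_step:
  assumes "1 \<le> i"
  shows "kalman_cov S i =
    (1\<^sub>m (comp_dim S i) - kalman_gain S i (forecast_cov S i) * composite_obs_op S i) * forecast_cov S i"
  using assms by (cases i) (simp_all add: Let_def forecast_cov_def composite_obs_op_def)

text \<open>
  The reference ensemble with the Kalman covariances in place of the covariances of its own members.
  Unlike \<open>ref_ens\<close> it does not refer to the probability measure, so it can be transported along
  the inputs.
\<close>

primrec limit_ens ::
  "linear_model \<Rightarrow> (nat \<Rightarrow> 'w \<Rightarrow> real vec) \<Rightarrow> (nat \<Rightarrow> nat \<Rightarrow> 'w \<Rightarrow> real vec) \<Rightarrow>
   (nat \<Rightarrow> nat \<Rightarrow> 'w \<Rightarrow> real vec) \<Rightarrow> nat \<Rightarrow> nat \<Rightarrow> 'w \<Rightarrow> real vec" where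
  "limit_ens S X0 V W 0 = X0"
| "limit_ens S X0 V W (Suc j) = (\<lambda>n \<omega>. analysis S (Suc j) (forecast_cov S (Suc j))
     (forecast S (Suc j) (limit_ens S X0 V W j n \<omega>) (V (Suc j) n \<omega>)) (W (Suc j) n \<omega>))"

text \<open>Only the inputs of member n enter, and M is arbitrary: one use takes the sigma-algebra
  generated by these inputs, which gives independence between members; another takes the space of
  input configurations.\<close>

lemma measurable_limit_ens:
  assumes S: "well_formed_model S"
    and X0: "X0 n \<in> M \<rightarrow>\<^sub>M vec_borel (state_dim S)"
    and V: "\<And>j. j \<in> {1..i} \<Longrightarrow> V j n \<in> M \<rightarrow>\<^sub>M vec_borel (state_dim S)"
    and W: "\<And>j. j \<in> {1..i} \<Longrightarrow> W j n \<in> M \<rightarrow>\<^sub>M vec_borel (obs_dim S j)"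
  shows "i \<le> horizon S \<Longrightarrow> limit_ens S X0 V W i n \<in> M \<rightarrow>\<^sub>M vec_borel (comp_dim S i)"
  using V W
proof (induction i)
  case 0
  then show ?case using X0 by (simp add: comp_dim_def)
next
  case (Suc j)
  then have i: "Suc j \<in> {1..horizon S}" by auto
  have x: "limit_ens S X0 V W j n \<in> M \<rightarrow>\<^sub>M vec_borel (comp_dim S j)"
    using Suc by simp
  have v: "V (Suc j) n \<in> M \<rightarrow>\<^sub>M vec_borel (state_dim S)"
    and w: "W (Suc j) n \<in> M \<rightarrow>\<^sub>M vec_borel (obs_dim S (Suc j))"
    by (rule Suc.prems; simp)+
  note psd = psd_forecast_cov[OF S i]
  have "(\<lambda>\<omega>. forecast S (Suc j) (limit_ens S X0 V W j n \<omega>) (V (Suc j) n \<omega>)) \<in> M \<rightarrow>\<^sub>M vec_borel (comp_dim S (Suc j))"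
    by (rule measurable_forecast[OF S i _ v]) (simp add: x)
  from measurable_analysis[OF S i this w random_matrix_const[OF psd_matrix_carrier[OF psd]] psd]
  show ?case by simp
qed

text \<open>The sample covariance involves the whole ensemble, so measurability of one member
  requires the inputs of all members, and the induction runs over all of them.\<close>

lemma measurable_enks:
  assumes S: "well_formed_model S" and n: "1 \<le> n"
    and X0: "\<And>n. 1 \<le> n \<Longrightarrow> X0 n \<in> M \<rightarrow>\<^sub>M vec_borel (state_dim S)"
    and V: "\<And>j n. j \<in> {1..i} \<Longrightarrow> 1 \<le> n \<Longrightarrow> V j n \<in> M \<rightarrow>\<^sub>M vec_borel (state_dim S)"
    and W: "\<And>j n. j \<in> {1..i} \<Longrightarrow> 1 \<le> n \<Longrightarrow> W j n \<in> M \<rightarrow>\<^sub>M vec_borel (obs_dim S j)"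
  shows "i \<le> horizon S \<Longrightarrow> enks S X0 V W N i n \<in> M \<rightarrow>\<^sub>M vec_borel (comp_dim S i)"
  using V W n
proof (induction i arbitrary: n)
  case 0
  then show ?case using X0 by (simp add: comp_dim_def)
next
  case (Suc j)
  then have i: "Suc j \<in> {1..horizon S}" by auto
  have x: "enks S X0 V W N j n \<in> M \<rightarrow>\<^sub>M vec_borel (comp_dim S j)" if "1 \<le> n" for n
    using Suc that by simp
  have v: "V (Suc j) n \<in> M \<rightarrow>\<^sub>M vec_borel (state_dim S)"
    and w: "W (Suc j) n \<in> M \<rightarrow>\<^sub>M vec_borel (obs_dim S (Suc j))" if "1 \<le> n" for n
    using Suc.prems(2,3) that by auto
  have f: "(\<lambda>\<omega>. forecast S (Suc j) (enks S X0 V W N j n \<omega>) (V (Suc j) n \<omega>)) \<in> M \<rightarrow>\<^sub>M vec_borel (comp_dim S (Suc j))"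
    if "1 \<le> n" for n
    by (rule measurable_forecast[OF S i _ v[OF that]]) (simp add: x[OF that])
  from measurable_analysis[OF S i f[OF Suc.prems(4)] w[OF Suc.prems(4)] random_matrix_sample_cov[OF f] psd_sample_cov]
  show ?case by (simp add: Let_def)
qed

lemma sample_cov_permute:
  assumes "\<pi> permutes {1..N}"
  shows "sample_cov d N (\<lambda>n. Z (\<pi> n)) = sample_cov d N Z"
proof -
  have "(\<Sum>n=1..N. f (\<pi> n)) = (\<Sum>n=1..N. f n)" for f :: "nat \<Rightarrow> real"
    using sum.permute[OF assms, of f] by (simp add: o_def)
  from this[of "\<lambda>n. Z n $ a" for a]
    this[of "\<lambda>n. (Z n $ a - sample_mean d N Z $ a) * (Z n $ b - sample_mean d N Z $ b)" for a b]
  show ?thesis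
    unfolding sample_cov_def sample_mean_def by simp
qed

lemma sample_cov_cong:
  assumes "\<And>n. n \<in> {1..N} \<Longrightarrow> Y n = Z n"
  shows "sample_cov d N Y = sample_cov d N Z"
  unfolding sample_cov_def sample_mean_def using assms by simp

text \<open>The sample covariance is symmetric in the members, so the recursion commutes with a
  relabelling of the inputs. The primed inputs may live on a different sample space: they are later
  the coordinate projections on the space of input configurations.\<close>

lemma ensembles_permute:
  fixes X0' :: "nat \<Rightarrow> 'v \<Rightarrow> real vec" and X0 :: "nat \<Rightarrow> 'w \<Rightarrow> real vec"
  assumes \<pi>: "\<pi> permutes {1..N}"
    and X0: "\<And>n. 1 \<le> n \<Longrightarrow> X0' n \<omega>' = X0 (\<pi> n) \<omega>"
    and V: "\<And>j n. j \<in> {1..i} \<Longrightarrow> 1 \<le> n \<Longrightarrow> V' j n \<omega>' = V j (\<pi> n) \<omega>"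
    and W: "\<And>j n. j \<in> {1..i} \<Longrightarrow> 1 \<le> n \<Longrightarrow> W' j n \<omega>' = W j (\<pi> n) \<omega>"
    and n: "1 \<le> n"
  shows "enks S X0' V' W' N i n \<omega>' = enks S X0 V W N i (\<pi> n) \<omega>"
    "limit_ens S X0' V' W' i n \<omega>' = limit_ens S X0 V W i (\<pi> n) \<omega>"
proof -
  show "enks S X0' V' W' N i n \<omega>' = enks S X0 V W N i (\<pi> n) \<omega>"
    using V W n
  proof (induction i arbitrary: n)
    case 0
    then show ?case using X0 by simp
  next
    case (Suc j)
    have x: "enks S X0' V' W' N j l \<omega>' = enks S X0 V W N j (\<pi> l) \<omega>" if "1 \<le> l" for l
      using Suc that by simp
    have v: "V' (Suc j) l \<omega>' = V (Suc j) (\<pi> l) \<omega>" "W' (Suc j) l \<omega>' = W (Suc j) (\<pi> l) \<omega>" if "1 \<le> l" for l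
      using Suc.prems(1,2) that by auto
    have "sample_cov d N (\<lambda>l. forecast S (Suc j) (enks S X0' V' W' N j l \<omega>') (V' (Suc j) l \<omega>')) =
        sample_cov d N (\<lambda>l. forecast S (Suc j) (enks S X0 V W N j (\<pi> l) \<omega>) (V (Suc j) (\<pi> l) \<omega>))" for d
      using x v by (intro sample_cov_cong) simp
    also have "\<dots> d = sample_cov d N (\<lambda>l. forecast S (Suc j) (enks S X0 V W N j l \<omega>) (V (Suc j) l \<omega>))" for d
      by (rule sample_cov_permute[OF \<pi>])
    finally show ?case using x[OF Suc.prems(3)] v[OF Suc.prems(3)] by (simp add: Let_def)
  qed
  show "limit_ens S X0' V' W' i n \<omega>' = limit_ens S X0 V W i (\<pi> n) \<omega>"
    using V W
  proof (induction i)
    case 0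
    then show ?case using X0 n by simp
  next
    case (Suc j)
    then have "limit_ens S X0' V' W' j n \<omega>' = limit_ens S X0 V W j (\<pi> n) \<omega>" by simp
    moreover have "V' (Suc j) n \<omega>' = V (Suc j) (\<pi> n) \<omega>" "W' (Suc j) n \<omega>' = W (Suc j) (\<pi> n) \<omega>"
      using Suc.prems n by auto
    ultimately show ?case by simp
  qed
qed

section \<open>Independent blocks of inputs\<close>

context prob_space
begin

text \<open>The sigma-algebra on the sample space generated by the inputs with labels in J.
  Measurability with respect to it expresses that a variable is a function of these inputs.\<close>

definition block_algebra :: "('i \<Rightarrow> 'b measure) \<Rightarrow> ('i \<Rightarrow> 'a \<Rightarrow> 'b) \<Rightarrow> 'i set \<Rightarrow> 'a measure" where
  "block_algebra M' X J = vimage_algebra (space M) (\<lambda>\<omega>. \<lambda>l\<in>J. X l \<omega>) (Pi\<^sub>M J M')"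

lemma measurable_block_algebra:
  assumes "indep_vars M' X I" "J \<subseteq> I" "l \<in> J"
  shows "X l \<in> block_algebra M' X J \<rightarrow>\<^sub>M M' l"
proof -
  have "random_variable (M' l) (X l)" if "l \<in> J" for l
    using assms(1,2) that by (auto simp: indep_vars_def2)
  then have "(\<lambda>\<omega>. \<lambda>l\<in>J. X l \<omega>) \<in> M \<rightarrow>\<^sub>M Pi\<^sub>M J M'"
    by (rule measurable_restrict)
  then have "(\<lambda>\<omega>. \<lambda>l\<in>J. X l \<omega>) \<in> space M \<rightarrow> space (Pi\<^sub>M J M')"
    by (simp add: measurable_def)
  then have "(\<lambda>\<omega>. \<lambda>l\<in>J. X l \<omega>) \<in> block_algebra M' X J \<rightarrow>\<^sub>M Pi\<^sub>M J M'"
    unfolding block_algebra_def by (rule measurable_vimage_algebra1)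
  from measurable_compose[OF this measurable_component_singleton[OF assms(3)]] assms(3)
  show ?thesis by simp
qed

text \<open>Tuples of independent inputs over disjoint label sets are independent, hence so are the
  sigma-algebras they generate, and hence f and g.\<close>

lemma expectation_mult_blocks:
  fixes f g :: "'a \<Rightarrow> real"
  assumes X: "indep_vars M' X I" and JK: "J \<subseteq> I" "K \<subseteq> I" "J \<inter> K = {}"
    and f: "f \<in> borel_measurable (block_algebra M' X J)" "integrable M f"
    and g: "g \<in> borel_measurable (block_algebra M' X K)" "integrable M g"
  shows "(\<integral>\<omega>. f \<omega> * g \<omega> \<partial>M) = (\<integral>\<omega>. f \<omega> \<partial>M) * (\<integral>\<omega>. g \<omega> \<partial>M)"
proof (rule indep_var_lebesgue_integral[OF _ f(2) g(2)])
  let ?r = "\<lambda>J \<omega>. \<lambda>l\<in>J. X l \<omega>"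
  have "indep_vars (\<lambda>j. Pi\<^sub>M (if j then J else K) M') (\<lambda>j \<omega>. ?r (if j then J else K) \<omega>) (UNIV :: bool set)"
    by (rule indep_vars_restrict[OF X]) (use JK in \<open>auto simp: disjoint_family_on_def\<close>)
  also have "(\<lambda>j. Pi\<^sub>M (if j then J else K) M') = case_bool (Pi\<^sub>M J M') (Pi\<^sub>M K M')"
    by (auto simp: fun_eq_iff split: bool.split)
  also have "(\<lambda>j \<omega>. ?r (if j then J else K) \<omega>) = case_bool (?r J) (?r K)"
    by (auto simp: fun_eq_iff split: bool.split)
  finally have "indep_var (Pi\<^sub>M J M') (?r J) (Pi\<^sub>M K M') (?r K)"
    unfolding indep_var_def .
  then have i: "indep_set (sets (block_algebra M' X J)) (sets (block_algebra M' X K))"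
    unfolding indep_var_eq block_algebra_def sets_vimage_algebra by blast
  have sub: "sigma_sets (space M) {h -` A \<inter> space M |A. A \<in> sets borel} \<subseteq> sets (block_algebra M' X L)"
    if "h \<in> borel_measurable (block_algebra M' X L)" for h :: "'a \<Rightarrow> real" and L
    unfolding sets_vimage_algebra[symmetric]
    by (rule sets_image_in_sets[OF _ that]) (simp add: block_algebra_def)
  have "indep_set (sigma_sets (space M) {f -` A \<inter> space M |A. A \<in> sets borel})
      (sigma_sets (space M) {g -` A \<inter> space M |A. A \<in> sets borel})"
    using i sub[OF f(1)] sub[OF g(1)] unfolding indep_sets2_eq by blast
  then show "indep_var borel f borel g"
    unfolding indep_var_eq using f(2) g(2) by auto
qed

section \<open>Means and covariances\<close>

text \<open>For a constant family \<open>bounded_moments\<close> says that all even moments are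
  finite. Mean and covariance are values of integrals; finiteness of the moments makes these
  integrals meaningful.\<close>

definition has_moments :: "nat \<Rightarrow> ('a \<Rightarrow> real vec) \<Rightarrow> real vec \<Rightarrow> real mat \<Rightarrow> bool" where
  "has_moments d Z \<mu> C \<longleftrightarrow> Z \<in> M \<rightarrow>\<^sub>M vec_borel d \<and> \<mu> \<in> carrier_vec d \<and> C \<in> carrier_mat d d \<and>
    (\<forall>j<d. bounded_moments (\<lambda>_ _ \<omega>. Z \<omega> $ j)) \<and>
    (\<forall>j<d. (\<integral>\<omega>. Z \<omega> $ j \<partial>M) = \<mu> $ j) \<and>
    (\<forall>a<d. \<forall>b<d. (\<integral>\<omega>. (Z \<omega> $ a - \<mu> $ a) * (Z \<omega> $ b - \<mu> $ b) \<partial>M) = C $$ (a, b))"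

lemma has_momentsD:
  assumes "has_moments d Z \<mu> C"
  shows "Z \<in> M \<rightarrow>\<^sub>M vec_borel d" "\<mu> \<in> carrier_vec d" "C \<in> carrier_mat d d"
    "j < d \<Longrightarrow> bounded_moments (\<lambda>_ _ \<omega>. Z \<omega> $ j)" "j < d \<Longrightarrow> (\<integral>\<omega>. Z \<omega> $ j \<partial>M) = \<mu> $ j"
    "a < d \<Longrightarrow> b < d \<Longrightarrow> (\<integral>\<omega>. (Z \<omega> $ a - \<mu> $ a) * (Z \<omega> $ b - \<mu> $ b) \<partial>M) = C $$ (a, b)"
  using assms by (auto simp: has_moments_def)

lemma bounded_moments_integrable_mult:
  assumes "bounded_moments (\<lambda>_ _. f)" "bounded_moments (\<lambda>_ _. g)"
  shows "integrable M (\<lambda>\<omega>. f \<omega> * g \<omega>)" "integrable M f"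
  using bounded_moments_integrable[OF bounded_moments_mult[OF assms], of 1]
    bounded_moments_integrable[OF assms(1), of 1] by simp_all

lemma has_moments_mean_cov:
  assumes Z: "has_moments d Z \<mu> C"
  shows "mean_vec M d Z = \<mu>" "cov_mat M d Z = C"
proof -
  show mean: "mean_vec M d Z = \<mu>"
    using has_momentsD[OF Z] by (intro eq_vecI) (auto simp: mean_vec_def)
  show "cov_mat M d Z = C"
    using has_momentsD[OF Z] by (intro eq_matI) (auto simp: cov_mat_def mean)
qed

lemma has_moments_second:
  assumes Z: "has_moments d Z \<mu> C" and ab: "a < d" "b < d"
  shows "(\<integral>\<omega>. Z \<omega> $ a * Z \<omega> $ b \<partial>M) = C $$ (a, b) + \<mu> $ a * \<mu> $ b"
proof -
  note i = bounded_moments_integrable_mult[OF has_momentsD(4)[OF Z ab(1)] has_momentsD(4)[OF Z ab(2)]]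
    bounded_moments_integrable_mult(2)[OF has_momentsD(4)[OF Z ab(2)] has_momentsD(4)[OF Z ab(1)]]
  have "C $$ (a, b) = (\<integral>\<omega>. (Z \<omega> $ a - \<mu> $ a) * (Z \<omega> $ b - \<mu> $ b) \<partial>M)"
    using has_momentsD(6)[OF Z ab] by simp
  also have "\<dots> = (\<integral>\<omega>. Z \<omega> $ a * Z \<omega> $ b - \<mu> $ b * Z \<omega> $ a - \<mu> $ a * Z \<omega> $ b + \<mu> $ a * \<mu> $ b \<partial>M)"
    by (intro Bochner_Integration.integral_cong refl) (simp add: algebra_simps)
  also have "\<dots> = (\<integral>\<omega>. Z \<omega> $ a * Z \<omega> $ b \<partial>M) - \<mu> $ a * \<mu> $ b"
    using i has_momentsD(5)[OF Z ab(1)] has_momentsD(5)[OF Z ab(2)] by (simp add: prob_space)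
  finally show ?thesis by simp
qed

lemma expectation_mult_sums:
  fixes f :: "'k \<Rightarrow> 'a \<Rightarrow> real" and g :: "'l \<Rightarrow> 'a \<Rightarrow> real"
  assumes f: "\<And>k. k \<in> K \<Longrightarrow> bounded_moments (\<lambda>_ _. f k)" and g: "\<And>l. l \<in> L \<Longrightarrow> bounded_moments (\<lambda>_ _. g l)"
  shows "(\<integral>\<omega>. (\<Sum>k\<in>K. x k * f k \<omega>) * (\<Sum>l\<in>L. y l * g l \<omega>) \<partial>M) =
    (\<Sum>k\<in>K. \<Sum>l\<in>L. x k * y l * (\<integral>\<omega>. f k \<omega> * g l \<omega> \<partial>M))"
proof -
  have i: "integrable M (\<lambda>\<omega>. x k * y l * (f k \<omega> * g l \<omega>))" if "k \<in> K" "l \<in> L" for k l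
    using bounded_moments_integrable_mult(1)[OF f[OF that(1)] g[OF that(2)]] by simp
  have "(\<integral>\<omega>. (\<Sum>k\<in>K. x k * f k \<omega>) * (\<Sum>l\<in>L. y l * g l \<omega>) \<partial>M) =
      (\<integral>\<omega>. (\<Sum>k\<in>K. \<Sum>l\<in>L. x k * y l * (f k \<omega> * g l \<omega>)) \<partial>M)"
    by (simp add: sum_product mult_ac)
  also have "\<dots> = (\<Sum>k\<in>K. \<integral>\<omega>. (\<Sum>l\<in>L. x k * y l * (f k \<omega> * g l \<omega>)) \<partial>M)"
    by (intro Bochner_Integration.integral_sum Bochner_Integration.integrable_sum i)
  also have "\<dots> = (\<Sum>k\<in>K. \<Sum>l\<in>L. \<integral>\<omega>. x k * y l * (f k \<omega> * g l \<omega>) \<partial>M)"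
    by (intro sum.cong refl Bochner_Integration.integral_sum i)
  finally show ?thesis by simp
qed

lemma bounded_moments_cmult_sum:
  assumes "\<And>k. k \<in> K \<Longrightarrow> bounded_moments (\<lambda>_ _. f k)"
  shows "bounded_moments (\<lambda>_ _ \<omega>. \<Sum>k\<in>K. x k * f k \<omega>)"
  by (intro bounded_moments_sum bounded_moments_mult bounded_moments_const assms)

text \<open>The mixed terms of the bilinear expansion vanish by uncorrelatedness, leaving the two
  congruences. Each time step uses this twice: with F and the noise embedding for the forecast, with
  I - K H and -K for the analysis.\<close>

lemma has_moments_affine:
  assumes Z: "has_moments d Z \<mu> C" and W: "has_moments e W \<nu> R"
    and A: "A \<in> carrier_mat r d" and B: "B \<in> carrier_mat r e" and c: "c \<in> carrier_vec r"
    and cross: "\<And>k l. k < d \<Longrightarrow> l < e \<Longrightarrow> (\<integral>\<omega>. (Z \<omega> $ k - \<mu> $ k) * (W \<omega> $ l - \<nu> $ l) \<partial>M) = 0"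
  shows "has_moments r (\<lambda>\<omega>. A *\<^sub>v Z \<omega> + B *\<^sub>v W \<omega> + c) (A *\<^sub>v \<mu> + B *\<^sub>v \<nu> + c) (A * C * A\<^sup>T + B * R * B\<^sup>T)"
proof -
  note Zc = measurable_vec_borelD(1)[OF has_momentsD(1)[OF Z]] and Wc = measurable_vec_borelD(1)[OF has_momentsD(1)[OF W]]
  note mc = has_momentsD(2)[OF Z] has_momentsD(2)[OF W] and Cc = has_momentsD(3)[OF Z] and Rc = has_momentsD(3)[OF W]
  define z where "z k \<omega> = Z \<omega> $ k - \<mu> $ k" for k \<omega>
  define w where "w l \<omega> = W \<omega> $ l - \<nu> $ l" for l \<omega>
  define \<eta> where "\<eta> = A *\<^sub>v \<mu> + B *\<^sub>v \<nu> + c"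
  define Y where "Y \<omega> = A *\<^sub>v Z \<omega> + B *\<^sub>v W \<omega> + c" for \<omega>
  have zb: "bounded_moments (\<lambda>_ _. z k)" if "k \<in> {..<d}" for k
    unfolding z_def using that by (intro bounded_moments_diff bounded_moments_const has_momentsD(4)[OF Z]) simp
  have wb: "bounded_moments (\<lambda>_ _. w l)" if "l \<in> {..<e}" for l
    unfolding w_def using that by (intro bounded_moments_diff bounded_moments_const has_momentsD(4)[OF W]) simp
  define s where "s a \<omega> = (\<Sum>k<d. A $$ (a, k) * z k \<omega>)" for a \<omega>
  define t where "t a \<omega> = (\<Sum>l<e. B $$ (a, l) * w l \<omega>)" for a \<omega>
  have sb: "bounded_moments (\<lambda>_ _. s a)" and tb: "bounded_moments (\<lambda>_ _. t a)" for a
    unfolding s_def t_def by (intro bounded_moments_cmult_sum zb wb; simp)+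
  \<comment> \<open>The deviation from the mean splits into a part \<open>s\<close> linear in the
    centred Z and a part \<open>t\<close> linear in the centred W; both have mean 0.\<close>
  have Y: "Y \<omega> $ a = s a \<omega> + t a \<omega> + \<eta> $ a" if \<omega>: "\<omega> \<in> space M" and a: "a < r" for \<omega> a
  proof -
    have "Y \<omega> $ a = (A *\<^sub>v Z \<omega>) $ a + (B *\<^sub>v W \<omega>) $ a + c $ a"
      unfolding Y_def using A B c a by simp
    moreover have "\<eta> $ a = (A *\<^sub>v \<mu>) $ a + (B *\<^sub>v \<nu>) $ a + c $ a"
      unfolding \<eta>_def using A B c a by simp
    ultimately show ?thesis
      unfolding mult_mat_vec_entry[OF A Zc[OF \<omega>] a] mult_mat_vec_entry[OF B Wc[OF \<omega>] a]
        mult_mat_vec_entry[OF A mc(1) a] mult_mat_vec_entry[OF B mc(2) a] s_def t_def z_def w_def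
      by (simp add: right_diff_distrib sum_subtractf)
  qed
  have z0: "(\<integral>\<omega>. z k \<omega> \<partial>M) = 0" if "k < d" for k
    unfolding z_def using that has_momentsD(5)[OF Z that] bounded_moments_integrable[OF has_momentsD(4)[OF Z that], of 1]
    by (simp add: prob_space)
  have w0: "(\<integral>\<omega>. w l \<omega> \<partial>M) = 0" if "l < e" for l
    unfolding w_def using that has_momentsD(5)[OF W that] bounded_moments_integrable[OF has_momentsD(4)[OF W that], of 1]
    by (simp add: prob_space)
  have s0: "(\<integral>\<omega>. s a \<omega> \<partial>M) = 0" for a
  proof -
    have "(\<integral>\<omega>. s a \<omega> \<partial>M) = (\<Sum>k<d. \<integral>\<omega>. A $$ (a, k) * z k \<omega> \<partial>M)"
      unfolding s_def using bounded_moments_integrable[OF zb, of _ 1]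
      by (intro Bochner_Integration.integral_sum integrable_mult_right) simp
    then show ?thesis using z0 by simp
  qed
  have t0: "(\<integral>\<omega>. t a \<omega> \<partial>M) = 0" for a
  proof -
    have "(\<integral>\<omega>. t a \<omega> \<partial>M) = (\<Sum>l<e. \<integral>\<omega>. B $$ (a, l) * w l \<omega> \<partial>M)"
      unfolding t_def using bounded_moments_integrable[OF wb, of _ 1]
      by (intro Bochner_Integration.integral_sum integrable_mult_right) simp
    then show ?thesis using w0 by simp
  qed
  have ist: "integrable M (s a)" "integrable M (t a)" for a
    using bounded_moments_integrable[OF sb, of 1] bounded_moments_integrable[OF tb, of 1] by simp_all
  show ?thesis
    unfolding has_moments_def Y_def[symmetric] \<eta>_def[symmetric]
  proof (intro conjI allI impI)
    show "Y \<in> M \<rightarrow>\<^sub>M vec_borel r"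
      unfolding Y_def
      by (intro measurable_add_vec(1) measurable_mult_mat_vec[OF random_matrix_const[OF A] has_momentsD(1)[OF Z]]
          measurable_mult_mat_vec[OF random_matrix_const[OF B] has_momentsD(1)[OF W]] measurable_const)
        (simp add: c)
    show "\<eta> \<in> carrier_vec r" unfolding \<eta>_def using A B c mc by simp
    show "A * C * A\<^sup>T + B * R * B\<^sup>T \<in> carrier_mat r r" using A B Cc Rc by simp
    show "bounded_moments (\<lambda>_ _ \<omega>. Y \<omega> $ j)" if j: "j < r" for j
    proof -
      have "bounded_moments (\<lambda>_ _ \<omega>. s j \<omega> + t j \<omega> + \<eta> $ j)"
        by (intro bounded_moments_add sb tb bounded_moments_const)
      then show ?thesis by (subst bounded_moments_cong[OF Y[OF _ j]])
    qed
    show "(\<integral>\<omega>. Y \<omega> $ j \<partial>M) = \<eta> $ j" if j: "j < r" for j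
    proof -
      have "(\<integral>\<omega>. Y \<omega> $ j \<partial>M) = (\<integral>\<omega>. s j \<omega> + t j \<omega> + \<eta> $ j \<partial>M)"
        by (intro Bochner_Integration.integral_cong refl Y j)
      then show ?thesis using ist s0 t0 by (simp add: prob_space)
    qed
    fix a b assume ab: "a < r" "b < r"
    have "(\<integral>\<omega>. (Y \<omega> $ a - \<eta> $ a) * (Y \<omega> $ b - \<eta> $ b) \<partial>M) = (\<integral>\<omega>. (s a \<omega> + t a \<omega>) * (s b \<omega> + t b \<omega>) \<partial>M)"
      using Y ab by (intro Bochner_Integration.integral_cong refl) simp
    also have "\<dots> = (\<integral>\<omega>. s a \<omega> * s b \<omega> + s a \<omega> * t b \<omega> + s b \<omega> * t a \<omega> + t a \<omega> * t b \<omega> \<partial>M)"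
      by (intro Bochner_Integration.integral_cong refl) (simp add: algebra_simps)
    also have "\<dots> = (\<integral>\<omega>. s a \<omega> * s b \<omega> \<partial>M) + (\<integral>\<omega>. s a \<omega> * t b \<omega> \<partial>M) + (\<integral>\<omega>. s b \<omega> * t a \<omega> \<partial>M) + (\<integral>\<omega>. t a \<omega> * t b \<omega> \<partial>M)"
      using bounded_moments_integrable_mult(1)[OF sb sb] bounded_moments_integrable_mult(1)[OF sb tb]
        bounded_moments_integrable_mult(1)[OF tb tb] by simp
    also have "(\<integral>\<omega>. s a \<omega> * s b \<omega> \<partial>M) = (\<Sum>k<d. \<Sum>l<d. A $$ (a, k) * A $$ (b, l) * C $$ (k, l))"
      unfolding s_def using has_momentsD(6)[OF Z] by (subst expectation_mult_sums[OF zb zb]) (simp_all add: z_def)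
    also have "(\<integral>\<omega>. t a \<omega> * t b \<omega> \<partial>M) = (\<Sum>k<e. \<Sum>l<e. B $$ (a, k) * B $$ (b, l) * R $$ (k, l))"
      unfolding t_def using has_momentsD(6)[OF W] by (subst expectation_mult_sums[OF wb wb]) (simp_all add: w_def)
    also have "(\<integral>\<omega>. s a \<omega> * t b \<omega> \<partial>M) = 0"
      unfolding s_def t_def using cross by (subst expectation_mult_sums[OF zb wb]) (simp_all add: z_def w_def)
    also have "(\<integral>\<omega>. s b \<omega> * t a \<omega> \<partial>M) = 0"
      unfolding s_def t_def using cross by (subst expectation_mult_sums[OF zb wb]) (simp_all add: z_def w_def)
    also have "(\<Sum>k<d. \<Sum>l<d. A $$ (a, k) * A $$ (b, l) * C $$ (k, l)) = (A * C * A\<^sup>T) $$ (a, b)"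
      by (rule congruence_entry[OF A Cc ab, symmetric])
    also have "(\<Sum>k<e. \<Sum>l<e. B $$ (a, k) * B $$ (b, l) * R $$ (k, l)) = (B * R * B\<^sup>T) $$ (a, b)"
      by (rule congruence_entry[OF B Rc ab, symmetric])
    finally show "(\<integral>\<omega>. (Y \<omega> $ a - \<eta> $ a) * (Y \<omega> $ b - \<eta> $ b) \<partial>M) = (A * C * A\<^sup>T + B * R * B\<^sup>T) $$ (a, b)"
      using add_mat_entry[of "A * C * A\<^sup>T" r r "B * R * B\<^sup>T" a b] A B Cc Rc ab by simp
  qed
qed

end

section \<open>Gaussian vectors\<close>

text \<open>A zero variance is a point mass without density, so it is treated apart from the normal
  density in each claim.\<close>

lemma normal_law_central_moments:
  assumes "0 \<le> v"
  shows "integrable (normal_law m v) (\<lambda>x. (x - m) ^ k)"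
    "(\<integral>x. (x - m) \<partial>normal_law m v) = 0" "(\<integral>x. (x - m)\<^sup>2 \<partial>normal_law m v) = v"
proof -
  show "integrable (normal_law m v) (\<lambda>x. (x - m) ^ k)"
  proof (cases "v = 0")
    case True
    interpret prob_space "return borel m" by (rule prob_space_return) simp
    have "AE x in return borel m. (x - m) ^ k = 0 ^ k" by (subst AE_return) auto
    then have "integrable (return borel m) (\<lambda>x. (x - m) ^ k) \<longleftrightarrow> integrable (return borel m) (\<lambda>x. 0 ^ k :: real)"
      by (intro integrable_cong_AE) auto
    then show ?thesis using True by (simp add: normal_law_def)
  next
    case False
    then show ?thesis
      using assms integrable_normal_moment[of "sqrt v" m k]
      by (simp add: normal_law_def integrable_density)
  qed
  show "(\<integral>x. (x - m) \<partial>normal_law m v) = 0"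
  proof (cases "v = 0")
    case True
    then show ?thesis by (simp add: normal_law_def integral_return)
  next
    case False
    then show ?thesis
      using assms integral_normal_moment_odd[of "sqrt v" m 0]
      by (simp add: normal_law_def integral_density)
  qed
  show "(\<integral>x. (x - m)\<^sup>2 \<partial>normal_law m v) = v"
  proof (cases "v = 0")
    case True
    then show ?thesis by (simp add: normal_law_def integral_return)
  next
    case False
    then show ?thesis
      using assms integral_normal_moment_even[of "sqrt v" m 1]
      by (simp add: normal_law_def integral_density power2_eq_square)
  qed
qed

context prob_space
begin

lemma gaussian_functional:
  assumes Z: "gaussian_vec M d Z \<mu> \<Sigma>" and psd: "psd_matrix d \<Sigma>" and u: "u \<in> carrier_vec d"
  shows "(\<lambda>\<omega>. u \<bullet> Z \<omega>) \<in> borel_measurable M"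
    "integrable M (\<lambda>\<omega>. (u \<bullet> Z \<omega> - u \<bullet> \<mu>) ^ k)"
    "(\<integral>\<omega>. (u \<bullet> Z \<omega> - u \<bullet> \<mu>) ^ k \<partial>M) = (\<integral>x. (x - u \<bullet> \<mu>) ^ k \<partial>normal_law (u \<bullet> \<mu>) (u \<bullet> (\<Sigma> *\<^sub>v u)))"
    "(\<integral>\<omega>. u \<bullet> Z \<omega> - u \<bullet> \<mu> \<partial>M) = 0"
    "(\<integral>\<omega>. (u \<bullet> Z \<omega> - u \<bullet> \<mu>)\<^sup>2 \<partial>M) = u \<bullet> (\<Sigma> *\<^sub>v u)"
proof -
  have Zm: "Z \<in> M \<rightarrow>\<^sub>M vec_borel d"
    and law: "distr M borel (\<lambda>\<omega>. u \<bullet> Z \<omega>) = normal_law (u \<bullet> \<mu>) (u \<bullet> (\<Sigma> *\<^sub>v u))"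
    using Z u by (auto simp: gaussian_vec_def)
  have v: "0 \<le> u \<bullet> (\<Sigma> *\<^sub>v u)" using psd u by (simp add: psd_matrix_def)
  note mom = normal_law_central_moments[OF v, of "u \<bullet> \<mu>"]
  have "(\<lambda>\<omega>. \<Sum>j<d. u $ j * Z \<omega> $ j) \<in> borel_measurable M"
    using measurable_vec_borelD(2)[OF Zm] by simp
  also have "?this \<longleftrightarrow> (\<lambda>\<omega>. u \<bullet> Z \<omega>) \<in> borel_measurable M"
  proof (intro measurable_cong)
    fix \<omega> assume "\<omega> \<in> space M"
    from measurable_vec_borelD(1)[OF Zm this] show "(\<Sum>j<d. u $ j * Z \<omega> $ j) = u \<bullet> Z \<omega>"
      by (simp add: scalar_prod_def lessThan_atLeast0)
  qed
  finally show m [measurable]: "(\<lambda>\<omega>. u \<bullet> Z \<omega>) \<in> borel_measurable M" .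
  show "integrable M (\<lambda>\<omega>. (u \<bullet> Z \<omega> - u \<bullet> \<mu>) ^ k)"
    using mom(1)[of k] integrable_distr[OF m, of "\<lambda>x. (x - u \<bullet> \<mu>) ^ k"] by (simp add: law)
  have e: "(\<integral>\<omega>. (u \<bullet> Z \<omega> - u \<bullet> \<mu>) ^ k \<partial>M) = (\<integral>x. (x - u \<bullet> \<mu>) ^ k \<partial>normal_law (u \<bullet> \<mu>) (u \<bullet> (\<Sigma> *\<^sub>v u)))" for k
    unfolding law[symmetric] by (subst integral_distr) simp_all
  then show "(\<integral>\<omega>. (u \<bullet> Z \<omega> - u \<bullet> \<mu>) ^ k \<partial>M) = (\<integral>x. (x - u \<bullet> \<mu>) ^ k \<partial>normal_law (u \<bullet> \<mu>) (u \<bullet> (\<Sigma> *\<^sub>v u)))" .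
  show "(\<integral>\<omega>. u \<bullet> Z \<omega> - u \<bullet> \<mu> \<partial>M) = 0" using e[of 1] mom(2) by simp
  show "(\<integral>\<omega>. (u \<bullet> Z \<omega> - u \<bullet> \<mu>)\<^sup>2 \<partial>M) = u \<bullet> (\<Sigma> *\<^sub>v u)" using e[of 2] mom(3) by simp
qed

text \<open>Each central moment of a coordinate is an integral against a normal law fixed by the
  common mean and covariance, so the bound is uniform in n.\<close>

lemma gaussian_bounded_moments:
  assumes Z: "\<And>n. 1 \<le> n \<Longrightarrow> gaussian_vec M d (Z n) \<mu> \<Sigma>" and psd: "psd_matrix d \<Sigma>" and \<mu>: "\<mu> \<in> carrier_vec d"
    and j: "j < d"
  shows "bounded_moments (\<lambda>N n \<omega>. Z n \<omega> $ j)"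
proof -
  let ?u = "unit_vec d j :: real vec"
  have u: "?u \<in> carrier_vec d" by simp
  have "bounded_moments (\<lambda>N n \<omega>. ?u \<bullet> Z n \<omega> - ?u \<bullet> \<mu>)"
    unfolding bounded_moments_def
    using gaussian_functional(1-3)[OF Z psd u] by (auto intro!: exI)
  from bounded_moments_add[OF this bounded_moments_const[of "?u \<bullet> \<mu>"]]
  have "bounded_moments (\<lambda>N n \<omega>. ?u \<bullet> Z n \<omega>)" by simp
  also have "?this \<longleftrightarrow> ?thesis"
  proof (rule bounded_moments_cong)
    fix n \<omega> assume "1 \<le> (n :: nat)" "\<omega> \<in> space M"
    then have "Z n \<omega> \<in> carrier_vec d"
      using Z[of n] measurable_vec_borelD(1) by (auto simp: gaussian_vec_def)
    then show "?u \<bullet> Z n \<omega> = Z n \<omega> $ j" using j by (simp add: scalar_prod_left_unit)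
  qed
  finally show ?thesis .
qed

text \<open>\<open>gaussian_vec\<close> prescribes only variances of linear functionals. The
  covariance of coordinates a and b is obtained by polarisation from the variance along e_a +
  e_b.\<close>

lemma gaussian_has_moments:
  assumes Z: "gaussian_vec M d Z \<mu> \<Sigma>" and psd: "psd_matrix d \<Sigma>" and \<mu>: "\<mu> \<in> carrier_vec d"
  shows "has_moments d Z \<mu> \<Sigma>"
proof -
  have Zm: "Z \<in> M \<rightarrow>\<^sub>M vec_borel d" using Z by (simp add: gaussian_vec_def)
  note Zc = measurable_vec_borelD(1)[OF Zm]
  have Sc: "\<Sigma> \<in> carrier_mat d d" "\<Sigma>\<^sup>T = \<Sigma>" using psd by (auto simp: psd_matrix_def)
  have bm: "bounded_moments (\<lambda>_ _ \<omega>. Z \<omega> $ j)" if "j < d" for j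
    using gaussian_bounded_moments[of d "\<lambda>_. Z", OF Z psd \<mu> that] .
  have mean: "(\<integral>\<omega>. Z \<omega> $ j \<partial>M) = \<mu> $ j" if j: "j < d" for j
  proof -
    have "(\<integral>\<omega>. Z \<omega> $ j - \<mu> $ j \<partial>M) = (\<integral>\<omega>. unit_vec d j \<bullet> Z \<omega> - unit_vec d j \<bullet> \<mu> \<partial>M)"
      using Zc \<mu> j by (intro Bochner_Integration.integral_cong refl) (simp add: scalar_prod_left_unit)
    also have "\<dots> = 0" by (rule gaussian_functional(4)[OF Z psd]) simp
    finally show ?thesis using bounded_moments_integrable[OF bm[OF j], of 1] by (simp add: prob_space)
  qed
  define z where "z j \<omega> = Z \<omega> $ j - \<mu> $ j" for j \<omega>
  have zb: "bounded_moments (\<lambda>_ _. z j)" if "j < d" for j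
    unfolding z_def by (intro bounded_moments_diff bounded_moments_const bm that)
  note ii = bounded_moments_integrable_mult(1)[OF zb zb]
  have unit: "unit_vec d a \<bullet> (\<Sigma> *\<^sub>v unit_vec d b) = \<Sigma> $$ (a, b)" if ab: "a < d" "b < d" for a b
  proof -
    have "(\<Sigma> *\<^sub>v unit_vec d b) $ a = (\<Sum>k<d. \<Sigma> $$ (a, k) * unit_vec d b $ k)"
      by (rule mult_mat_vec_entry[OF Sc(1) _ ab(1)]) simp
    also have "\<dots> = (\<Sum>k<d. if k = b then \<Sigma> $$ (a, k) else 0)"
      using ab by (intro sum.cong) auto
    also have "\<dots> = \<Sigma> $$ (a, b)" using ab by simp
    finally show ?thesis
      using scalar_prod_left_unit[OF mult_mat_vec_carrier[OF Sc(1) unit_vec_carrier] ab(1)] by simp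
  qed
  have diag: "(\<integral>\<omega>. z a \<omega> * z a \<omega> \<partial>M) = \<Sigma> $$ (a, a)" if a: "a < d" for a
  proof -
    have "(\<integral>\<omega>. z a \<omega> * z a \<omega> \<partial>M) = (\<integral>\<omega>. (unit_vec d a \<bullet> Z \<omega> - unit_vec d a \<bullet> \<mu>)\<^sup>2 \<partial>M)"
      using Zc \<mu> a by (intro Bochner_Integration.integral_cong refl)
        (simp add: scalar_prod_left_unit z_def power2_eq_square)
    also have "\<dots> = \<Sigma> $$ (a, a)"
      using gaussian_functional(5)[OF Z psd, of "unit_vec d a"] unit[OF a a] by simp
    finally show ?thesis .
  qed
  have "(\<integral>\<omega>. z a \<omega> * z b \<omega> \<partial>M) = \<Sigma> $$ (a, b)" if ab: "a < d" "b < d" for a b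
  proof -
    let ?u = "unit_vec d a :: real vec" and ?v = "unit_vec d b :: real vec"
    have uv: "?u + ?v \<in> carrier_vec d" by simp
    have "(\<integral>\<omega>. z a \<omega> * z a \<omega> + 2 * (z a \<omega> * z b \<omega>) + z b \<omega> * z b \<omega> \<partial>M) =
        (\<integral>\<omega>. ((?u + ?v) \<bullet> Z \<omega> - (?u + ?v) \<bullet> \<mu>)\<^sup>2 \<partial>M)"
    proof (intro Bochner_Integration.integral_cong refl)
      fix \<omega> assume "\<omega> \<in> space M"
      from Zc[OF this] \<mu> ab have "(?u + ?v) \<bullet> Z \<omega> - (?u + ?v) \<bullet> \<mu> = z a \<omega> + z b \<omega>"
        by (simp add: add_scalar_prod_distrib[of _ d] scalar_prod_left_unit z_def)
      then show "z a \<omega> * z a \<omega> + 2 * (z a \<omega> * z b \<omega>) + z b \<omega> * z b \<omega> = ((?u + ?v) \<bullet> Z \<omega> - (?u + ?v) \<bullet> \<mu>)\<^sup>2"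
        by (simp add: power2_eq_square algebra_simps)
    qed
    also have "\<dots> = ?u \<bullet> (\<Sigma> *\<^sub>v ?u) + 2 * (?v \<bullet> (\<Sigma> *\<^sub>v ?u)) + ?v \<bullet> (\<Sigma> *\<^sub>v ?v)"
      using gaussian_functional(5)[OF Z psd uv] quadratic_form_add[OF Sc, of ?u ?v] by simp
    also have "\<dots> = \<Sigma> $$ (a, a) + 2 * \<Sigma> $$ (b, a) + \<Sigma> $$ (b, b)"
      using ab by (simp add: unit)
    also have "\<Sigma> $$ (b, a) = \<Sigma> $$ (a, b)"
      using Sc ab by (metis carrier_matD index_transpose_mat(1))
    finally show ?thesis using ii[OF ab] ii[OF ab(1) ab(1)] ii[OF ab(2) ab(2)] diag ab by simp
  qed
  then show ?thesis
    using Zm \<mu> Sc bm mean by (simp add: has_moments_def z_def)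
qed

end

section \<open>Convergence in \<open>L\<^sup>p\<close>\<close>

lemma euclid_norm_le_sum_abs:
  assumes "v \<in> carrier_vec d"
  shows "0 \<le> euclid_norm v" "euclid_norm v \<le> (\<Sum>j<d. \<bar>v $ j\<bar>)"
proof -
  have "v \<bullet> v = (\<Sum>j<d. (v $ j)\<^sup>2)"
    using assms by (simp add: scalar_prod_def lessThan_atLeast0 power2_eq_square)
  then have "euclid_norm v = L2_set (\<lambda>j. v $ j) {..<d}"
    by (simp add: euclid_norm_def L2_set_def)
  then show "0 \<le> euclid_norm v" "euclid_norm v \<le> (\<Sum>j<d. \<bar>v $ j\<bar>)"
    using L2_set_le_sum_abs[of "\<lambda>j. v $ j" "{..<d}"] by (simp_all add: L2_set_nonneg)
qed

lemma abs_entry_le_euclid_norm: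
  assumes "v \<in> carrier_vec d" "j < d"
  shows "\<bar>v $ j\<bar> \<le> euclid_norm v"
proof -
  have "(v $ j)\<^sup>2 \<le> (\<Sum>j<d. (v $ j)\<^sup>2)"
    using assms(2) by (intro member_le_sum) auto
  also have "\<dots> = v \<bullet> v"
    using assms by (simp add: scalar_prod_def lessThan_atLeast0 power2_eq_square)
  finally show ?thesis
    unfolding euclid_norm_def by (intro real_le_rsqrt) simp
qed

text \<open>Reduces spectral norms to entries. The same bound shows that the supremum is taken over
  a bounded set, and the zero vector in the unit ball then yields nonnegativity.\<close>

lemma spectral_norm_le_sum_abs:
  assumes A: "A \<in> carrier_mat r c"
  shows "0 \<le> spectral_norm A" "spectral_norm A \<le> (\<Sum>a<r. \<Sum>b<c. \<bar>A $$ (a, b)\<bar>)"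
proof -
  let ?B = "{v \<in> carrier_vec c. euclid_norm v \<le> 1}" and ?s = "\<Sum>a<r. \<Sum>b<c. \<bar>A $$ (a, b)\<bar>"
  have zero: "0\<^sub>v c \<in> ?B" by (simp add: euclid_norm_def)
  have le: "euclid_norm (A *\<^sub>v v) \<le> ?s" if v: "v \<in> ?B" for v
  proof -
    from v have vc: "v \<in> carrier_vec c" and v1: "euclid_norm v \<le> 1" by auto
    have "euclid_norm (A *\<^sub>v v) \<le> (\<Sum>a<r. \<bar>(A *\<^sub>v v) $ a\<bar>)"
      using A vc by (intro euclid_norm_le_sum_abs) simp
    also have "\<dots> \<le> (\<Sum>a<r. \<Sum>b<c. \<bar>A $$ (a, b) * v $ b\<bar>)"
    proof (intro sum_mono)
      fix a assume "a \<in> {..<r}"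
      then show "\<bar>(A *\<^sub>v v) $ a\<bar> \<le> (\<Sum>b<c. \<bar>A $$ (a, b) * v $ b\<bar>)"
        using mult_mat_vec_entry[OF A vc, of a] sum_abs[of "\<lambda>b. A $$ (a, b) * v $ b" "{..<c}"] by simp
    qed
    also have "\<dots> \<le> ?s"
    proof (intro sum_mono)
      fix a b assume "b \<in> {..<c}"
      then have "\<bar>v $ b\<bar> \<le> 1" using abs_entry_le_euclid_norm[OF vc, of b] v1 by simp
      then show "\<bar>A $$ (a, b) * v $ b\<bar> \<le> \<bar>A $$ (a, b)\<bar>"
        by (simp add: abs_mult mult_left_le)
    qed
    finally show ?thesis .
  qed
  have e: "spectral_norm A = (SUP v \<in> ?B. euclid_norm (A *\<^sub>v v))"
    using A by (simp add: spectral_norm_def)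
  show "spectral_norm A \<le> ?s"
    unfolding e by (rule cSUP_least, use zero in blast, rule le)
  have "0 \<le> euclid_norm (A *\<^sub>v 0\<^sub>v c)"
    using A by (intro euclid_norm_le_sum_abs(1)[of _ r]) simp
  also have "\<dots> \<le> spectral_norm A"
    unfolding e by (rule cSUP_upper[OF zero bdd_aboveI2[OF le]])
  finally show "0 \<le> spectral_norm A" .
qed

context prob_space
begin

lemma vanishing_abs:
  assumes "vanishing F"
  shows "vanishing (\<lambda>N n \<omega>. \<bar>F N n \<omega>\<bar>)"
proof -
  have "bounded_moments (\<lambda>N n \<omega>. \<bar>F N n \<omega>\<bar>)"
    using vanishing_bounded[OF assms]
    by (auto simp: bounded_moments_def power_even_abs intro!: borel_measurable_abs)
  with assms show ?thesis by (simp add: vanishing_def)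
qed

text \<open>The nonnegative integral is monotone for arbitrary functions, so f is compared directly
  with the majorant G; in the applications f is a norm and G a sum of absolute values of
  entries.\<close>

lemma Lp_norm_tendsto_0:
  assumes G: "vanishing G" and p: "1 \<le> p"
    and f: "\<And>N \<omega>. \<omega> \<in> space M \<Longrightarrow> 0 \<le> f N \<omega> \<and> f N \<omega> \<le> G N 1 \<omega>"
  shows "(\<lambda>N. Lp_norm M p (f N)) \<longlonglongrightarrow> 0"
proof -
  note Gb = vanishing_bounded[OF G]
  \<comment> \<open>Any even exponent 2k >= p would do.\<close>
  define k where "k = nat \<lceil>p\<rceil>"
  have k: "1 \<le> k" "p \<le> real (2 * k)" using p by (simp_all add: k_def) linarith+
  define e where "e N = (\<integral>\<omega>. \<bar>G N 1 \<omega>\<bar> \<partial>M) + (\<integral>\<omega>. G N 1 \<omega> ^ (2 * k) \<partial>M)" for N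
  have "(\<lambda>N. sqrt (\<integral>\<omega>. (G N 1 \<omega>)\<^sup>2 \<partial>M)) \<longlonglongrightarrow> sqrt 0"
    using vanishing_moments[OF G, of 1] by (intro tendsto_real_sqrt) simp
  then have lim: "(\<lambda>N. sqrt (\<integral>\<omega>. (G N 1 \<omega>)\<^sup>2 \<partial>M)) \<longlonglongrightarrow> 0" by simp
  have "(\<lambda>N. \<integral>\<omega>. \<bar>G N 1 \<omega>\<bar> \<partial>M) \<longlonglongrightarrow> 0"
  proof (rule tendsto_sandwich[OF _ _ tendsto_const lim])
    show "\<forall>\<^sub>F N in sequentially. 0 \<le> (\<integral>\<omega>. \<bar>G N 1 \<omega>\<bar> \<partial>M)" by simp
    have "(\<integral>\<omega>. \<bar>G N 1 \<omega>\<bar> \<partial>M) \<le> sqrt (\<integral>\<omega>. (G N 1 \<omega>)\<^sup>2 \<partial>M)" for N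
      using cauchy_schwarz_expectation(2)[of "G N 1" "\<lambda>_. 1"] bounded_momentsD(1)[OF Gb, of 1 N]
        bounded_momentsD(3)[OF Gb, of 1 N] by (simp add: prob_space)
    then show "\<forall>\<^sub>F N in sequentially. (\<integral>\<omega>. \<bar>G N 1 \<omega>\<bar> \<partial>M) \<le> sqrt (\<integral>\<omega>. (G N 1 \<omega>)\<^sup>2 \<partial>M)" by simp
  qed
  then have e: "e \<longlonglongrightarrow> 0"
    unfolding e_def using tendsto_add[OF _ vanishing_moments[OF G k(1)]] by fastforce
  have e0: "0 \<le> e N" for N
    unfolding e_def by (intro add_nonneg_nonneg Bochner_Integration.integral_nonneg) (simp_all add: zero_le_even_power)
  have I: "(\<integral>\<^sup>+\<omega>. ennreal (\<bar>f N \<omega>\<bar> powr p) \<partial>M) \<le> ennreal (e N)" for N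
  proof -
    have i: "integrable M (\<lambda>\<omega>. \<bar>G N 1 \<omega>\<bar>)" "integrable M (\<lambda>\<omega>. G N 1 \<omega> ^ (2 * k))"
      using bounded_moments_integrable[OF Gb, of 1 N] bounded_momentsD(2)[OF Gb _ k(1), of 1 N] by auto
    \<comment> \<open>A non-integer power is at most y for y <= 1 and at most y^(2k) otherwise; both
      have integrals tending to 0.\<close>
    have "x powr p \<le> y + y ^ (2 * k)" if "0 \<le> x" "x \<le> y" for x y :: real
    proof -
      have "x powr p \<le> y powr p" using that p by (intro powr_mono2) auto
      also have "\<dots> \<le> y + y ^ (2 * k)"
      proof (cases "y \<le> 1")
        case True
        then have "y powr p \<le> y powr 1" using that p by (intro powr_mono') auto
        also have "\<dots> = y" using that by simp
        finally show ?thesis using that by (simp add: add_increasing2)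
      next
        case False
        then have "y powr p \<le> y powr real (2 * k)" using k by (intro powr_mono) auto
        also have "\<dots> = y ^ (2 * k)" using False by (intro powr_realpow) auto
        finally show ?thesis using that by simp
      qed
      finally show ?thesis .
    qed
    then have "\<bar>f N \<omega>\<bar> powr p \<le> \<bar>G N 1 \<omega>\<bar> + G N 1 \<omega> ^ (2 * k)" if "\<omega> \<in> space M" for \<omega>
      using f[OF that, of N] by (metis abs_of_nonneg order_trans)
    then have "(\<integral>\<^sup>+\<omega>. ennreal (\<bar>f N \<omega>\<bar> powr p) \<partial>M) \<le> (\<integral>\<^sup>+\<omega>. ennreal (\<bar>G N 1 \<omega>\<bar> + G N 1 \<omega> ^ (2 * k)) \<partial>M)"
      by (intro nn_integral_mono ennreal_leI)
    also have "\<dots> = ennreal (\<integral>\<omega>. \<bar>G N 1 \<omega>\<bar> + G N 1 \<omega> ^ (2 * k) \<partial>M)"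
      using i by (intro nn_integral_eq_integral) (auto simp: zero_le_even_power)
    also have "(\<integral>\<omega>. \<bar>G N 1 \<omega>\<bar> + G N 1 \<omega> ^ (2 * k) \<partial>M) = e N"
      using i by (simp add: e_def)
    finally show ?thesis .
  qed
  have le: "Lp_norm M p (f N) \<le> ennreal (e N powr (1 / p))" for N
  proof -
    let ?I = "\<integral>\<^sup>+\<omega>. ennreal (\<bar>f N \<omega>\<bar> powr p) \<partial>M"
    have fin: "?I \<noteq> \<infinity>" using I[of N] by (metis ennreal_neq_top infinity_ennreal_def top.extremum_uniqueI)
    have "enn2real ?I \<le> e N"
      using enn2real_mono[OF I[of N]] e0[of N] by simp
    then have "enn2real ?I powr (1 / p) \<le> e N powr (1 / p)"
      using p by (intro powr_mono2) auto
    then show ?thesis using fin by (simp add: Lp_norm_def Let_def ennreal_leI)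
  qed
  have "(\<lambda>N. ennreal (e N powr (1 / p))) \<longlonglongrightarrow> ennreal 0"
    using p e0 by (intro tendsto_ennrealI tendsto_zero_powrI[OF e tendsto_const]) auto
  then have lim': "(\<lambda>N. ennreal (e N powr (1 / p))) \<longlonglongrightarrow> 0" by simp
  show ?thesis
    by (rule tendsto_sandwich[OF _ _ tendsto_const lim']) (use le in auto)
qed

lemma vec_converges_Lp_if_asymp_eq:
  assumes X: "vec_asymp_eq d X (\<lambda>N n. Y n)" and p: "1 \<le> p"
  shows "vec_converges_Lp M p (\<lambda>N. X N 1) (Y 1)"
  unfolding vec_converges_Lp_def
proof (rule Lp_norm_tendsto_0[OF _ p])
  show "vanishing (\<lambda>N n \<omega>. \<Sum>j<d. \<bar>X N n \<omega> $ j - Y n \<omega> $ j\<bar>)"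
    by (intro vanishing_sum vanishing_abs asymp_eqD(3) vec_asymp_eqD(3)[OF X]) simp
  fix N \<omega> assume \<omega>: "\<omega> \<in> space M"
  have c: "X N 1 \<omega> \<in> carrier_vec d" "Y 1 \<omega> \<in> carrier_vec d"
    using vec_asymp_eqD(1,2)[OF X _ \<omega>] by auto
  then have "X N 1 \<omega> - Y 1 \<omega> \<in> carrier_vec d" by simp
  from euclid_norm_le_sum_abs[OF this] add_vec_entry(2)[OF c]
  show "0 \<le> euclid_norm (X N 1 \<omega> - Y 1 \<omega>) \<and> euclid_norm (X N 1 \<omega> - Y 1 \<omega>) \<le> (\<Sum>j<d. \<bar>X N 1 \<omega> $ j - Y 1 \<omega> $ j\<bar>)"
    by simp
qed

lemma mat_converges_Lp_if_asymp_eq: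
  assumes A: "mat_asymp_eq r c A (\<lambda>N n. B n)" and p: "1 \<le> p"
  shows "mat_converges_Lp M p (\<lambda>N. A N 1) (B 1)"
  unfolding mat_converges_Lp_def
proof (rule Lp_norm_tendsto_0[OF _ p])
  show "vanishing (\<lambda>N n \<omega>. \<Sum>a<r. \<Sum>b<c. \<bar>A N n \<omega> $$ (a, b) - B n \<omega> $$ (a, b)\<bar>)"
    by (intro vanishing_sum vanishing_abs asymp_eqD(3) mat_asymp_eqD(3)[OF A]) simp_all
  fix N \<omega> assume \<omega>: "\<omega> \<in> space M"
  have c: "A N 1 \<omega> \<in> carrier_mat r c" "B 1 \<omega> \<in> carrier_mat r c"
    using mat_asymp_eqD(1,2)[OF A _ \<omega>] by auto
  then have "A N 1 \<omega> - B 1 \<omega> \<in> carrier_mat r c" by (intro minus_carrier_mat)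
  from spectral_norm_le_sum_abs[OF this] c
  show "0 \<le> spectral_norm (A N 1 \<omega> - B 1 \<omega>) \<and>
      spectral_norm (A N 1 \<omega> - B 1 \<omega>) \<le> (\<Sum>a<r. \<Sum>b<c. \<bar>A N 1 \<omega> $$ (a, b) - B 1 \<omega> $$ (a, b)\<bar>)"
    by simp
qed

lemma has_moments_cong:
  assumes "\<And>\<omega>. \<omega> \<in> space M \<Longrightarrow> Z \<omega> = Z' \<omega>"
  shows "has_moments d Z \<mu> C \<longleftrightarrow> has_moments d Z' \<mu> C"
proof -
  have "Z \<in> M \<rightarrow>\<^sub>M vec_borel d \<longleftrightarrow> Z' \<in> M \<rightarrow>\<^sub>M vec_borel d"
    using assms by (rule measurable_cong)
  moreover have "bounded_moments (\<lambda>_ _ \<omega>. Z \<omega> $ j) \<longleftrightarrow> bounded_moments (\<lambda>_ _ \<omega>. Z' \<omega> $ j)" for j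
    by (rule bounded_moments_cong) (simp add: assms)
  moreover have "(\<integral>\<omega>. Z \<omega> $ j \<partial>M) = (\<integral>\<omega>. Z' \<omega> $ j \<partial>M)"
    "(\<integral>\<omega>. (Z \<omega> $ a - \<mu> $ a) * (Z \<omega> $ b - \<mu> $ b) \<partial>M) = (\<integral>\<omega>. (Z' \<omega> $ a - \<mu> $ a) * (Z' \<omega> $ b - \<mu> $ b) \<partial>M)" for j a b
    by (intro Bochner_Integration.integral_cong refl; simp add: assms)+
  ultimately show ?thesis by (simp add: has_moments_def)
qed

lemma vec_asymp_eq_cong:
  assumes "\<And>N n \<omega>. 1 \<le> n \<Longrightarrow> \<omega> \<in> space M \<Longrightarrow> X N n \<omega> = X' N n \<omega>"
    and "\<And>N n \<omega>. 1 \<le> n \<Longrightarrow> \<omega> \<in> space M \<Longrightarrow> Y N n \<omega> = Y' N n \<omega>"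
  shows "vec_asymp_eq d X Y \<longleftrightarrow> vec_asymp_eq d X' Y'"
proof -
  have "asymp_eq (\<lambda>N n \<omega>. X N n \<omega> $ j) (\<lambda>N n \<omega>. Y N n \<omega> $ j) \<longleftrightarrow>
      asymp_eq (\<lambda>N n \<omega>. X' N n \<omega> $ j) (\<lambda>N n \<omega>. Y' N n \<omega> $ j)" for j
    by (rule asymp_eq_cong) (simp_all add: assms)
  then show ?thesis using assms by (simp add: vec_asymp_eq_def)
qed

lemma has_moments_cross:
  assumes X: "indep_vars M' X I" and JK: "J \<subseteq> I" "K \<subseteq> I" "J \<inter> K = {}"
    and Z: "has_moments d Z \<mu> C" "Z \<in> block_algebra M' X J \<rightarrow>\<^sub>M vec_borel d"
    and W: "has_moments e W \<nu> R" "W \<in> block_algebra M' X K \<rightarrow>\<^sub>M vec_borel e"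
    and kl: "k < d" "l < e"
  shows "(\<integral>\<omega>. (Z \<omega> $ k - \<mu> $ k) * (W \<omega> $ l - \<nu> $ l) \<partial>M) = 0"
proof -
  have i: "integrable M (\<lambda>\<omega>. Z \<omega> $ k)" "integrable M (\<lambda>\<omega>. W \<omega> $ l)"
    using bounded_moments_integrable[OF has_momentsD(4)[OF Z(1) kl(1)], of 1]
      bounded_moments_integrable[OF has_momentsD(4)[OF W(1) kl(2)], of 1] by simp_all
  have "(\<integral>\<omega>. (Z \<omega> $ k - \<mu> $ k) * (W \<omega> $ l - \<nu> $ l) \<partial>M) =
      (\<integral>\<omega>. Z \<omega> $ k - \<mu> $ k \<partial>M) * (\<integral>\<omega>. W \<omega> $ l - \<nu> $ l \<partial>M)"
    using measurable_vec_borelD(2)[OF Z(2) kl(1)] measurable_vec_borelD(2)[OF W(2) kl(2)] i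
    by (intro expectation_mult_blocks[OF X JK]) simp_all
  also have "(\<integral>\<omega>. Z \<omega> $ k - \<mu> $ k \<partial>M) = 0"
    using i has_momentsD(5)[OF Z(1) kl(1)] by (simp add: prob_space)
  finally show ?thesis by simp
qed

text \<open>Member n of the limit is a function of the inputs in J n, and these label sets are
  disjoint. Hence coordinates and their pairwise products are uncorrelated across members, as the
  law of large numbers requires.\<close>

lemma sample_statistics_asymp_eq:
  assumes X: "indep_vars M' X I" and J: "\<And>n. 1 \<le> n \<Longrightarrow> J n \<subseteq> I" "\<And>n l. n \<noteq> l \<Longrightarrow> J n \<inter> J l = {}"
    and Y: "vec_asymp_eq d Y (\<lambda>N. Z)"
    and Z: "\<And>n. 1 \<le> n \<Longrightarrow> has_moments d (Z n) \<mu> C"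
      "\<And>n. 1 \<le> n \<Longrightarrow> Z n \<in> block_algebra M' X (J n) \<rightarrow>\<^sub>M vec_borel d"
  shows "mat_asymp_eq d d (\<lambda>N n \<omega>. sample_cov d N (\<lambda>l. Y N l \<omega>)) (\<lambda>N n \<omega>. C)"
    "vec_asymp_eq d (\<lambda>N n \<omega>. sample_mean d N (\<lambda>l. Y N l \<omega>)) (\<lambda>N n \<omega>. \<mu>)"
proof -
  note zm = measurable_vec_borelD(2)[OF Z(2)] and zb = has_momentsD(4)[OF Z(1)]
  have u1: "pairwise_uncorrelated (\<lambda>n \<omega>. Z n \<omega> $ j)" if "j < d" for j
    unfolding pairwise_uncorrelated_def
  proof (intro allI impI)
    fix n l :: nat assume nl: "1 \<le> n" "1 \<le> l" "n \<noteq> l"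
    show "(\<integral>\<omega>. Z n \<omega> $ j * Z l \<omega> $ j \<partial>M) = (\<integral>\<omega>. Z n \<omega> $ j \<partial>M) * (\<integral>\<omega>. Z l \<omega> $ j \<partial>M)"
      by (rule expectation_mult_blocks[OF X J(1)[OF nl(1)] J(1)[OF nl(2)] J(2)[OF nl(3)]])
        (use zm zb that nl bounded_moments_integrable_mult(2) in blast)+
  qed
  have u2: "pairwise_uncorrelated (\<lambda>n \<omega>. Z n \<omega> $ a * Z n \<omega> $ b)" if ab: "a < d" "b < d" for a b
    unfolding pairwise_uncorrelated_def
  proof (intro allI impI)
    fix n l :: nat assume nl: "1 \<le> n" "1 \<le> l" "n \<noteq> l"
    have m: "(\<lambda>\<omega>. Z q \<omega> $ a * Z q \<omega> $ b) \<in> borel_measurable (block_algebra M' X (J q))" if "1 \<le> q" for q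
      using zm[OF that] ab by (intro borel_measurable_times) auto
    have i: "integrable M (\<lambda>\<omega>. Z q \<omega> $ a * Z q \<omega> $ b)" if "1 \<le> q" for q
      by (rule bounded_moments_integrable_mult(1)[OF zb[OF that ab(1)] zb[OF that ab(2)]])
    show "(\<integral>\<omega>. Z n \<omega> $ a * Z n \<omega> $ b * (Z l \<omega> $ a * Z l \<omega> $ b) \<partial>M) =
        (\<integral>\<omega>. Z n \<omega> $ a * Z n \<omega> $ b \<partial>M) * (\<integral>\<omega>. Z l \<omega> $ a * Z l \<omega> $ b \<partial>M)"
      by (rule expectation_mult_blocks[OF X J(1)[OF nl(1)] J(1)[OF nl(2)] J(2)[OF nl(3)]
            m[OF nl(1)] i[OF nl(1)] m[OF nl(2)] i[OF nl(2)]])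
  qed
  note mc = has_momentsD(2,3)[OF Z(1)[OF order_refl]]
  show "mat_asymp_eq d d (\<lambda>N n \<omega>. sample_cov d N (\<lambda>l. Y N l \<omega>)) (\<lambda>N n \<omega>. C)"
    by (rule mat_asymp_eq_sample_cov[OF Y, of "\<lambda>j. \<mu> $ j"])
      (use has_momentsD(5)[OF Z(1)] has_moments_second[OF Z(1)] mc u1 u2 in auto)
  have "vec d (\<lambda>j. \<mu> $ j) = \<mu>" using mc by auto
  then show "vec_asymp_eq d (\<lambda>N n \<omega>. sample_mean d N (\<lambda>l. Y N l \<omega>)) (\<lambda>N n \<omega>. \<mu>)"
    using vec_asymp_eq_sample_mean[OF Y, of "\<lambda>j. \<mu> $ j"] has_momentsD(5)[OF Z(1)] u1 by simp
qed

end

section \<open>The ensemble Kalman smoother\<close>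

lemma measurable_ensemble_pair:
  assumes S: "well_formed_model S" and i: "i \<le> horizon S" and n: "1 \<le> n"
    and X0: "\<And>n. 1 \<le> n \<Longrightarrow> X0 n \<in> M \<rightarrow>\<^sub>M vec_borel (state_dim S)"
    and V: "\<And>j n. j \<in> {1..i} \<Longrightarrow> 1 \<le> n \<Longrightarrow> V j n \<in> M \<rightarrow>\<^sub>M vec_borel (state_dim S)"
    and W: "\<And>j n. j \<in> {1..i} \<Longrightarrow> 1 \<le> n \<Longrightarrow> W j n \<in> M \<rightarrow>\<^sub>M vec_borel (obs_dim S j)"
  shows "(\<lambda>\<omega>. enks S X0 V W N i n \<omega> @\<^sub>v limit_ens S X0 V W i n \<omega>) \<in> M \<rightarrow>\<^sub>M vec_borel (2 * comp_dim S i)"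
  unfolding mult_2
proof (rule measurable_append_vec)
  show "enks S X0 V W N i n \<in> M \<rightarrow>\<^sub>M vec_borel (comp_dim S i)"
    by (rule measurable_enks[OF S n _ _ _ i]) (use X0 V W in auto)
  show "limit_ens S X0 V W i n \<in> M \<rightarrow>\<^sub>M vec_borel (comp_dim S i)"
    by (rule measurable_limit_ens[OF S _ _ _ i]) (use X0 V W n in auto)
qed

locale enks_inputs = prob_space P for P :: "'w measure" +
  fixes S :: linear_model
    and X0 :: "nat \<Rightarrow> 'w \<Rightarrow> real vec" and V W :: "nat \<Rightarrow> nat \<Rightarrow> 'w \<Rightarrow> real vec"
  assumes wf: "well_formed_model S"
    and X0: "\<And>n. 1 \<le> n \<Longrightarrow> gaussian_vec P (state_dim S) (X0 n) (prior_mean S) (prior_cov S)"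
    and V: "\<And>i n. i \<in> {1..horizon S} \<Longrightarrow> 1 \<le> n \<Longrightarrow>
      gaussian_vec P (state_dim S) (V i n) (0\<^sub>v (state_dim S)) (model_cov S i)"
    and W: "\<And>i n. i \<in> {1..horizon S} \<Longrightarrow> 1 \<le> n \<Longrightarrow>
      gaussian_vec P (obs_dim S i) (W i n) (0\<^sub>v (obs_dim S i)) (obs_cov S i)"
    and indep: "indep_vars (\<lambda>l. vec_borel (input_dim S l)) (input_vec X0 V W) (inputs S)"
begin

section \<open>Limit members as functions of their own inputs\<close>

text \<open>The inputs that limit member n has used up to step i; for i = 0 only its prior
  draw.\<close>

definition past_block :: "nat \<Rightarrow> nat \<Rightarrow> input set" where
  "past_block i n = {Prior n} \<union> {Model_noise j n |j. j \<in> {1..i}} \<union> {Obs_noise j n |j. j \<in> {1..i}}"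

abbreviation block :: "input set \<Rightarrow> 'w measure" where
  "block \<equiv> block_algebra (\<lambda>l. vec_borel (input_dim S l)) (input_vec X0 V W)"

abbreviation limit_forecast :: "nat \<Rightarrow> nat \<Rightarrow> 'w \<Rightarrow> real vec" where
  "limit_forecast j n \<equiv> \<lambda>\<omega>. forecast S (Suc j) (limit_ens S X0 V W j n \<omega>) (V (Suc j) n \<omega>)"

lemma past_block_subset: "1 \<le> n \<Longrightarrow> i \<le> horizon S \<Longrightarrow> past_block i n \<subseteq> inputs S"
  by (auto simp: past_block_def inputs_def)

lemma past_block_disjoint: "n \<noteq> l \<Longrightarrow> past_block i n \<inter> past_block i l = {}"
  by (auto simp: past_block_def)

lemma block_inputs:
  assumes "K \<subseteq> inputs S"
  shows "Prior n \<in> K \<Longrightarrow> X0 n \<in> block K \<rightarrow>\<^sub>M vec_borel (state_dim S)"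
    "Model_noise i n \<in> K \<Longrightarrow> V i n \<in> block K \<rightarrow>\<^sub>M vec_borel (state_dim S)"
    "Obs_noise i n \<in> K \<Longrightarrow> W i n \<in> block K \<rightarrow>\<^sub>M vec_borel (obs_dim S i)"
  using measurable_block_algebra[OF indep assms, of "Prior n"]
    measurable_block_algebra[OF indep assms, of "Model_noise i n"]
    measurable_block_algebra[OF indep assms, of "Obs_noise i n"] by simp_all

lemma block_limit_ens:
  assumes "i \<le> horizon S" "past_block i n \<subseteq> K" "K \<subseteq> inputs S"
  shows "limit_ens S X0 V W i n \<in> block K \<rightarrow>\<^sub>M vec_borel (comp_dim S i)"
  by (rule measurable_limit_ens[OF wf _ _ _ assms(1)])
    (rule block_inputs[OF assms(3)]; use assms(2) in \<open>auto simp: past_block_def\<close>)+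

lemma block_limit_forecast:
  assumes j: "Suc j \<le> horizon S" and K: "past_block j n \<subseteq> K" "Model_noise (Suc j) n \<in> K" "K \<subseteq> inputs S"
  shows "limit_forecast j n \<in> block K \<rightarrow>\<^sub>M vec_borel (comp_dim S (Suc j))"
proof -
  have "limit_ens S X0 V W j n \<in> block K \<rightarrow>\<^sub>M vec_borel (comp_dim S (Suc j - 1))"
    using block_limit_ens[OF _ K(1,3)] j by simp
  then show ?thesis
    using j by (intro measurable_forecast[OF wf] block_inputs(2)[OF K(3,2)]) auto
qed

lemma input_moments:
  "1 \<le> n \<Longrightarrow> has_moments (state_dim S) (X0 n) (prior_mean S) (prior_cov S)"
  "i \<in> {1..horizon S} \<Longrightarrow> 1 \<le> n \<Longrightarrow> has_moments (state_dim S) (V i n) (0\<^sub>v (state_dim S)) (model_cov S i)"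
  "i \<in> {1..horizon S} \<Longrightarrow> 1 \<le> n \<Longrightarrow> has_moments (obs_dim S i) (W i n) (0\<^sub>v (obs_dim S i)) (obs_cov S i)"
proof -
  show "1 \<le> n \<Longrightarrow> has_moments (state_dim S) (X0 n) (prior_mean S) (prior_cov S)"
    using wf by (intro gaussian_has_moments X0) (auto simp: well_formed_model_def)
  show "i \<in> {1..horizon S} \<Longrightarrow> 1 \<le> n \<Longrightarrow> has_moments (state_dim S) (V i n) (0\<^sub>v (state_dim S)) (model_cov S i)"
    by (intro gaussian_has_moments V model_psd(1)[OF wf]) auto
  show "i \<in> {1..horizon S} \<Longrightarrow> 1 \<le> n \<Longrightarrow> has_moments (obs_dim S i) (W i n) (0\<^sub>v (obs_dim S i)) (obs_cov S i)"
    by (intro gaussian_has_moments W pd_matrix_imp_psd model_psd(2)[OF wf]) auto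
qed

lemma input_asymp_eq:
  "vec_asymp_eq (state_dim S) (\<lambda>N. X0) (\<lambda>N. X0)"
  "i \<in> {1..horizon S} \<Longrightarrow> vec_asymp_eq (state_dim S) (\<lambda>N. V i) (\<lambda>N. V i)"
  "i \<in> {1..horizon S} \<Longrightarrow> vec_asymp_eq (obs_dim S i) (\<lambda>N. W i) (\<lambda>N. W i)"
proof -
  have *: "vec_asymp_eq d (\<lambda>N. Z) (\<lambda>N. Z)"
    if Z: "\<And>n. 1 \<le> n \<Longrightarrow> gaussian_vec P d (Z n) \<mu> \<Sigma>" and \<Sigma>: "psd_matrix d \<Sigma>" and \<mu>: "\<mu> \<in> carrier_vec d"
    for d Z \<mu> \<Sigma>
  proof -
    have "Z n \<omega> \<in> carrier_vec d" if "1 \<le> n" "\<omega> \<in> space P" for n \<omega>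
      using Z[OF that(1)] measurable_vec_borelD(1)[OF _ that(2)] by (auto simp: gaussian_vec_def)
    moreover have "bounded_moments (\<lambda>N n \<omega>. Z n \<omega> $ j)" if "j < d" for j
      by (rule gaussian_bounded_moments[OF Z \<Sigma> \<mu> that])
    ultimately show ?thesis
      by (simp add: vec_asymp_eq_def asymp_eq_refl)
  qed
  show "vec_asymp_eq (state_dim S) (\<lambda>N. X0) (\<lambda>N. X0)"
    by (rule *[OF X0]) (use wf in \<open>auto simp: well_formed_model_def\<close>)
  show "vec_asymp_eq (state_dim S) (\<lambda>N. V i) (\<lambda>N. V i)" if i: "i \<in> {1..horizon S}"
    by (rule *[OF V[OF i] model_psd(1)[OF wf i]]) simp_all
  show "vec_asymp_eq (obs_dim S i) (\<lambda>N. W i) (\<lambda>N. W i)" if i: "i \<in> {1..horizon S}"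
    by (rule *[OF W[OF i] pd_matrix_imp_psd[OF model_psd(2)[OF wf i]]]) simp_all
qed

text \<open>The model noise of the new step lies outside the past block of the member, hence is
  uncorrelated with its state. The mean obtained is common to all members.\<close>

lemma limit_forecast_moments:
  assumes j: "Suc j \<le> horizon S"
    and U: "\<And>n. 1 \<le> n \<Longrightarrow> has_moments (comp_dim S j) (limit_ens S X0 V W j n) \<mu> (kalman_cov S j)"
  obtains \<mu>' where "\<And>n. 1 \<le> n \<Longrightarrow> has_moments (comp_dim S (Suc j)) (limit_forecast j n) \<mu>' (forecast_cov S (Suc j))"
proof -
  let ?i = "Suc j"
  have i: "?i \<in> {1..horizon S}" using j by simp
  define \<mu>' where "\<mu>' = forecast_mat S ?i *\<^sub>v \<mu> + noise_mat S ?i *\<^sub>v 0\<^sub>v (state_dim S) + forecast_shift S ?i"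
  have F: "forecast_mat S ?i \<in> carrier_mat (comp_dim S ?i) (comp_dim S j)"
    using forecast_mat_carrier[OF wf i refl] by simp
  have "has_moments (comp_dim S ?i) (limit_forecast j n) \<mu>' (forecast_cov S ?i)" if n: "1 \<le> n" for n
  proof -
    note Um = has_momentsD(1)[OF U[OF n]] and Vm = has_momentsD(1)[OF input_moments(2)[OF i n]]
    have cross: "(\<integral>\<omega>. (limit_ens S X0 V W j n \<omega> $ k - \<mu> $ k) * (V ?i n \<omega> $ l - 0\<^sub>v (state_dim S) $ l) \<partial>P) = 0"
      if "k < comp_dim S j" "l < state_dim S" for k l
    proof (rule has_moments_cross[OF indep _ _ _ U[OF n] _ input_moments(2)[OF i n] _ that])
      show sub: "past_block j n \<subseteq> inputs S" using n j by (intro past_block_subset) auto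
      show sub': "{Model_noise ?i n} \<subseteq> inputs S" using n j by (auto simp: inputs_def)
      show "past_block j n \<inter> {Model_noise ?i n} = {}" by (auto simp: past_block_def)
      show "limit_ens S X0 V W j n \<in> block (past_block j n) \<rightarrow>\<^sub>M vec_borel (comp_dim S j)"
        using j by (intro block_limit_ens sub) auto
      show "V ?i n \<in> block {Model_noise ?i n} \<rightarrow>\<^sub>M vec_borel (state_dim S)"
        by (rule block_inputs(2)[OF sub']) simp
    qed
    have "has_moments (comp_dim S ?i)
        (\<lambda>\<omega>. forecast_mat S ?i *\<^sub>v limit_ens S X0 V W j n \<omega> + noise_mat S ?i *\<^sub>v V ?i n \<omega> + forecast_shift S ?i) \<mu>'
        (forecast_mat S ?i * kalman_cov S j * (forecast_mat S ?i)\<^sup>T + noise_mat S ?i * model_cov S ?i * (noise_mat S ?i)\<^sup>T)"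
      unfolding \<mu>'_def
      by (rule has_moments_affine[OF U[OF n] input_moments(2)[OF i n] F noise_mat_carrier[OF wf i refl]
            forecast_shift_carrier[OF wf i refl] cross])
    also have "forecast_mat S ?i * kalman_cov S j * (forecast_mat S ?i)\<^sup>T + noise_mat S ?i * model_cov S ?i * (noise_mat S ?i)\<^sup>T =
        forecast_cov S ?i"
      using kalman_forecast_cov_eq[OF wf i refl, of "kalman_cov S j"] has_momentsD(3)[OF U[OF n]]
      by (simp add: forecast_cov_def)
    finally show ?thesis
      by (subst has_moments_cong[OF forecast_affine[OF wf i refl]])
        (simp_all add: measurable_vec_borelD(1)[OF Um] measurable_vec_borelD(1)[OF Vm])
  qed
  then show ?thesis by (rule that)
qed

text \<open>The mean is carried along existentially: it is whatever the affine recursion yields,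
  while the covariance is identified with the smoother covariance by the Joseph form.\<close>

lemma limit_ens_moments:
  assumes "i \<le> horizon S"
  obtains \<mu> where "\<And>n. 1 \<le> n \<Longrightarrow> has_moments (comp_dim S i) (limit_ens S X0 V W i n) \<mu> (kalman_cov S i)"
  using assms
proof (induction i arbitrary: thesis)
  case 0
  show ?case
    by (rule 0(1)[of "prior_mean S"]) (use input_moments(1) in \<open>simp add: comp_dim_def\<close>)
next
  case (Suc j)
  let ?i = "Suc j"
  have i: "?i \<in> {1..horizon S}" using Suc.prems by simp
  obtain \<mu>0 where U: "\<And>n. 1 \<le> n \<Longrightarrow> has_moments (comp_dim S j) (limit_ens S X0 V W j n) \<mu>0 (kalman_cov S j)"
    using Suc by (metis Suc_leD)
  obtain \<mu> where Uf: "\<And>n. 1 \<le> n \<Longrightarrow> has_moments (comp_dim S ?i) (limit_forecast j n) \<mu> (forecast_cov S ?i)"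
    using limit_forecast_moments[OF Suc.prems(2) U] by blast
  let ?K = "kalman_gain S ?i (forecast_cov S ?i)" and ?H = "composite_obs_op S ?i"
  let ?L = "1\<^sub>m (comp_dim S ?i) - ?K * ?H"
  note psd = psd_forecast_cov[OF wf i]
  note K = kalman_gain_carrier[OF wf i psd]
  have K': "- ?K \<in> carrier_mat (comp_dim S ?i) (obs_dim S ?i)" using K by simp
  define \<mu>' where "\<mu>' = ?L *\<^sub>v \<mu> + (- ?K) *\<^sub>v 0\<^sub>v (obs_dim S ?i) + ?K *\<^sub>v obs_data S ?i"
  have "has_moments (comp_dim S ?i) (limit_ens S X0 V W ?i n) \<mu>' (kalman_cov S ?i)" if n: "1 \<le> n" for n
  proof -
    note Um = has_momentsD(1)[OF Uf[OF n]] and Wm = has_momentsD(1)[OF input_moments(3)[OF i n]]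
    have cross: "(\<integral>\<omega>. (limit_forecast j n \<omega> $ k - \<mu> $ k) * (W ?i n \<omega> $ l - 0\<^sub>v (obs_dim S ?i) $ l) \<partial>P) = 0"
      if "k < comp_dim S ?i" "l < obs_dim S ?i" for k l
    proof (rule has_moments_cross[OF indep _ _ _ Uf[OF n] _ input_moments(3)[OF i n] _ that])
      \<comment> \<open>The forecast already depends on the model noise of this step, so its block
        is the past block enlarged by that label; the observation noise of the step stays
        outside.\<close>
      show sub: "insert (Model_noise ?i n) (past_block j n) \<subseteq> inputs S"
        using n Suc.prems past_block_subset[of n j] by (auto simp: inputs_def)
      show sub': "{Obs_noise ?i n} \<subseteq> inputs S" using n Suc.prems by (auto simp: inputs_def)
      show "insert (Model_noise ?i n) (past_block j n) \<inter> {Obs_noise ?i n} = {}" by (auto simp: past_block_def)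
      show "limit_forecast j n \<in> block (insert (Model_noise ?i n) (past_block j n)) \<rightarrow>\<^sub>M vec_borel (comp_dim S ?i)"
        using Suc.prems by (intro block_limit_forecast sub) auto
      show "W ?i n \<in> block {Obs_noise ?i n} \<rightarrow>\<^sub>M vec_borel (obs_dim S ?i)"
        by (rule block_inputs(3)[OF sub']) simp
    qed
    have y: "?K *\<^sub>v obs_data S ?i \<in> carrier_vec (comp_dim S ?i)"
      using K model_carriers(4)[OF wf i refl] by simp
    have "has_moments (comp_dim S ?i)
        (\<lambda>\<omega>. ?L *\<^sub>v limit_forecast j n \<omega> + (- ?K) *\<^sub>v W ?i n \<omega> + ?K *\<^sub>v obs_data S ?i) \<mu>'
        (?L * forecast_cov S ?i * ?L\<^sup>T + (- ?K) * obs_cov S ?i * (- ?K)\<^sup>T)"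
      unfolding \<mu>'_def
      by (rule has_moments_affine[OF Uf[OF n] input_moments(3)[OF i n] update_mat_carrier[OF wf i psd] K' y cross])
    also have "?L * forecast_cov S ?i * ?L\<^sup>T + (- ?K) * obs_cov S ?i * (- ?K)\<^sup>T = kalman_cov S ?i"
      using kalman_update_cov[OF wf i psd] kalman_cov_step[of ?i S] by simp
    finally show ?thesis
      unfolding limit_ens.simps
      by (subst has_moments_cong[OF analysis_affine[OF wf i refl]])
        (simp_all add: measurable_vec_borelD(1)[OF Um] measurable_vec_borelD(1)[OF Wm] K)
  qed
  then show ?case by (rule Suc.prems(1))
qed

text \<open>The two recursions differ only in the covariance inside the gain, which
  \<open>ref_ens\<close> computes from member 1; by the moment lemma it is
  \<open>forecast_cov\<close>.\<close>

lemma ref_ens_eq_limit_ens: "i \<le> horizon S \<Longrightarrow> ref_ens P S X0 V W i = limit_ens S X0 V W i"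
proof (induction i)
  case (Suc j)
  obtain \<mu>0 where "\<And>n. 1 \<le> n \<Longrightarrow> has_moments (comp_dim S j) (limit_ens S X0 V W j n) \<mu>0 (kalman_cov S j)"
    using limit_ens_moments[of j] Suc.prems by (metis Suc_leD)
  then obtain \<mu> where "\<And>n. 1 \<le> n \<Longrightarrow>
      has_moments (comp_dim S (Suc j)) (limit_forecast j n) \<mu> (forecast_cov S (Suc j))"
    using limit_forecast_moments[OF Suc.prems] by blast
  from has_moments_mean_cov(2)[OF this[OF order_refl]] show ?case
    using Suc by (simp add: Let_def)
qed simp

section \<open>Convergence of the smoother ensemble\<close>

text \<open>The induction runs over all members at once, since the gain of the next step depends on
  averages over the ensemble. The members keep a common noise realisation with their reference
  counterparts, so the noise cancels in the differences up to the difference of the gains.\<close>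

lemma enks_asymp_eq:
  "i \<le> horizon S \<Longrightarrow> vec_asymp_eq (comp_dim S i) (\<lambda>N. enks S X0 V W N i) (\<lambda>N. limit_ens S X0 V W i)"
proof (induction i)
  case 0
  then show ?case using input_asymp_eq(1) by (simp add: comp_dim_def)
next
  case (Suc j)
  let ?i = "Suc j"
  have i: "?i \<in> {1..horizon S}" using Suc.prems by simp
  have IH: "vec_asymp_eq (comp_dim S j) (\<lambda>N. enks S X0 V W N j) (\<lambda>N. limit_ens S X0 V W j)"
    using Suc by simp
  have F: "forecast_mat S ?i \<in> carrier_mat (comp_dim S ?i) (comp_dim S j)"
    using forecast_mat_carrier[OF wf i refl] by simp
  define Xf where "Xf N n \<omega> = forecast S ?i (enks S X0 V W N j n \<omega>) (V ?i n \<omega>)" for N n \<omega>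
  have Xf: "vec_asymp_eq (comp_dim S ?i) Xf (\<lambda>N. limit_forecast j)"
  proof -
    have "vec_asymp_eq (comp_dim S ?i)
        (\<lambda>N n \<omega>. forecast_mat S ?i *\<^sub>v enks S X0 V W N j n \<omega> + noise_mat S ?i *\<^sub>v V ?i n \<omega> + forecast_shift S ?i)
        (\<lambda>N n \<omega>. forecast_mat S ?i *\<^sub>v limit_ens S X0 V W j n \<omega> + noise_mat S ?i *\<^sub>v V ?i n \<omega> + forecast_shift S ?i)"
      by (intro vec_asymp_eq_add(1) vec_asymp_eq_mult[OF mat_asymp_eq_const[OF F] IH]
          vec_asymp_eq_mult[OF mat_asymp_eq_const[OF noise_mat_carrier[OF wf i refl]] input_asymp_eq(2)[OF i]]
          vec_asymp_eq_const[OF forecast_shift_carrier[OF wf i refl]])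
    also have "?this \<longleftrightarrow> vec_asymp_eq (comp_dim S ?i) Xf (\<lambda>N. limit_forecast j)"
    proof (intro vec_asymp_eq_cong)
      fix N n \<omega> assume n: "1 \<le> (n :: nat)" and \<omega>: "\<omega> \<in> space P"
      note v = vec_asymp_eqD(1)[OF input_asymp_eq(2)[OF i] n \<omega>]
      have c: "enks S X0 V W N j n \<omega> \<in> carrier_vec (comp_dim S (?i - 1))"
        "limit_ens S X0 V W j n \<omega> \<in> carrier_vec (comp_dim S (?i - 1))"
        using vec_asymp_eqD(1,2)[OF IH n \<omega>] by simp_all
      show "forecast_mat S ?i *\<^sub>v enks S X0 V W N j n \<omega> + noise_mat S ?i *\<^sub>v V ?i n \<omega> + forecast_shift S ?i = Xf N n \<omega>"
        unfolding Xf_def by (rule forecast_affine[OF wf i refl c(1) v, symmetric])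
      show "forecast_mat S ?i *\<^sub>v limit_ens S X0 V W j n \<omega> + noise_mat S ?i *\<^sub>v V ?i n \<omega> + forecast_shift S ?i = limit_forecast j n \<omega>"
        by (rule forecast_affine[OF wf i refl c(2) v, symmetric])
    qed
    finally show ?thesis .
  qed
  obtain \<mu>0 where "\<And>n. 1 \<le> n \<Longrightarrow> has_moments (comp_dim S j) (limit_ens S X0 V W j n) \<mu>0 (kalman_cov S j)"
    using limit_ens_moments[of j] Suc.prems by (metis Suc_leD)
  then obtain \<mu> where Uf: "\<And>n. 1 \<le> n \<Longrightarrow>
      has_moments (comp_dim S ?i) (limit_forecast j n) \<mu> (forecast_cov S ?i)"
    using limit_forecast_moments[OF Suc.prems] by blast
  have C: "mat_asymp_eq (comp_dim S ?i) (comp_dim S ?i)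
      (\<lambda>N n \<omega>. sample_cov (comp_dim S ?i) N (\<lambda>l. Xf N l \<omega>)) (\<lambda>N n \<omega>. forecast_cov S ?i)"
  \<comment> \<open>The block of step i contains every input of the forecast; that it also holds the
    observation noise of step i is harmless, as blocks of different members stay disjoint.\<close>
  proof (rule sample_statistics_asymp_eq(1)[OF indep _ _ Xf Uf, of "past_block ?i"])
    show "limit_forecast j n \<in> block (past_block ?i n) \<rightarrow>\<^sub>M vec_borel (comp_dim S ?i)" if "1 \<le> n" for n
      using Suc.prems that by (intro block_limit_forecast past_block_subset) (auto simp: past_block_def)
  qed (use Suc.prems past_block_subset past_block_disjoint in auto)
  have K: "mat_asymp_eq (comp_dim S ?i) (obs_dim S ?i)
      (\<lambda>N n \<omega>. kalman_gain S ?i (sample_cov (comp_dim S ?i) N (\<lambda>l. Xf N l \<omega>)))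
      (\<lambda>N n \<omega>. kalman_gain S ?i (forecast_cov S ?i))"
    by (rule mat_asymp_eq_kalman_gain[OF wf i C psd_sample_cov psd_forecast_cov[OF wf i]])
  note H = mat_asymp_eq_const[OF composite_obs_op_carrier[OF wf i refl]]
  have "vec_asymp_eq (comp_dim S ?i)
      (\<lambda>N n \<omega>. Xf N n \<omega> + kalman_gain S ?i (sample_cov (comp_dim S ?i) N (\<lambda>l. Xf N l \<omega>)) *\<^sub>v
        (obs_data S ?i - W ?i n \<omega> - composite_obs_op S ?i *\<^sub>v Xf N n \<omega>))
      (\<lambda>N n \<omega>. limit_forecast j n \<omega> + kalman_gain S ?i (forecast_cov S ?i) *\<^sub>v
        (obs_data S ?i - W ?i n \<omega> - composite_obs_op S ?i *\<^sub>v limit_forecast j n \<omega>))"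
    by (intro vec_asymp_eq_add(1)[OF Xf] vec_asymp_eq_mult[OF K] vec_asymp_eq_add(2) vec_asymp_eq_mult[OF H Xf]
        input_asymp_eq(3)[OF i] vec_asymp_eq_const model_carriers(4)[OF wf i refl])
  also have "?this \<longleftrightarrow> ?case"
  proof (intro vec_asymp_eq_cong)
    fix N n \<omega> assume n: "1 \<le> (n :: nat)" and \<omega>: "\<omega> \<in> space P"
    show "Xf N n \<omega> + kalman_gain S ?i (sample_cov (comp_dim S ?i) N (\<lambda>l. Xf N l \<omega>)) *\<^sub>v
        (obs_data S ?i - W ?i n \<omega> - composite_obs_op S ?i *\<^sub>v Xf N n \<omega>) = enks S X0 V W N ?i n \<omega>"
      using analysis_eq[OF wf i refl vec_asymp_eqD(1)[OF Xf n \<omega>]] by (simp add: Let_def Xf_def)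
    show "limit_forecast j n \<omega> + kalman_gain S ?i (forecast_cov S ?i) *\<^sub>v
        (obs_data S ?i - W ?i n \<omega> - composite_obs_op S ?i *\<^sub>v limit_forecast j n \<omega>) = limit_ens S X0 V W ?i n \<omega>"
      using analysis_eq[OF wf i refl vec_asymp_eqD(2)[OF Xf n \<omega>]] by simp
  qed
  finally show ?case .
qed

lemma enks_convergence:
  assumes i: "i \<le> horizon S" and p: "1 \<le> p"
  shows "vec_converges_Lp P p (\<lambda>N. enks S X0 V W N i 1) (ref_ens P S X0 V W i 1)"
    "vec_converges_Lp P p (\<lambda>N \<omega>. sample_mean (comp_dim S i) N (\<lambda>n. enks S X0 V W N i n \<omega>))
      (\<lambda>\<omega>. mean_vec P (comp_dim S i) (ref_ens P S X0 V W i 1))"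
    "mat_converges_Lp P p (\<lambda>N \<omega>. sample_cov (comp_dim S i) N (\<lambda>n. enks S X0 V W N i n \<omega>)) (\<lambda>\<omega>. kalman_cov S i)"
proof -
  note ref = ref_ens_eq_limit_ens[OF i] and X = enks_asymp_eq[OF i]
  obtain \<mu> where U: "\<And>n. 1 \<le> n \<Longrightarrow> has_moments (comp_dim S i) (limit_ens S X0 V W i n) \<mu> (kalman_cov S i)"
    using limit_ens_moments[OF i] by blast
  have bl: "limit_ens S X0 V W i n \<in> block (past_block i n) \<rightarrow>\<^sub>M vec_borel (comp_dim S i)" if "1 \<le> n" for n
    by (rule block_limit_ens[OF i order_refl past_block_subset[OF that i]])
  have stats: "mat_asymp_eq (comp_dim S i) (comp_dim S i)
      (\<lambda>N n \<omega>. sample_cov (comp_dim S i) N (\<lambda>l. enks S X0 V W N i l \<omega>)) (\<lambda>N n \<omega>. kalman_cov S i)"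
    "vec_asymp_eq (comp_dim S i) (\<lambda>N n \<omega>. sample_mean (comp_dim S i) N (\<lambda>l. enks S X0 V W N i l \<omega>)) (\<lambda>N n \<omega>. \<mu>)"
    by (rule sample_statistics_asymp_eq[OF indep past_block_subset[OF _ i] past_block_disjoint X U bl]; assumption)+
  show "vec_converges_Lp P p (\<lambda>N. enks S X0 V W N i 1) (ref_ens P S X0 V W i 1)"
    unfolding ref by (rule vec_converges_Lp_if_asymp_eq[OF X p])
  show "vec_converges_Lp P p (\<lambda>N \<omega>. sample_mean (comp_dim S i) N (\<lambda>n. enks S X0 V W N i n \<omega>))
      (\<lambda>\<omega>. mean_vec P (comp_dim S i) (ref_ens P S X0 V W i 1))"
    unfolding ref has_moments_mean_cov(1)[OF U[OF order_refl]]
    by (rule vec_converges_Lp_if_asymp_eq[OF stats(2) p])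
  show "mat_converges_Lp P p (\<lambda>N \<omega>. sample_cov (comp_dim S i) N (\<lambda>n. enks S X0 V W N i n \<omega>)) (\<lambda>\<omega>. kalman_cov S i)"
    by (rule mat_converges_Lp_if_asymp_eq[OF stats(1) p])
qed

section \<open>Exchangeability\<close>

fun permute_input :: "(nat \<Rightarrow> nat) \<Rightarrow> input \<Rightarrow> input" where
  "permute_input \<pi> (Prior n) = Prior (\<pi> n)"
| "permute_input \<pi> (Model_noise i n) = Model_noise i (\<pi> n)"
| "permute_input \<pi> (Obs_noise i n) = Obs_noise i (\<pi> n)"

lemma permutes_pos:
  assumes "\<pi> permutes {1..N}" "1 \<le> n"
  shows "1 \<le> \<pi> n"
proof (cases "n \<in> {1..N}")
  case True
  then show ?thesis using permutes_in_image[OF assms(1), of n] by simp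
next
  case False
  then show ?thesis using assms by (simp add: permutes_not_in)
qed

lemma permute_input_inputs:
  assumes "\<pi> permutes {1..N}"
  shows "permute_input \<pi> \<in> inputs S \<rightarrow> inputs S" "inj_on (permute_input \<pi>) (inputs S)"
    "input_dim S (permute_input \<pi> l) = input_dim S l"
proof -
  show "permute_input \<pi> \<in> inputs S \<rightarrow> inputs S"
    using permutes_pos[OF assms] by (auto simp: inputs_def)
  have "\<pi> n = \<pi> l \<longleftrightarrow> n = l" for n l
    using permutes_inj[OF assms] by (auto dest: injD)
  then show "inj_on (permute_input \<pi>) (inputs S)"
    by (auto simp: inputs_def inj_on_def)
  show "input_dim S (permute_input \<pi> l) = input_dim S l" by (cases l) simp_all
qed

text \<open>Relabelling members keeps the kind and the time step of an input, hence its Gaussian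
  parameters; \<open>distr_vec_borel_eqI\<close> turns equal parameters into equal laws.\<close>

lemma distr_permute_input:
  assumes \<pi>: "\<pi> permutes {1..N}" and l: "l \<in> inputs S"
  shows "distr P (vec_borel (input_dim S l)) (input_vec X0 V W (permute_input \<pi> l)) =
    distr P (vec_borel (input_dim S l)) (input_vec X0 V W l)"
proof -
  have same: "distr P (vec_borel d) Z = distr P (vec_borel d) Z'"
    if "gaussian_vec P d Z \<mu> \<Sigma>" "gaussian_vec P d Z' \<mu> \<Sigma>" for d Z Z' \<mu> \<Sigma>
    using that by (intro distr_vec_borel_eqI prob_space_axioms) (simp_all add: gaussian_vec_def)
  show ?thesis
  proof (cases l)
    case (Prior n)
    with l have n: "1 \<le> n" by (auto simp: inputs_def)
    from same[OF X0[OF permutes_pos[OF \<pi> n]] X0[OF n]] show ?thesis by (simp add: Prior)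
  next
    case (Model_noise i n)
    with l have n: "i \<in> {1..horizon S}" "1 \<le> n" by (auto simp: inputs_def)
    from same[OF V[OF n(1) permutes_pos[OF \<pi> n(2)]] V[OF n]] show ?thesis by (simp add: Model_noise)
  next
    case (Obs_noise i n)
    with l have n: "i \<in> {1..horizon S}" "1 \<le> n" by (auto simp: inputs_def)
    from same[OF W[OF n(1) permutes_pos[OF \<pi> n(2)]] W[OF n]] show ?thesis by (simp add: Obs_noise)
  qed
qed

text \<open>By independence the joint law is the product of the marginal laws over the infinite
  label set. Reindexing along the injective relabelling gives the product of the relabelled
  marginals.\<close>

lemma joint_law_permute:
  assumes \<pi>: "\<pi> permutes {1..N}"
  shows "distr P (\<Pi>\<^sub>M l\<in>inputs S. vec_borel (input_dim S l)) (\<lambda>\<omega>. \<lambda>l\<in>inputs S. input_vec X0 V W (permute_input \<pi> l) \<omega>) =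
    distr P (\<Pi>\<^sub>M l\<in>inputs S. vec_borel (input_dim S l)) (\<lambda>\<omega>. \<lambda>l\<in>inputs S. input_vec X0 V W l \<omega>)"
proof -
  let ?I = "inputs S" and ?B = "\<lambda>l. vec_borel (input_dim S l)" and ?X = "input_vec X0 V W"
  let ?\<sigma> = "permute_input \<pi>"
  define D where "D l = distr P (?B l) (?X l)" for l
  note \<sigma> = permute_input_inputs[OF \<pi>]
  have rv: "random_variable (?B l) (?X l)" if "l \<in> ?I" for l
    using indep that by (auto simp: indep_vars_def2)
  have prob: "prob_space (D l)" if "l \<in> ?I" for l
    unfolding D_def by (rule prob_space_distr[OF rv[OF that]])
  have ne: "?I \<noteq> {}" by (auto simp: inputs_def)
  have joint: "distr P (Pi\<^sub>M ?I ?B) (\<lambda>\<omega>. \<lambda>l\<in>?I. ?X l \<omega>) = Pi\<^sub>M ?I D"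
    unfolding D_def by (rule iffD1[OF indep_vars_iff_distr_eq_PiM' indep]) (use ne rv in blast)+
  \<comment> \<open>This invariance of the marginals identifies the reindexed product with the
    original one.\<close>
  have D\<sigma>: "D (?\<sigma> l) = D l" if "l \<in> ?I" for l
    using distr_permute_input[OF \<pi> that] by (simp add: D_def \<sigma>(3))
  have PD: "(\<Pi>\<^sub>M l\<in>?I. D (?\<sigma> l)) = Pi\<^sub>M ?I D"
    using D\<sigma> by (intro PiM_cong) auto
  have sets_D: "sets (Pi\<^sub>M ?I D) = sets (Pi\<^sub>M ?I ?B)"
    by (rule sets_PiM_cong) (simp_all add: D_def)
  have rX: "(\<lambda>\<omega>. \<lambda>l\<in>?I. ?X l \<omega>) \<in> P \<rightarrow>\<^sub>M Pi\<^sub>M ?I ?B"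
    by (rule measurable_restrict[OF rv])
  have rs: "(\<lambda>x. \<lambda>l\<in>?I. x (?\<sigma> l)) \<in> Pi\<^sub>M ?I ?B \<rightarrow>\<^sub>M Pi\<^sub>M ?I ?B"
  proof (rule measurable_restrict)
    fix l assume "l \<in> ?I"
    then have "?\<sigma> l \<in> ?I" using \<sigma>(1) by auto
    from measurable_component_singleton[OF this, of ?B]
    show "(\<lambda>x. x (?\<sigma> l)) \<in> Pi\<^sub>M ?I ?B \<rightarrow>\<^sub>M ?B l" by (simp add: \<sigma>(3))
  qed
  have "distr P (Pi\<^sub>M ?I ?B) (\<lambda>\<omega>. \<lambda>l\<in>?I. ?X (?\<sigma> l) \<omega>) =
      distr P (Pi\<^sub>M ?I ?B) ((\<lambda>x. \<lambda>l\<in>?I. x (?\<sigma> l)) \<circ> (\<lambda>\<omega>. \<lambda>l\<in>?I. ?X l \<omega>))"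
    using \<sigma>(1) by (intro arg_cong[where f = "distr P (Pi\<^sub>M ?I ?B)"]) (auto simp: fun_eq_iff restrict_def Pi_iff)
  also have "\<dots> = distr (Pi\<^sub>M ?I D) (Pi\<^sub>M ?I ?B) (\<lambda>x. \<lambda>l\<in>?I. x (?\<sigma> l))"
    unfolding joint[symmetric] by (rule distr_distr[OF rs rX, symmetric])
  also have "\<dots> = distr (Pi\<^sub>M ?I D) (\<Pi>\<^sub>M l\<in>?I. D (?\<sigma> l)) (\<lambda>x. \<lambda>l\<in>?I. x (?\<sigma> l))"
    by (intro distr_cong) (simp_all add: PD sets_D)
  also have "\<dots> = (\<Pi>\<^sub>M l\<in>?I. D (?\<sigma> l))"
    by (rule distr_PiM_reindex[OF prob \<sigma>(2,1)])
  finally show ?thesis unfolding PD joint .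
qed

text \<open>The columns are a fixed measurable function G of the input configuration, and permuting
  them amounts to applying G to the relabelled configuration, whose law is unchanged.\<close>

lemma exchangeable_enks:
  assumes i: "i \<le> horizon S"
  shows "exchangeable P (2 * comp_dim S i) N (\<lambda>n \<omega>. enks S X0 V W N i n \<omega> @\<^sub>v ref_ens P S X0 V W i n \<omega>)"
proof -
  let ?I = "inputs S" and ?B = "\<lambda>l. vec_borel (input_dim S l)" and ?X = "input_vec X0 V W"
  let ?T = "\<Pi>\<^sub>M n\<in>{1..N}. vec_borel (2 * comp_dim S i)"
  \<comment> \<open>The recursion is run on the space of input configurations, with the coordinate
    projections as inputs; this produces G.\<close>
  define x0 where "x0 n x = x (Prior n)" for n and x :: "input \<Rightarrow> real vec"
  define v where "v j n x = x (Model_noise j n)" for j n and x :: "input \<Rightarrow> real vec"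
  define w where "w j n x = x (Obs_noise j n)" for j n and x :: "input \<Rightarrow> real vec"
  define Z where "Z n \<omega> = enks S X0 V W N i n \<omega> @\<^sub>v limit_ens S X0 V W i n \<omega>" for n \<omega>
  define G where "G n x = enks S x0 v w N i n x @\<^sub>v limit_ens S x0 v w i n x" for n x
  have Z_meas: "Z n \<in> P \<rightarrow>\<^sub>M vec_borel (2 * comp_dim S i)" if "1 \<le> n" for n
    unfolding Z_def
    by (rule measurable_ensemble_pair[OF wf i that]) (use i X0 V W in \<open>auto simp: gaussian_vec_def\<close>)
  have G_meas: "G n \<in> Pi\<^sub>M ?I ?B \<rightarrow>\<^sub>M vec_borel (2 * comp_dim S i)" if "1 \<le> n" for n
    unfolding G_def
  proof (rule measurable_ensemble_pair[OF wf i that])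
    show "x0 n \<in> Pi\<^sub>M ?I ?B \<rightarrow>\<^sub>M vec_borel (state_dim S)" if "1 \<le> n" for n
      unfolding x0_def using that measurable_component_singleton[of "Prior n" ?I ?B] by (simp add: inputs_def)
    show "v j n \<in> Pi\<^sub>M ?I ?B \<rightarrow>\<^sub>M vec_borel (state_dim S)" if "j \<in> {1..i}" "1 \<le> n" for j n
      unfolding v_def using that i measurable_component_singleton[of "Model_noise j n" ?I ?B] by (simp add: inputs_def)
    show "w j n \<in> Pi\<^sub>M ?I ?B \<rightarrow>\<^sub>M vec_borel (obs_dim S j)" if "j \<in> {1..i}" "1 \<le> n" for j n
      unfolding w_def using that i measurable_component_singleton[of "Obs_noise j n" ?I ?B] by (simp add: inputs_def)
  qed
  have T_meas: "(\<lambda>x. \<lambda>n\<in>{1..N}. G n x) \<in> Pi\<^sub>M ?I ?B \<rightarrow>\<^sub>M ?T"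
    by (rule measurable_restrict) (simp add: G_meas)
  have law: "distr P ?T (\<lambda>\<omega>. \<lambda>n\<in>{1..N}. Z (\<pi> n) \<omega>) =
      distr (distr P (Pi\<^sub>M ?I ?B) (\<lambda>\<omega>. \<lambda>l\<in>?I. ?X l \<omega>)) ?T (\<lambda>x. \<lambda>n\<in>{1..N}. G n x)"
    if \<pi>: "\<pi> permutes {1..N}" for \<pi>
  proof -
    define \<Xi> where "\<Xi> \<omega> = (\<lambda>l\<in>?I. ?X (permute_input \<pi> l) \<omega>)" for \<omega>
    have \<Xi>: "\<Xi> \<in> P \<rightarrow>\<^sub>M Pi\<^sub>M ?I ?B"
      unfolding \<Xi>_def
    proof (rule measurable_restrict)
      fix l assume "l \<in> ?I"
      then have "permute_input \<pi> l \<in> ?I" using permute_input_inputs(1)[OF \<pi>] by auto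
      then have "random_variable (?B (permute_input \<pi> l)) (?X (permute_input \<pi> l))"
        using indep unfolding indep_vars_def2 by blast
      then show "?X (permute_input \<pi> l) \<in> P \<rightarrow>\<^sub>M ?B l"
        by (simp add: permute_input_inputs(3)[OF \<pi>])
    qed
    have "G n (\<Xi> \<omega>) = Z (\<pi> n) \<omega>" if n: "1 \<le> n" for n \<omega>
    proof -
      have "x0 n (\<Xi> \<omega>) = X0 (\<pi> n) \<omega>" if "1 \<le> n" for n
        using that by (simp add: x0_def \<Xi>_def inputs_def)
      moreover have "v j n (\<Xi> \<omega>) = V j (\<pi> n) \<omega>" "w j n (\<Xi> \<omega>) = W j (\<pi> n) \<omega>"
        if "j \<in> {1..i}" "1 \<le> n" for j n
        using that i by (simp_all add: v_def w_def \<Xi>_def inputs_def)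
      ultimately show ?thesis
        using ensembles_permute[OF \<pi>, of x0 "\<Xi> \<omega>" X0 \<omega> i v V w W n] n by (simp add: G_def Z_def)
    qed
    then have "(\<lambda>\<omega>. \<lambda>n\<in>{1..N}. Z (\<pi> n) \<omega>) = (\<lambda>x. \<lambda>n\<in>{1..N}. G n x) \<circ> \<Xi>"
      by (auto simp: fun_eq_iff restrict_def)
    then have "distr P ?T (\<lambda>\<omega>. \<lambda>n\<in>{1..N}. Z (\<pi> n) \<omega>) =
        distr (distr P (Pi\<^sub>M ?I ?B) \<Xi>) ?T (\<lambda>x. \<lambda>n\<in>{1..N}. G n x)"
      by (simp only: distr_distr[OF T_meas \<Xi>])
    also have "distr P (Pi\<^sub>M ?I ?B) \<Xi> = distr P (Pi\<^sub>M ?I ?B) (\<lambda>\<omega>. \<lambda>l\<in>?I. ?X l \<omega>)"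
      unfolding \<Xi>_def by (rule joint_law_permute[OF \<pi>])
    finally show ?thesis .
  qed
  have "exchangeable P (2 * comp_dim S i) N Z"
    unfolding exchangeable_def
  proof (intro conjI ballI allI impI)
    show "Z n \<in> P \<rightarrow>\<^sub>M vec_borel (2 * comp_dim S i)" if "n \<in> {1..N}" for n
      using that by (intro Z_meas) simp
    fix \<pi> assume "\<pi> permutes {1..N}"
    \<comment> \<open>The right side of \<open>law\<close> does not involve the permutation, so the
      given one can be compared with the identity.\<close>
    from law[OF this] law[OF permutes_id]
    show "distr P ?T (\<lambda>\<omega>. \<lambda>n\<in>{1..N}. Z (\<pi> n) \<omega>) = distr P ?T (\<lambda>\<omega>. \<lambda>n\<in>{1..N}. Z n \<omega>)"
      by (simp only: id_apply)
  qed
  moreover have "Z = (\<lambda>n \<omega>. enks S X0 V W N i n \<omega> @\<^sub>v ref_ens P S X0 V W i n \<omega>)"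
    by (simp add: fun_eq_iff Z_def ref_ens_eq_limit_ens[OF i])
  ultimately show ?thesis by simp
qed

end

theorem theorem5p4:
  fixes P :: "'w measure"
    and S :: linear_model
    and X0 :: "nat \<Rightarrow> 'w \<Rightarrow> real vec"
    and V W :: "nat \<Rightarrow> nat \<Rightarrow> 'w \<Rightarrow> real vec"
  assumes "prob_space P"
    and "well_formed_model S"
    and "\<And>n. 1 \<le> n \<Longrightarrow> gaussian_vec P (state_dim S) (X0 n) (prior_mean S) (prior_cov S)"
    and "\<And>i n. i \<in> {1..horizon S} \<Longrightarrow> 1 \<le> n \<Longrightarrow>
           gaussian_vec P (state_dim S) (V i n) (0\<^sub>v (state_dim S)) (model_cov S i)"
    and "\<And>i n. i \<in> {1..horizon S} \<Longrightarrow> 1 \<le> n \<Longrightarrow>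
           gaussian_vec P (obs_dim S i) (W i n) (0\<^sub>v (obs_dim S i)) (obs_cov S i)"
    and "prob_space.indep_vars P (\<lambda>l. vec_borel (input_dim S l)) (input_vec X0 V W) (inputs S)"
  shows "\<forall>i \<le> horizon S.
     (\<forall>N \<ge> 2. exchangeable P (2 * comp_dim S i) N
        (\<lambda>n \<omega>. enks S X0 V W N i n \<omega> @\<^sub>v ref_ens P S X0 V W i n \<omega>)) \<and>
     (\<forall>p::real. 1 \<le> p \<longrightarrow>
        vec_converges_Lp P p (\<lambda>N. enks S X0 V W N i 1) (ref_ens P S X0 V W i 1) \<and>
        vec_converges_Lp P p
          (\<lambda>N \<omega>. sample_mean (comp_dim S i) N (\<lambda>n. enks S X0 V W N i n \<omega>))
          (\<lambda>\<omega>. mean_vec P (comp_dim S i) (ref_ens P S X0 V W i 1)) \<and>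
        mat_converges_Lp P p
          (\<lambda>N \<omega>. sample_cov (comp_dim S i) N (\<lambda>n. enks S X0 V W N i n \<omega>))
          (\<lambda>\<omega>. kalman_cov S i))"
proof -
  interpret prob_space P by fact
  interpret enks_inputs P S X0 V W
    by unfold_locales (use assms in auto)
  show ?thesis
    using exchangeable_enks enks_convergence by blast
qed

end
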